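(* Let $n\ge1$. Consider a family of $n\times n$ switch systems with Bernoulli arrival processes $\mathbf a^{(\epsilon)}(t)$, parameterized by $0<\epsilon<1$, such that every $a_{ij}^{(\epsilon)}(t)$ is Bernoulli with mean $\lambda_{ij}^{(\epsilon)}=\frac{1-\epsilon}{n}$. (i) Fix a scheduling policy under which the switch system is stable for any $0<\epsilon<1$. Let $\mathbf q^{(\epsilon)}(t)$ be the queue length process under this policy, and suppose that it converges in distribution to a steady state random vector $\overline{\mathbf q}^{(\epsilon)}$. Then for each of these systems $$\mathbb E\Big[\sum_{ij}\overline q_{ij}^{(\epsilon)}\Big]\ge\frac{(1-\epsilon)^2}{2\epsilon}(n-1),$$ and therefore $$\liminf_{\epsilon\downarrow0}\epsilon\,\mathbb E\Big[\sum_{ij}\overline q_{ij}^{(\epsilon)}\Big]\ge\frac{n-1}{2}.$$ (ii) Consider the same systems operating under the MaxWeight scheduling algorithm. The queue length process $\mathbf q^{(\epsilon)}(t)$ of each system is positive recurrent and so converges in distribution to a steady state random vector $\overline{\mathbf q}^{(\epsilon)}$. For each system with $0<\epsilon\le\frac1{2n}$, $$\mathbb E\big[\|\overline{\mathbf q}_\perp^{(\epsilon)}\|^r\big]\le(\widetilde M_r)^r\quad\forall r\in\{1,2,\ldots\},\qquad \widetilde M_r=(2\sqrt r\,e)^{1/r}\,16\,\frac re\,n^2(n+1),$$ and, for any $r\in\{2,3,\ldots\}$, $$\frac1\epsilon\Big(n-\frac32+\frac1{2n}\Big)-\widetilde B_1(\epsilon,n)\le\mathbb E\Big[\sum_{ij}\overline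 q_{ij}^{(\epsilon)}\Big]\le\frac1\epsilon\Big(n-\frac32+\frac1{2n}\Big)+\widetilde B_2(\epsilon,n),$$ where $$\widetilde B_1(\epsilon,n)=\Big(1-\frac\epsilon2\Big)\Big(n-2+\frac1n\Big)+n-\frac12+3n^{2-\frac1r}\epsilon^{-\frac1r}\widetilde M_r,$$ $$\widetilde B_2(\epsilon,n)=-\Big(1-\frac\epsilon2\Big)\Big(n-2+\frac1n\Big)+\frac{n+1}2+2n^{2-\frac1r}\epsilon^{-\frac1r}\widetilde M_r .$$ The terms $\widetilde B_1(\epsilon,n)$ and $\widetilde B_2(\epsilon,n)$ are both $o(1/\epsilon)$ as $\epsilon\downarrow0$. In the heavy traffic limit, $$\lim_{\epsilon\downarrow0}\epsilon\,\mathbb E\Big[\sum_{ij}\overline q_{ij}^{(\epsilon)}\Big]=n-\frac32+\frac1{2n}.$$ Thus MaxWeight has optimal queue length scaling in the heavy traffic limit (this limit is $O(n)$, the same order in $n$ as the universal lower bound $\frac{n-1}{2}$ of part (i)).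
   Context: Vectors $x=(x_{ij})_{1\le i,j\le n}$ live in $\mathbb R^{n^2}$ with inner product $\langle x,y\rangle=\sum_{ij}x_{ij}y_{ij}$ and Euclidean norm $\|x\|$. Switch model (discrete time). $q_{ij}(t)\in\mathbb Z_+$ is the queue length for the input-output pair $(i,j)$, $a_{ij}(t)$ is the number of arrivals to it in slot $t$. Arrivals are i.i.d. across $t$, independent across pairs $(i,j)$, and independent of the queue lengths and schedules. Feasible schedules: $\mathcal S=\{s\in\{0,1\}^{n^2}:\sum_i s_{ij}\le1\ \forall j,\ \sum_j s_{ij}\le1\ \forall i\}$; maximal schedules: $\mathcal S^*=\{s\in\{0,1\}^{n^2}:\sum_i s_{ij}=1\ \forall j,\ \sum_j s_{ij}=1\ \forall i\}$. A scheduling policy picks $\mathbf s(t)\in\mathcal S$ in every slot based on the current queue length vector $\mathbf q(t)$, before the arrivals $\mathbf a(t)$ occur. Queues evolve as $q_{ij}(t+1)=[q_{ij}(t)+a_{ij}(t)-s_{ij}(t)]^+$, and $\mathbf q(t)$ is a Markov chain. The switch is stable under a policy if $\limsup_{C\to\infty}\limsup_{t\to\infty}\mathbb P(\sum_{ij}q_{ij}(t)\ge C)=0$. MaxWeight algorithm: $\mathbf s(t)\in\arg\max_{s\in\mathcal S}\langle \mathbf q(t),s\rangle$, ties broken uniformly at random; the chosen schedule is always taken to be a maximal one, $\mathbf s(t)\in\mathcal S^*$ (the maximum over $\mathcal S$ is always attained in $\mathcal S^*$). Under it, $\mathbf q(t)$ is irreducible and aperiodic on the appropriate state space. Cone and projection: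 $\mathcal K=\{x\in\mathbb R^{n^2}: x_{ij}=w_i+\widetilde w_j \text{ for all } i,j, \text{ for some } w_i,\widetilde w_j\in\mathbb R_+\}$, a closed convex cone. For $x\in\mathbb R^{n^2}$, $x_\parallel=\arg\min_{y\in\mathcal K}\|x-y\|$ is the projection onto $\mathcal K$ and $x_\perp=x-x_\parallel$. *)

theory Defs
  imports "HOL-Probability.Probability" "HOL-Library.Landau_Symbols"
begin

section \<open>Discrete-time Markov chains with transition kernel \<open>K\<close>\<close>

primrec chain_law :: "('a \<Rightarrow> 'a pmf) \<Rightarrow> 'a pmf \<Rightarrow> nat \<Rightarrow> 'a pmf" where
  "chain_law K \<mu> 0 = \<mu>"
| "chain_law K \<mu> (Suc t) = bind_pmf (chain_law K \<mu> t) K"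

definition stationary :: "('a \<Rightarrow> 'a pmf) \<Rightarrow> 'a pmf \<Rightarrow> bool" where
  "stationary K \<pi> \<longleftrightarrow> bind_pmf \<pi> K = \<pi>"

definition converges_in_distribution ::
    "(nat \<Rightarrow> 'a::topological_space pmf) \<Rightarrow> 'a pmf \<Rightarrow> bool" where
  "converges_in_distribution \<mu> \<pi> \<longleftrightarrow>
     (\<forall>f :: 'a \<Rightarrow> real. continuous_on UNIV f \<and> bounded (range f) \<longrightarrow>
        (\<lambda>t. measure_pmf.expectation (\<mu> t) f) \<longlonglongrightarrow> measure_pmf.expectation \<pi> f)"

definition accessible :: "('a \<Rightarrow> 'a pmf) \<Rightarrow> ('a \<times> 'a) set" where
  "accessible K = {(x, y). y \<in> set_pmf (K x)}\<^sup>*"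

text \<open>\<open>first_passage K x t y\<close> is the probability that the chain started in \<open>y\<close> visits
  \<open>x\<close> for the first time after time 0 exactly at time \<open>t\<close>.\<close>

primrec first_passage :: "('a \<Rightarrow> 'a pmf) \<Rightarrow> 'a \<Rightarrow> nat \<Rightarrow> 'a \<Rightarrow> real" where
  "first_passage K x 0 y = 0"
| "first_passage K x (Suc t) y =
     measure_pmf.expectation (K y)
       (\<lambda>z. if z = x then of_bool (t = 0) else first_passage K x t z)"

definition positive_recurrent_state :: "('a \<Rightarrow> 'a pmf) \<Rightarrow> 'a \<Rightarrow> bool" where
  "positive_recurrent_state K x \<longleftrightarrow>
     (\<lambda>t. first_passage K x t x) sums 1 \<and>
     summable (\<lambda>t. real t * first_passage K x t x)"

definition positive_recurrent_on :: "('a \<Rightarrow> 'a pmf) \<Rightarrow> 'a set \<Rightarrow> bool" where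
  "positive_recurrent_on K X \<longleftrightarrow>
     (\<forall>x\<in>X. set_pmf (K x) \<subseteq> X) \<and>
     (\<forall>x\<in>X. \<forall>y\<in>X. (x, y) \<in> accessible K) \<and>
     (\<forall>x\<in>X. positive_recurrent_state K x)"


section \<open>The switch\<close>

text \<open>Queue lengths, arrivals and schedules of an $n \times n$ switch, with
  \<open>n = CARD('n)\<close>; component \<open>q $ i $ j\<close> belongs to the input-output pair \<open>(i, j)\<close>.\<close>

type_synonym 'n switch_vec = "nat ^ 'n ^ 'n"

type_synonym 'n switch_policy = "'n switch_vec \<Rightarrow> 'n switch_vec pmf"

definition real_vec :: "'n::finite switch_vec \<Rightarrow> real ^ 'n ^ 'n" where
  "real_vec q = (\<chi> i j. real (q $ i $ j))"

definition total_queue :: "'n::finite switch_vec \<Rightarrow> nat" where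
  "total_queue q = (\<Sum>i\<in>UNIV. \<Sum>j\<in>UNIV. q $ i $ j)"

definition schedules :: "'n::finite switch_vec set" where
  "schedules = {s. (\<forall>i j. s $ i $ j \<in> {0, 1}) \<and>
     (\<forall>j. (\<Sum>i\<in>UNIV. s $ i $ j) \<le> 1) \<and> (\<forall>i. (\<Sum>j\<in>UNIV. s $ i $ j) \<le> 1)}"

definition maximal_schedules :: "'n::finite switch_vec set" where
  "maximal_schedules = {s. (\<forall>i j. s $ i $ j \<in> {0, 1}) \<and>
     (\<forall>j. (\<Sum>i\<in>UNIV. s $ i $ j) = 1) \<and> (\<forall>i. (\<Sum>j\<in>UNIV. s $ i $ j) = 1)}"

text \<open>A policy may randomise: it maps the current queue length vector to the conditional law
  of the schedule.\<close>

definition scheduling_policy :: "'n::finite switch_policy \<Rightarrow> bool" where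
  "scheduling_policy P \<longleftrightarrow> (\<forall>q. set_pmf (P q) \<subseteq> schedules)"

definition bernoulli_arrivals :: "real ^ 'n ^ 'n \<Rightarrow> 'n::finite switch_vec pmf" where
  "bernoulli_arrivals rate =
     map_pmf (\<lambda>b. \<chi> i j. of_bool (b (i, j)))
       (Pi_pmf UNIV False (\<lambda>(i, j). bernoulli_pmf (rate $ i $ j)))"

text \<open>One slot: the schedule \<open>s\<close> is chosen from \<open>q\<close>, then fresh arrivals \<open>a\<close> occur
  independently of \<open>q\<close> and \<open>s\<close>. Subtraction is componentwise and truncated on \<^typ>\<open>nat\<close>, so
  \<open>q + a - s\<close> has components $[q_{ij} + a_{ij} - s_{ij}]^+$.\<close>

definition switch_kernel ::
    "'n::finite switch_policy \<Rightarrow> real ^ 'n ^ 'n \<Rightarrow> 'n switch_vec \<Rightarrow> 'n switch_vec pmf" where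
  "switch_kernel P rate q =
     bind_pmf (P q) (\<lambda>s. map_pmf (\<lambda>a. q + a - s) (bernoulli_arrivals rate))"

definition switch_stable :: "(nat \<Rightarrow> 'n::finite switch_vec pmf) \<Rightarrow> bool" where
  "switch_stable \<mu> \<longleftrightarrow>
     Limsup at_top (\<lambda>C :: real. limsup (\<lambda>t.
       ereal (measure_pmf.prob (\<mu> t) {q. real (total_queue q) \<ge> C}))) = 0"

definition max_weight :: "'n::finite switch_policy" where
  "max_weight q = pmf_of_set
     {s \<in> maximal_schedules.
        \<forall>s'\<in>schedules. real_vec q \<bullet> real_vec s' \<le> real_vec q \<bullet> real_vec s}"

definition uniform_rate :: "real \<Rightarrow> real ^ 'n ^ 'n::finite" where
  "uniform_rate \<epsilon> = (\<chi> i j. (1 - \<epsilon>) / real CARD('n))"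

definition switch_cone :: "(real ^ 'n ^ 'n::finite) set" where
  "switch_cone = {x. \<exists>w w' :: 'n \<Rightarrow> real.
     (\<forall>i. 0 \<le> w i) \<and> (\<forall>j. 0 \<le> w' j) \<and> (\<forall>i j. x $ i $ j = w i + w' j)}"

definition perp :: "real ^ 'n ^ 'n \<Rightarrow> real ^ 'n ^ 'n::finite" where
  "perp x = x - closest_point switch_cone x"


section \<open>Constants in the bounds\<close>

definition M_bound :: "nat \<Rightarrow> nat \<Rightarrow> real" where
  "M_bound n r = (2 * sqrt (real r) * exp 1) powr (1 / real r) *
     16 * (real r / exp 1) * real n ^ 2 * (real n + 1)"

definition B1_bound :: "nat \<Rightarrow> nat \<Rightarrow> real \<Rightarrow> real" where
  "B1_bound n r \<epsilon> = (1 - \<epsilon> / 2) * (real n - 2 + 1 / real n) + real n - 1 / 2 +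
     3 * real n powr (2 - 1 / real r) * \<epsilon> powr (- 1 / real r) * M_bound n r"

definition B2_bound :: "nat \<Rightarrow> nat \<Rightarrow> real \<Rightarrow> real" where
  "B2_bound n r \<epsilon> = - (1 - \<epsilon> / 2) * (real n - 2 + 1 / real n) + (real n + 1) / 2 +
     2 * real n powr (2 - 1 / real r) * \<epsilon> powr (- 1 / real r) * M_bound n r"

end

theory Submission
  imports Defs "HOL-Real_Asymp.Real_Asymp"
begin

text \<open>Every bound comes from the vanishing of a stationary drift.

  For an arbitrary policy, the workload \<open>X\<close> of one input dominates a unit-rate single-server queue
  fed by its \<open>n\<close> Bernoulli streams; the drift of \<open>X\<^sup>2\<close> gives the Kingman-type lower bound per
  input, and summing over inputs gives (i).

  For MaxWeight, a doubly substochastic matrix never outweighs the chosen schedule (Birkhoff), so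
  \<open>\<parallel>q\<parallel>\<^sup>2\<close> has drift \<open>A - B \<parallel>q\<parallel>\<close>, which makes \<open>cosh (\<theta> \<parallel>q\<parallel>)\<close> a geometric Lyapunov function and the
  chain geometrically ergodic. Testing against \<open>1/n + q\<^sub>\<bottom> / (n \<parallel>q\<^sub>\<bottom>\<parallel>)\<close>, which is substochastic because
  \<open>q\<^sub>\<bottom>\<close> lies in the polar cone, gives \<open>\<parallel>q\<^sub>\<bottom>\<parallel>\<^sup>2\<close> such a drift uniformly in \<open>\<epsilon>\<close>, hence an exponential
  moment and the state space collapse. Finally the quadratic form \<open>mform\<close>, the sum of squared row
  and column sums minus \<open>1/n\<close> times the squared total, is \<open>n\<close> times the inner product on the span of
  the cone; since unused service is orthogonal to the next queue vector, its contribution to the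
  drift of the form is controlled by \<open>q\<^sub>\<bottom>\<close> alone.\<close>

section \<open>Expectations and drift of Markov chains on countable spaces\<close>

text \<open>The limit constant is a trace. The span of the cone has dimension 2n - 1, and near
  \<epsilon> = 0 the centred arrivals have covariance close to (1/n)(1 - 1/n) times the identity, so
  the form of one increment has mean close to (2n - 1)(1 - 1/n); half of this is n - 3/2 + 1/(2n).

  A Hoelder estimate with exponent r combines them into the order \<epsilon> powr (1 - 1/r), which
  after division by \<epsilon> is o(1/\<epsilon>); a larger r improves the power of \<epsilon> but
  enlarges the constant.

  A stationary drift vanishes only for integrable functions, so moments of the limit law have to be
  secured beforehand by truncating Lyapunov functions. For an arbitrary policy even the mean queue
  is not known to be finite, which is why (i) is stated in the extended nonnegative reals.\<close>

lemma expectation_bind_pmf_nonneg: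
  fixes f :: "'b \<Rightarrow> real"
  assumes nn: "\<And>y. 0 \<le> f y" and int: "\<And>x. integrable (measure_pmf (K x)) f"
  shows "integrable (measure_pmf (bind_pmf p K)) f \<longleftrightarrow>
      integrable (measure_pmf p) (\<lambda>x. measure_pmf.expectation (K x) f)"
    and "measure_pmf.expectation (bind_pmf p K) f
      = measure_pmf.expectation p (\<lambda>x. measure_pmf.expectation (K x) f)"
proof -
  have eq: "(\<integral>\<^sup>+y. ennreal (f y) \<partial>measure_pmf (bind_pmf p K)) =
      (\<integral>\<^sup>+x. ennreal (measure_pmf.expectation (K x) f) \<partial>measure_pmf p)"
    using nn int by (simp add: nn_integral_eq_integral)
  have nn': "0 \<le> measure_pmf.expectation (K x) f" for x
    using nn by simp
  show "integrable (measure_pmf (bind_pmf p K)) f \<longleftrightarrow>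
      integrable (measure_pmf p) (\<lambda>x. measure_pmf.expectation (K x) f)"
    using nn nn' eq by (simp add: integrable_iff_bounded)
  show "measure_pmf.expectation (bind_pmf p K) f
      = measure_pmf.expectation p (\<lambda>x. measure_pmf.expectation (K x) f)"
    using nn nn' eq by (simp add: integral_eq_nn_integral)
qed

text \<open>Reduction to Tonelli for the positive and the negative part. Integrability against the
  mixture is a separate hypothesis: the inner expectations of a signed function may cancel, so it
  does not follow from theirs.\<close>

lemma expectation_bind_pmf:
  fixes f :: "'b \<Rightarrow> real"
  assumes int: "\<And>x. integrable (measure_pmf (K x)) f"
    and bind: "integrable (measure_pmf (bind_pmf p K)) f"
  shows "integrable (measure_pmf p) (\<lambda>x. measure_pmf.expectation (K x) f)" (is ?I)
    and "measure_pmf.expectation (bind_pmf p K) f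
      = measure_pmf.expectation p (\<lambda>x. measure_pmf.expectation (K x) f)" (is ?E)
proof -
  let ?g = "\<lambda>y. max (f y) 0" and ?h = "\<lambda>y. max (- f y) 0"
  have f: "f = (\<lambda>y. ?g y - ?h y)" by auto
  have ig: "integrable (measure_pmf (K x)) ?g" "integrable (measure_pmf (K x)) ?h" for x
    using int by auto
  have ib: "integrable (measure_pmf (bind_pmf p K)) ?g" "integrable (measure_pmf (bind_pmf p K)) ?h"
    using bind by auto
  have E: "measure_pmf.expectation (K x) f
      = measure_pmf.expectation (K x) ?g - measure_pmf.expectation (K x) ?h" for x
    by (subst f) (rule Bochner_Integration.integral_diff[OF ig])
  note G = expectation_bind_pmf_nonneg[of ?g K p, OF _ ig(1)]
    and H = expectation_bind_pmf_nonneg[of ?h K p, OF _ ig(2)]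
  have ip: "integrable (measure_pmf p) (\<lambda>x. measure_pmf.expectation (K x) ?g)"
     "integrable (measure_pmf p) (\<lambda>x. measure_pmf.expectation (K x) ?h)"
    using G(1) H(1) ib by auto
  show ?I unfolding E using ip by simp
  have "measure_pmf.expectation (bind_pmf p K) f
      = measure_pmf.expectation (bind_pmf p K) ?g - measure_pmf.expectation (bind_pmf p K) ?h"
    by (subst f) (rule Bochner_Integration.integral_diff[OF ib])
  also have "\<dots> = measure_pmf.expectation p (\<lambda>x. measure_pmf.expectation (K x) ?g)
     - measure_pmf.expectation p (\<lambda>x. measure_pmf.expectation (K x) ?h)"
    using G(2) H(2) by simp
  also have "\<dots> = measure_pmf.expectation p (\<lambda>x. measure_pmf.expectation (K x) f)"
    unfolding E by (rule Bochner_Integration.integral_diff[OF ip, symmetric])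
  finally show ?E .
qed

lemma integrable_pmf_bounded:
  fixes f :: "'a \<Rightarrow> real"
  assumes "\<And>x. \<bar>f x\<bar> \<le> B"
  shows "integrable (measure_pmf p) f"
  by (rule measure_pmf.integrable_const_bound[where B=B]) (use assms in auto)

lemma abs_expectation_pmf_le:
  fixes f :: "'a \<Rightarrow> real"
  assumes "\<And>x. \<bar>f x\<bar> \<le> B"
  shows "\<bar>measure_pmf.expectation p f\<bar> \<le> B"
proof -
  have "\<bar>measure_pmf.expectation p f\<bar> \<le> measure_pmf.expectation p (\<lambda>x. \<bar>f x\<bar>)" by simp
  also have "\<dots> \<le> measure_pmf.expectation p (\<lambda>x. B)"
    by (rule integral_mono) (use assms in \<open>auto intro!: integrable_pmf_bounded[where B=B]\<close>)
  finally show ?thesis by simp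
qed

lemma expectation_bind_pmf_bounded:
  fixes f :: "'b \<Rightarrow> real"
  assumes "\<And>y. \<bar>f y\<bar> \<le> B"
  shows "measure_pmf.expectation (bind_pmf p K) f
      = measure_pmf.expectation p (\<lambda>x. measure_pmf.expectation (K x) f)"
  by (rule expectation_bind_pmf(2); rule integrable_pmf_bounded[OF assms])

text \<open>Truncating a Lyapunov function at level \<open>M\<close> keeps it integrable, and the truncated
  drift is nonpositive above the level.\<close>

lemma stationary_drift_bound:
  fixes F f :: "'a \<Rightarrow> real"
  assumes st: "stationary K \<pi>" and fin: "\<And>x. finite (set_pmf (K x))"
    and F: "\<And>x. 0 \<le> F x" and f: "\<And>x. 0 \<le> f x" and g: "0 \<le> g"
    and drift: "\<And>x. measure_pmf.expectation (K x) F + f x \<le> F x + g"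
  shows "integrable (measure_pmf \<pi>) f" and "measure_pmf.expectation \<pi> f \<le> g"
proof -
  have trunc: "measure_pmf.expectation \<pi> (\<lambda>x. if F x \<le> real M then f x else 0) \<le> g"
    and itr: "integrable (measure_pmf \<pi>) (\<lambda>x. if F x \<le> real M then f x else 0)" for M :: nat
  proof -
    let ?F = "\<lambda>x. min (F x) (real M)"
    have bF: "\<bar>?F x\<bar> \<le> real M" for x using F[of x] by auto
    have bK: "\<bar>measure_pmf.expectation (K x) ?F\<bar> \<le> real M" for x
      by (rule abs_expectation_pmf_le[OF bF])
    \<comment> \<open>Where F \<le> M the drift inequality itself bounds f, by F + g, since the
      expectation of F is nonnegative.\<close>
    have bf: "\<bar>if F x \<le> real M then f x else 0\<bar> \<le> real M + g" for x
    proof -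
      have "0 \<le> measure_pmf.expectation (K x) F" using F by simp
      then show ?thesis using drift[of x] f[of x] g by auto
    qed
    show itr: "integrable (measure_pmf \<pi>) (\<lambda>x. if F x \<le> real M then f x else 0)"
      by (rule integrable_pmf_bounded[OF bf])
    have "measure_pmf.expectation \<pi> ?F = measure_pmf.expectation (bind_pmf \<pi> K) ?F"
      using st by (simp add: stationary_def)
    also have "\<dots> = measure_pmf.expectation \<pi> (\<lambda>x. measure_pmf.expectation (K x) ?F)"
      by (rule expectation_bind_pmf_bounded[OF bF])
    finally have eq: "measure_pmf.expectation \<pi> ?F
        = measure_pmf.expectation \<pi> (\<lambda>x. measure_pmf.expectation (K x) ?F)" .
    \<comment> \<open>For F x \<le> M this is the given drift; for F x > M the truncated expectation
      is at most M, which is the truncated value at x.\<close>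
    have le: "measure_pmf.expectation (K x) ?F \<le> ?F x + g - (if F x \<le> real M then f x else 0)" for x
    proof -
      have "measure_pmf.expectation (K x) ?F \<le> measure_pmf.expectation (K x) F"
        by (rule integral_mono) (auto intro!: integrable_measure_pmf_finite fin)
      moreover have "measure_pmf.expectation (K x) ?F \<le> real M" using bK[of x] by auto
      ultimately show ?thesis using drift[of x] f[of x] g by auto
    qed
    have "measure_pmf.expectation \<pi> (\<lambda>x. measure_pmf.expectation (K x) ?F) \<le>
      measure_pmf.expectation \<pi> (\<lambda>x. ?F x + g - (if F x \<le> real M then f x else 0))"
      by (rule integral_mono[OF _ _ le])
        (use itr in \<open>auto intro!: integrable_pmf_bounded[OF bK] integrable_pmf_bounded[OF bF]\<close>)
    also have "\<dots> = measure_pmf.expectation \<pi> ?F + g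
        - measure_pmf.expectation \<pi> (\<lambda>x. if F x \<le> real M then f x else 0)"
      using itr integrable_pmf_bounded[OF bF, of \<pi>] by simp
    finally show "measure_pmf.expectation \<pi> (\<lambda>x. if F x \<le> real M then f x else 0) \<le> g"
      using eq by simp
  qed
  have lim: "(\<lambda>M. if F x \<le> real M then f x else 0) \<longlonglongrightarrow> f x" for x
  proof (rule tendsto_eventually)
    obtain N where "F x \<le> real N" using real_arch_simple by blast
    then show "eventually (\<lambda>M. (if F x \<le> real M then f x else 0) = f x) sequentially"
      by (auto simp: eventually_sequentially intro!: exI[of _ N])
  qed
  have "(\<integral>\<^sup>+x. ennreal (f x) \<partial>measure_pmf \<pi>) =
     (\<integral>\<^sup>+x. liminf (\<lambda>M. ennreal (if F x \<le> real M then f x else 0)) \<partial>measure_pmf \<pi>)"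
  proof (rule nn_integral_cong)
    fix x
    have "(\<lambda>M. ennreal (if F x \<le> real M then f x else 0)) \<longlonglongrightarrow> ennreal (f x)"
      by (rule tendsto_ennrealI[OF lim])
    then show "ennreal (f x) = liminf (\<lambda>M. ennreal (if F x \<le> real M then f x else 0))"
      by (simp add: lim_imp_Liminf)
  qed
  also have "\<dots> \<le> liminf (\<lambda>M. \<integral>\<^sup>+x. ennreal (if F x \<le> real M then f x else 0) \<partial>measure_pmf \<pi>)"
    by (rule nn_integral_liminf) simp
  also have "\<dots> \<le> liminf (\<lambda>M::nat. ennreal g)"
  proof (intro Liminf_mono always_eventually allI)
    fix M :: nat
    have "(\<integral>\<^sup>+x. ennreal (if F x \<le> real M then f x else 0) \<partial>measure_pmf \<pi>)
      = ennreal (measure_pmf.expectation \<pi> (\<lambda>x. if F x \<le> real M then f x else 0))"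
      by (rule nn_integral_eq_integral[OF itr]) (use f in auto)
    also have "\<dots> \<le> ennreal g" by (rule ennreal_leI[OF trunc])
    finally show "(\<integral>\<^sup>+x. ennreal (if F x \<le> real M then f x else 0) \<partial>measure_pmf \<pi>) \<le> ennreal g" .
  qed
  also have "\<dots> = ennreal g" by (simp add: Liminf_const)
  finally have le: "(\<integral>\<^sup>+x. ennreal (f x) \<partial>measure_pmf \<pi>) \<le> ennreal g" .
  show int: "integrable (measure_pmf \<pi>) f"
    using le f by (intro integrableI_bounded) (auto simp: order_le_less_trans[OF le])
  show "measure_pmf.expectation \<pi> f \<le> g"
    using le nn_integral_eq_integral[OF int] f g by (simp add: ennreal_le_iff)
qed

section \<open>Geometric ergodicity\<close>

abbreviation (input) kpow :: "('a \<Rightarrow> 'a pmf) \<Rightarrow> nat \<Rightarrow> 'a \<Rightarrow> 'a pmf" where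
  "kpow K t x \<equiv> chain_law K (return_pmf x) t"

lemma chain_law_eq_bind_kpow: "chain_law K \<mu> t = bind_pmf \<mu> (kpow K t)"
  by (induction t) (simp_all add: bind_return_pmf' bind_assoc_pmf)

lemma kpow_add: "kpow K (s + t) x = bind_pmf (kpow K s x) (kpow K t)"
  by (induction t) (simp_all add: bind_return_pmf' bind_assoc_pmf)

lemma finite_set_kpow:
  assumes "\<And>x. finite (set_pmf (K x))"
  shows "finite (set_pmf (kpow K t x))"
  by (induction t) (use assms in auto)

text \<open>Minorisation by a single atom; on a countable space this takes the place of a minorising
  measure.\<close>

lemma expectation_ge_pmf_mult:
  fixes h :: "'a \<Rightarrow> real"
  assumes "\<And>y. 0 \<le> h y" and "integrable (measure_pmf p) h"
  shows "pmf p x * h x \<le> measure_pmf.expectation p h"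
proof -
  have "pmf p x * h x = measure_pmf.expectation p (\<lambda>y. h y * indicator {x} y)"
    by (subst integral_measure_pmf_real[of "{x}"]) (auto simp: indicator_def split: if_splits)
  also have "\<dots> \<le> measure_pmf.expectation p h"
    by (rule integral_mono) (use assms in \<open>auto split: split_indicator intro!: integrable_real_mult_indicator\<close>)
  finally show ?thesis .
qed

lemma accessible_imp_kpow:
  assumes "(x, y) \<in> accessible K"
  shows "\<exists>t. y \<in> set_pmf (kpow K t x)"
  using assms unfolding accessible_def
proof (induction rule: rtrancl_induct)
  case base
  show ?case by (rule exI[of _ 0]) simp
next
  case (step y z)
  then obtain t where "y \<in> set_pmf (kpow K t x)" by blast
  then show ?case using step(2) by (intro exI[of _ "Suc t"]) auto
qed

text \<open>The numerical core of Harris' theorem, used both for convergence and for return times.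
  The value \<gamma> v + D comes from the drift of V, and \<delta> is the mass gained by coupling or
  lost by killing. For large v the drift alone contracts the weight 1 + \<beta> v; the second
  inequality holds for all v but has to spend \<delta>.\<close>

lemma minorization_constants:
  fixes g D \<delta> :: real
  assumes g: "0 \<le> g" "g < 1" and D: "0 \<le> D" and \<delta>: "0 < \<delta>"
  shows "\<exists>\<beta>>0. \<exists>\<alpha>. \<alpha> < 1 \<and> 0 \<le> \<alpha> \<and> (\<forall>v\<ge>0.
     ((4 * D + 4) / (1 - g) \<le> v \<longrightarrow> 1 + \<beta> * (g * v + D) \<le> \<alpha> * (1 + \<beta> * v)) \<and>
     1 - \<delta> + \<beta> * (g * v + D) \<le> \<alpha> * (1 + \<beta> * v))"
proof -
  \<comment> \<open>This choice makes \<beta> D at most \<delta>/2; the other half of \<delta> pays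
    for \<eta>.\<close>
  define \<beta> where "\<beta> = \<delta> / (2 * (D + 1))"
  define \<eta> where "\<eta> = min (min ((1 - g) / 4) \<beta>) (\<delta> / 2)"
  have \<beta>: "0 < \<beta>" using D \<delta> by (simp add: \<beta>_def)
  have \<beta>D: "\<beta> * D \<le> \<delta> / 2"
    using D \<delta> by (simp add: \<beta>_def field_simps)
  have \<eta>: "0 < \<eta>" "\<eta> \<le> (1 - g) / 4" "\<eta> \<le> \<beta>" "\<eta> \<le> \<delta> / 2"
    using g \<beta> \<delta> by (auto simp: \<eta>_def min_def)
  have 1: "1 + \<beta> * (g * v + D) \<le> (1 - \<eta>) * (1 + \<beta> * v)"
    if v: "0 \<le> v" "(4 * D + 4) / (1 - g) \<le> v" for v
  proof -
    have "4 * D + 4 \<le> (1 - g) * v" using v(2) g by (simp add: field_simps)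
    then have "\<beta> * (4 * D + 4) \<le> \<beta> * ((1 - g) * v)" using \<beta> by (intro mult_left_mono) auto
    moreover have "\<eta> * (\<beta> * v) \<le> (1 - g) / 4 * (\<beta> * v)"
      using \<eta> \<beta> v by (intro mult_right_mono) auto
    moreover have "0 \<le> \<beta> * D" using \<beta> D by simp
    ultimately show ?thesis using \<eta>(3) \<beta> by (simp add: algebra_simps)
  qed
  have 2: "1 - \<delta> + \<beta> * (g * v + D) \<le> (1 - \<eta>) * (1 + \<beta> * v)" if v: "0 \<le> v" for v
  proof -
    have "\<eta> * (\<beta> * v) \<le> (1 - g) / 4 * (\<beta> * v)"
      using \<eta> \<beta> v by (intro mult_right_mono) auto
    moreover have "0 \<le> (1 - g) * (\<beta> * v)" using g \<beta> v by simp
    ultimately show ?thesis using \<eta>(4) \<beta>D by (simp add: algebra_simps)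
  qed
  show ?thesis
    using \<beta> \<eta> g 1 2 by (intro exI[of _ \<beta>] conjI exI[of _ "1 - \<eta>"] allI impI) auto
qed

text \<open>Passes from a weighted oscillation to a weighted sup norm about a constant: the
  hypothesis says that every h - W lies below every h + W, so a number separates them.\<close>

lemma centre_of_oscillation:
  fixes h W :: "'a \<Rightarrow> real"
  assumes "\<And>x y. h x - h y \<le> W x + W y"
  shows "\<exists>c. \<forall>x. \<bar>h x - c\<bar> \<le> W x"
proof -
  define c where "c = (SUP x. h x - W x)"
  have "h x - W x \<le> c" for x
    unfolding c_def by (rule cSUP_upper) (use assms in \<open>auto intro!: bdd_aboveI2[where M="h x + W x"] simp: algebra_simps\<close>)
  moreover have "c \<le> h y + W y" for y
    unfolding c_def by (rule cSUP_least) (use assms in \<open>auto simp: algebra_simps\<close>)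
  ultimately have "\<bar>h x - c\<bar> \<le> W x" for x by (smt (verit))
  then show ?thesis by blast
qed

text \<open>The hypotheses of Harris' theorem with an atom. The self-loop at \<open>base\<close>
  gives aperiodicity. Only reachability of \<open>base\<close> is demanded, so transient states
  outside its class are allowed.\<close>

locale geometric_drift =
  fixes K :: "'a \<Rightarrow> 'a pmf" and V :: "'a \<Rightarrow> real" and \<gamma> C :: real and base :: 'a
  assumes finite_support: "\<And>x. finite (set_pmf (K x))"
    and V_nonneg: "\<And>x. 0 \<le> V x"
    and \<gamma>: "0 \<le> \<gamma>" "\<gamma> < 1" and C: "0 \<le> C"
    and drift: "\<And>x. measure_pmf.expectation (K x) V \<le> \<gamma> * V x + C"
    and finite_sublevel: "\<And>R. finite {x. V x \<le> R}"
    and reach_base: "\<And>x. (x, base) \<in> accessible K"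
    and base_loop: "base \<in> set_pmf (K base)"
begin

text \<open>The fixed point of v \<mapsto> \<gamma> v + C: with it the additive constant in the
  drift over t steps does not grow with t.\<close>

definition "D = C / (1 - \<gamma>)"

lemma D_nonneg: "0 \<le> D" using \<gamma> C by (simp add: D_def)

lemma integrable_kpow: "integrable (measure_pmf (kpow K t x)) (f :: 'a \<Rightarrow> real)"
  by (rule integrable_measure_pmf_finite[OF finite_set_kpow[OF finite_support]])

lemma expectation_kpow_add:
  fixes f :: "'a \<Rightarrow> real"
  shows "measure_pmf.expectation (kpow K (s + t) x) f
     = measure_pmf.expectation (kpow K s x) (\<lambda>y. measure_pmf.expectation (kpow K t y) f)"
  unfolding kpow_add
  by (rule expectation_bind_pmf(2)) (auto intro: integrable_kpow simp flip: kpow_add)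

lemma kpow_drift: "measure_pmf.expectation (kpow K t x) V \<le> \<gamma> ^ t * V x + D"
proof (induction t)
  case 0
  then show ?case using D_nonneg by simp
next
  case (Suc t)
  have "measure_pmf.expectation (kpow K (Suc t) x) V
      = measure_pmf.expectation (kpow K t x) (\<lambda>y. measure_pmf.expectation (K y) V)"
    using expectation_kpow_add[where s=t and t=1 and x=x and f=V] by (simp add: bind_return_pmf)
  also have "\<dots> \<le> measure_pmf.expectation (kpow K t x) (\<lambda>y. \<gamma> * V y + C)"
    by (rule integral_mono) (auto intro: integrable_kpow drift)
  also have "\<dots> = \<gamma> * measure_pmf.expectation (kpow K t x) V + C"
    using integrable_kpow by simp
  also have "\<dots> \<le> \<gamma> * (\<gamma> ^ t * V x + D) + C"
    using Suc \<gamma> by (intro add_mono mult_left_mono) auto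
  also have "\<dots> = \<gamma> ^ Suc t * V x + D"
    using \<gamma> by (simp add: D_def field_simps)
  finally show ?case .
qed

lemma kpow_drift': "measure_pmf.expectation (kpow K t x) V \<le> V x + D"
proof -
  have "\<gamma> ^ t * V x \<le> 1 * V x" using \<gamma> V_nonneg by (intro mult_right_mono power_le_one) auto
  then show ?thesis using kpow_drift[where t=t and x=x] by simp
qed

lemma base_persists: "base \<in> set_pmf (kpow K t x) \<Longrightarrow> t \<le> s \<Longrightarrow> base \<in> set_pmf (kpow K s x)"
  by (rotate_tac 1, induction s rule: dec_induct) (use base_loop in auto)

text \<open>Thanks to the self-loop, \<open>base\<close> stays in the support at all later times, so
  the maximum of finitely many hitting times serves all states of S at once.\<close>

lemma uniform_hitting:
  assumes "finite S"
  shows "\<exists>m \<delta>. 0 < m \<and> 0 < \<delta> \<and> (\<forall>x\<in>S. \<delta> \<le> pmf (kpow K m x) base)"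
proof -
  obtain \<tau> where \<tau>: "base \<in> set_pmf (kpow K (\<tau> x) x)" for x
    using accessible_imp_kpow[OF reach_base] by metis
  define m where "m = Suc (Max (insert 0 (\<tau> ` S)))"
  define \<delta> where "\<delta> = Min (insert 1 ((\<lambda>x. pmf (kpow K m x) base) ` S))"
  have "base \<in> set_pmf (kpow K m x)" if "x \<in> S" for x
    by (rule base_persists[OF \<tau>[of x]]) (use assms that in \<open>auto simp: m_def intro!: le_SucI Max_ge\<close>)
  then have "0 < \<delta>" using assms by (auto simp: \<delta>_def pmf_positive)
  moreover have "\<forall>x\<in>S. \<delta> \<le> pmf (kpow K m x) base" using assms by (auto simp: \<delta>_def)
  ultimately show ?thesis by (intro exI[of _ m] exI[of _ \<delta>]) (auto simp: m_def)
qed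

text \<open>The Hairer--Mattingly form of Harris' theorem, for the dual action on functions: the
  oscillation of \<open>f\<close> relative to the weight \<open>1 + \<beta> V\<close> contracts. Far out the drift does it, near
  the centre the common atom at \<open>base\<close>.\<close>

lemma harris_contraction:
  "\<exists>m>0. \<exists>\<beta>>0. \<exists>\<alpha>. \<alpha> < 1 \<and> 0 \<le> \<alpha> \<and>
     (\<forall>(f :: 'a \<Rightarrow> real) a c. 0 \<le> a \<longrightarrow> (\<forall>x. \<bar>f x - c\<bar> \<le> a * (1 + \<beta> * V x)) \<longrightarrow>
       (\<exists>c'. \<forall>x. \<bar>measure_pmf.expectation (kpow K m x) f - c'\<bar> \<le> \<alpha> * a * (1 + \<beta> * V x)))"
proof -
  define R where "R = (4 * D + 4) / (1 - \<gamma>)"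
  \<comment> \<open>Pairs of states are compared below: if the mean of V x and V y is less than R,
    each of them is less than 2 R.\<close>
  obtain m \<delta> where m: "0 < m" and \<delta>: "0 < \<delta>"
    and minor: "\<And>x. V x \<le> 2 * R \<Longrightarrow> \<delta> \<le> pmf (kpow K m x) base"
    using uniform_hitting[OF finite_sublevel[of "2 * R"]] by blast
  obtain \<beta> \<alpha> where \<beta>: "0 < \<beta>" and \<alpha>: "\<alpha> < 1" "0 \<le> \<alpha>"
    and far: "\<And>v. 0 \<le> v \<Longrightarrow> R \<le> v \<Longrightarrow> 1 + \<beta> * (\<gamma> * v + D) \<le> \<alpha> * (1 + \<beta> * v)"
    and near: "\<And>v. 0 \<le> v \<Longrightarrow> 1 - \<delta> + \<beta> * (\<gamma> * v + D) \<le> \<alpha> * (1 + \<beta> * v)"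
    using minorization_constants[OF \<gamma> D_nonneg \<delta>] unfolding R_def[symmetric] by blast
  have drift_m: "measure_pmf.expectation (kpow K m x) V \<le> \<gamma> * V x + D" for x
  proof -
    have "\<gamma> ^ m * V x \<le> \<gamma> ^ 1 * V x"
      using \<gamma> m V_nonneg by (intro mult_right_mono power_decreasing) auto
    then show ?thesis using kpow_drift[where t=m and x=x] by simp
  qed
  have main: "\<exists>c'. \<forall>x. \<bar>measure_pmf.expectation (kpow K m x) f - c'\<bar> \<le> \<alpha> * a * (1 + \<beta> * V x)"
    if a: "0 \<le> a" and f: "\<And>x. \<bar>f x - c\<bar> \<le> a * (1 + \<beta> * V x)" for f a c
  proof -
    let ?E = "\<lambda>x. measure_pmf.expectation (kpow K m x)"
    have EW: "?E x (\<lambda>z. a * (1 + \<beta> * V z)) \<le> a * (1 + \<beta> * (\<gamma> * V x + D))" for x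
      using a \<beta> drift_m[of x] integrable_kpow[where t=m and x=x and f=V] by (simp add: mult_left_mono)
    have Ef: "?E x (\<lambda>z. f z - c) = ?E x f - c" for x
      using integrable_kpow[where t=m and x=x and f=f] by simp
    \<comment> \<open>The mass \<delta>' placed on \<open>base\<close> is kept exact and f - c is
      bounded by its weight elsewhere. As \<delta>' may be anything up to the actual mass, the same
      value can be taken for two starting points, and then the terms with f at \<open>base\<close>
      cancel.\<close>
    have lower: "?E x f - c \<le> \<delta>' * (f base - c) + a * (1 - \<delta>' + \<beta> * (\<gamma> * V x + D))"
      and upper: "\<delta>' * (f base - c) - a * (1 - \<delta>' + \<beta> * (\<gamma> * V x + D)) \<le> ?E x f - c"
      if d: "0 \<le> \<delta>'" "\<delta>' \<le> pmf (kpow K m x) base" for x \<delta>'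
    proof -
      have W: "a * 1 \<le> a * (1 + \<beta> * V base)" using a \<beta> V_nonneg by (intro mult_left_mono) auto
      have "\<delta>' * (a * (1 + \<beta> * V base) - (f base - c))
         \<le> pmf (kpow K m x) base * (a * (1 + \<beta> * V base) - (f base - c))"
        using d f[of base] by (intro mult_right_mono) auto
      also have "\<dots> \<le> ?E x (\<lambda>z. a * (1 + \<beta> * V z) - (f z - c))"
        by (rule expectation_ge_pmf_mult) (use f in \<open>auto intro: integrable_kpow simp: abs_le_iff\<close>)
      also have "\<dots> = ?E x (\<lambda>z. a * (1 + \<beta> * V z)) - (?E x f - c)"
        unfolding Ef[symmetric] by (intro Bochner_Integration.integral_diff integrable_kpow)
      finally have "\<delta>' * (a * (1 + \<beta> * V base) - (f base - c)) \<le> \<dots>" .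
      moreover have "\<delta>' * a \<le> \<delta>' * (a * (1 + \<beta> * V base))" using W d by (intro mult_left_mono) auto
      ultimately show "?E x f - c \<le> \<delta>' * (f base - c) + a * (1 - \<delta>' + \<beta> * (\<gamma> * V x + D))"
        using EW[of x] by (simp add: algebra_simps)
      have "\<delta>' * (a * (1 + \<beta> * V base) + (f base - c))
         \<le> pmf (kpow K m x) base * (a * (1 + \<beta> * V base) + (f base - c))"
        using d f[of base] by (intro mult_right_mono) auto
      also have "\<dots> \<le> ?E x (\<lambda>z. a * (1 + \<beta> * V z) + (f z - c))"
        by (rule expectation_ge_pmf_mult) (use f in \<open>auto intro: integrable_kpow simp: abs_le_iff\<close>, smt (verit) f)
      also have "\<dots> = ?E x (\<lambda>z. a * (1 + \<beta> * V z)) + (?E x f - c)"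
        unfolding Ef[symmetric] by (intro Bochner_Integration.integral_add integrable_kpow)
      finally have "\<delta>' * (a * (1 + \<beta> * V base) + (f base - c)) \<le> \<dots>" .
      moreover have "\<delta>' * a \<le> \<delta>' * (a * (1 + \<beta> * V base))" using W d by (intro mult_left_mono) auto
      ultimately show "\<delta>' * (f base - c) - a * (1 - \<delta>' + \<beta> * (\<gamma> * V x + D)) \<le> ?E x f - c"
        using EW[of x] by (simp add: algebra_simps)
    qed
    have "?E x f - ?E y f \<le> \<alpha> * a * (1 + \<beta> * V x) + \<alpha> * a * (1 + \<beta> * V y)" for x y
    proof -
      \<comment> \<open>Both bounds are affine in V, so a pair acts like one state with the averaged
        value v. Far out \<delta>' = 0 is used, near the centre \<delta>' = \<delta>.\<close>
      define v where "v = (V x + V y) / 2"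
      have v: "0 \<le> v" using V_nonneg[of x] V_nonneg[of y] by (simp add: v_def)
      have goal_eq: "\<alpha> * a * (1 + \<beta> * V x) + \<alpha> * a * (1 + \<beta> * V y) = 2 * a * (\<alpha> * (1 + \<beta> * v))"
        by (simp add: v_def algebra_simps)
      have "?E x f - ?E y f \<le> 2 * a * (1 - \<delta>' + \<beta> * (\<gamma> * v + D))"
        if "0 \<le> \<delta>'" "\<delta>' \<le> pmf (kpow K m x) base" "\<delta>' \<le> pmf (kpow K m y) base" for \<delta>'
        using lower[OF that(1,2)] upper[OF that(1,3)] unfolding v_def by (simp add: field_simps)
      note bnd = this
      have "2 * a * s \<le> 2 * a * t" if "s \<le> t" for s t
        using a that by (intro mult_left_mono) auto
      note mono = this
      show ?thesis
      proof (cases "R \<le> v")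
        case True
        show ?thesis unfolding goal_eq
          using bnd[of 0] mono[OF far[OF v True]] by simp
      next
        case False
        then have "V x \<le> 2 * R" "V y \<le> 2 * R"
          using V_nonneg[of x] V_nonneg[of y] by (auto simp: v_def)
        then show ?thesis unfolding goal_eq
          using bnd[of \<delta>] minor \<delta> mono[OF near[OF v]] by (smt (verit))
      qed
    qed
    then show ?thesis by (rule centre_of_oscillation)
  qed
  have "\<forall>f a c. 0 \<le> a \<longrightarrow> (\<forall>x. \<bar>f x - c\<bar> \<le> a * (1 + \<beta> * V x)) \<longrightarrow>
       (\<exists>c'. \<forall>x. \<bar>measure_pmf.expectation (kpow K m x) f - c'\<bar> \<le> \<alpha> * a * (1 + \<beta> * V x))"
    using main by blast
  then show ?thesis using m \<beta> \<alpha> by blast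
qed

end

context geometric_drift begin

text \<open>Each block of m steps shrinks the oscillation by \<alpha>; the t mod m leftover steps
  are applied to f first and keep it bounded by B. The rate \<open>u\<close> is uniform in f and in
  the starting points.\<close>

lemma kpow_merging:
  "\<exists>u \<beta>. u \<longlonglongrightarrow> 0 \<and> 0 < \<beta> \<and> (\<forall>t. 0 \<le> u t) \<and>
     (\<forall>(f :: 'a \<Rightarrow> real) B t x y. 0 \<le> B \<longrightarrow> (\<forall>x. \<bar>f x\<bar> \<le> B) \<longrightarrow>
       \<bar>measure_pmf.expectation (kpow K t x) f - measure_pmf.expectation (kpow K t y) f\<bar>
         \<le> u t * B * (2 + \<beta> * (V x + V y)))"
proof -
  obtain m \<beta> \<alpha> where m: "0 < m" and \<beta>: "0 < \<beta>" and \<alpha>: "\<alpha> < 1" "0 \<le> \<alpha>"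
    and step: "\<And>(f :: 'a \<Rightarrow> real) a c. 0 \<le> a \<Longrightarrow> (\<And>x. \<bar>f x - c\<bar> \<le> a * (1 + \<beta> * V x)) \<Longrightarrow>
       \<exists>c'. \<forall>x. \<bar>measure_pmf.expectation (kpow K m x) f - c'\<bar> \<le> \<alpha> * a * (1 + \<beta> * V x)"
    using harris_contraction by metis
  have iter: "\<exists>c. \<forall>x. \<bar>measure_pmf.expectation (kpow K (m * k + j) x) f - c\<bar> \<le> \<alpha> ^ k * B * (1 + \<beta> * V x)"
    if B: "0 \<le> B" and f: "\<And>x. \<bar>f x\<bar> \<le> B" for f :: "'a \<Rightarrow> real" and B k j
  proof (induction k)
    case 0
    have "\<bar>measure_pmf.expectation (kpow K j x) f\<bar> \<le> B * (1 + \<beta> * V x)" for x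
    proof -
      have "\<bar>measure_pmf.expectation (kpow K j x) f\<bar> \<le> B" by (rule abs_expectation_pmf_le[OF f])
      also have "\<dots> \<le> B * (1 + \<beta> * V x)" using B \<beta> V_nonneg[of x] by (simp add: algebra_simps)
      finally show ?thesis .
    qed
    then show ?case by (intro exI[of _ 0]) simp
  next
    case (Suc k)
    then obtain c where c: "\<And>x. \<bar>measure_pmf.expectation (kpow K (m * k + j) x) f - c\<bar> \<le> (\<alpha> ^ k * B) * (1 + \<beta> * V x)"
      by blast
    have "0 \<le> \<alpha> ^ k * B" using \<alpha> B by simp
    from step[OF this c] obtain c' where
      "\<And>x. \<bar>measure_pmf.expectation (kpow K m x) (\<lambda>y. measure_pmf.expectation (kpow K (m * k + j) y) f) - c'\<bar>
         \<le> \<alpha> * (\<alpha> ^ k * B) * (1 + \<beta> * V x)" by blast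
    then show ?case
      by (intro exI[of _ c']) (simp only: mult_Suc_right add.assoc expectation_kpow_add power_Suc mult.assoc, simp)
  qed
  define u where "u = (\<lambda>t. \<alpha> ^ (t div m))"
  have "filterlim (\<lambda>t. t div m) at_top at_top"
    unfolding filterlim_at_top
  proof
    fix Z
    show "eventually (\<lambda>t. Z \<le> t div m) at_top"
      using eventually_ge_at_top[of "Z * m"] by eventually_elim (use m in \<open>simp add: less_eq_div_iff_mult_less_eq\<close>)
  qed
  from filterlim_compose[OF LIMSEQ_power_zero this, of \<alpha>] have u0: "u \<longlonglongrightarrow> 0"
    using \<alpha> by (simp add: u_def)
  have "\<bar>measure_pmf.expectation (kpow K t x) f - measure_pmf.expectation (kpow K t y) f\<bar>
         \<le> u t * B * (2 + \<beta> * (V x + V y))"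
    if B: "0 \<le> B" and f: "\<And>x. \<bar>f x\<bar> \<le> B" for f :: "'a \<Rightarrow> real" and B t x y
  proof -
    obtain c where "\<And>x. \<bar>measure_pmf.expectation (kpow K (m * (t div m) + t mod m) x) f - c\<bar>
       \<le> \<alpha> ^ (t div m) * B * (1 + \<beta> * V x)"
      using iter[where f=f, OF B f, where k="t div m" and j="t mod m"] by blast
    then have "\<And>x. \<bar>measure_pmf.expectation (kpow K t x) f - c\<bar> \<le> u t * B * (1 + \<beta> * V x)"
      by (simp add: u_def)
    from this[of x] this[of y] show ?thesis by (simp add: algebra_simps)
  qed
  then show ?thesis using u0 \<beta> \<alpha> by (intro exI[of _ u] exI[of _ \<beta>]) (auto simp: u_def)
qed

text \<open>Cauchy without a stationary law at hand: in t + s steps from x, the first s steps lead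
  to a random y whose V has bounded mean, and the remaining t steps merge y with x.\<close>

lemma kpow_expectation_converges:
  fixes f :: "'a \<Rightarrow> real"
  assumes f: "\<And>x. \<bar>f x\<bar> \<le> B"
  shows "\<exists>l. \<forall>x. (\<lambda>t. measure_pmf.expectation (kpow K t x) f) \<longlonglongrightarrow> l"
proof -
  have B: "0 \<le> B" using f[of undefined] by simp
  obtain u \<beta> where u: "u \<longlonglongrightarrow> 0" "\<And>t. 0 \<le> u t" and \<beta>: "0 < \<beta>"
    and merge: "\<And>t x y. \<bar>measure_pmf.expectation (kpow K t x) f - measure_pmf.expectation (kpow K t y) f\<bar>
         \<le> u t * B * (2 + \<beta> * (V x + V y))"
    using kpow_merging B f by (metis (no_types, lifting))
  let ?P = "\<lambda>t x. measure_pmf.expectation (kpow K t x) f"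
  have cauchy: "\<bar>?P (t + s) x - ?P t x\<bar> \<le> u t * (B * (2 + \<beta> * (2 * V x + D)))" for t s x
  proof -
    have "?P (t + s) x - ?P t x = measure_pmf.expectation (kpow K s x) (\<lambda>y. ?P t y - ?P t x)"
      using integrable_kpow by (simp add: expectation_kpow_add add.commute[of t])
    also have "\<bar>\<dots>\<bar> \<le> measure_pmf.expectation (kpow K s x) (\<lambda>y. \<bar>?P t y - ?P t x\<bar>)" by simp
    also have "\<dots> \<le> measure_pmf.expectation (kpow K s x) (\<lambda>y. u t * B * (2 + \<beta> * (V y + V x)))"
      by (intro integral_mono integrable_kpow merge)
    also have "\<dots> = u t * B * (2 + \<beta> * (measure_pmf.expectation (kpow K s x) V + V x))"
      using integrable_kpow[where f=V] by simp
    also have "\<dots> \<le> u t * B * (2 + \<beta> * (2 * V x + D))"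
      using kpow_drift'[where t=s and x=x] u(2) B \<beta> by (intro mult_left_mono) auto
    finally show ?thesis by (simp add: mult.assoc)
  qed
  have "Cauchy (\<lambda>t. ?P t x)" for x
  proof (rule metric_CauchyI)
    fix e :: real assume e: "0 < e"
    have "(\<lambda>t. u t * (B * (2 + \<beta> * (2 * V x + D)))) \<longlonglongrightarrow> 0"
      using tendsto_mult_left_zero[OF u(1)] .
    then have "eventually (\<lambda>t. u t * (B * (2 + \<beta> * (2 * V x + D))) < e / 2) sequentially"
      using e by (intro order_tendstoD(2)) auto
    then obtain N where N: "u N * (B * (2 + \<beta> * (2 * V x + D))) < e / 2"
      by (auto simp: eventually_sequentially)
    have "dist (?P t x) (?P N x) < e / 2" if "N \<le> t" for t
      using cauchy[where t=N and s="t - N" and x=x] N that by (simp add: dist_real_def)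
    then show "\<exists>M. \<forall>m\<ge>M. \<forall>n\<ge>M. dist (?P m x) (?P n x) < e"
      by (intro exI[of _ N] allI impI) (rule dist_triangle_half_l[where y="?P N x"])
  qed
  then have conv: "convergent (\<lambda>t. ?P t x)" for x
    by (simp add: Cauchy_convergent)
  have "(\<lambda>t. ?P t x) \<longlonglongrightarrow> lim (\<lambda>t. ?P t base)" for x
  proof -
    have "(\<lambda>t. u t * (B * (2 + \<beta> * (V x + V base)))) \<longlonglongrightarrow> 0"
      using tendsto_mult_left_zero[OF u(1)] .
    then have "(\<lambda>t. ?P t x - ?P t base) \<longlonglongrightarrow> 0"
      by (rule Lim_null_comparison[rotated]) (use merge in \<open>simp add: mult.assoc\<close>)
    moreover have "(\<lambda>t. ?P t base) \<longlonglongrightarrow> lim (\<lambda>t. ?P t base)"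
      using conv convergent_LIMSEQ_iff by blast
    ultimately have "(\<lambda>t. (?P t x - ?P t base) + ?P t base) \<longlonglongrightarrow> 0 + lim (\<lambda>t. ?P t base)"
      by (rule tendsto_add)
    then show ?thesis by simp
  qed
  then show ?thesis by blast
qed

text \<open>The pointwise limits of the transition probabilities are the candidate law. Mass could
  escape to infinity; tightness excludes this, because V has bounded mean along the chain and finite
  sublevel sets. The same tightness identifies the limit functional L with integration against the
  candidate.\<close>

theorem ergodic:
  "\<exists>\<pi>. stationary K \<pi> \<and> (\<forall>init (f :: 'a \<Rightarrow> real). bounded (range f) \<longrightarrow>
     (\<lambda>t. measure_pmf.expectation (chain_law K init t) f) \<longlonglongrightarrow> measure_pmf.expectation \<pi> f)"
proof -
  let ?E = "\<lambda>t x (f :: 'a \<Rightarrow> real). measure_pmf.expectation (kpow K t x) f"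
  define L where "L f = lim (\<lambda>t. ?E t base f)" for f
  have L: "(\<lambda>t. ?E t x f) \<longlonglongrightarrow> L f" if f: "\<And>x. \<bar>f x\<bar> \<le> B" for f B x
  proof -
    obtain l where l: "\<And>x. (\<lambda>t. ?E t x f) \<longlonglongrightarrow> l"
      using kpow_expectation_converges[where f=f, OF f] by blast
    have "L f = l" unfolding L_def by (rule limI[OF l])
    then show ?thesis using l by simp
  qed
  define p where "p y = L (indicator {y})" for y
  have p: "(\<lambda>t. pmf (kpow K t x) y) \<longlonglongrightarrow> p y" for x y
    using L[of "indicator {y}" 1 x] unfolding p_def
    by (simp add: measure_pmf_single indicator_def)
  have p_nonneg: "0 \<le> p y" for y
    by (rule LIMSEQ_le_const[OF p]) auto
  define b where "b = V base + D"
  have b: "0 \<le> b" using V_nonneg D_nonneg by (simp add: b_def)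
  define S where "S R = {x. V x \<le> R}" for R
  have S: "finite (S R)" for R using finite_sublevel by (simp add: S_def)
  \<comment> \<open>Markov's inequality, uniformly in t.\<close>
  have tail: "?E t base (indicator (- S R)) \<le> b / R" if R: "0 < R" for t R
  proof -
    have "?E t base (indicator (- S R)) \<le> ?E t base (\<lambda>x. V x / R)"
      by (intro integral_mono integrable_kpow)
        (use R V_nonneg in \<open>auto simp: S_def indicator_def\<close>)
    also have "\<dots> \<le> b / R" using kpow_drift'[where t=t and x=base] R by (simp add: b_def divide_right_mono)
    finally show ?thesis .
  qed
  have body: "\<bar>?E t base f - (\<Sum>y\<in>S R. f y * pmf (kpow K t base) y)\<bar> \<le> B * (b / R)"
    if R: "0 < R" and f: "\<And>x. \<bar>f x\<bar> \<le> B" for t R f B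
  proof -
    have B: "0 \<le> B" using f[of undefined] by simp
    have "(\<Sum>y\<in>S R. f y * pmf (kpow K t base) y) = ?E t base (\<lambda>x. f x * indicator (S R) x)"
      by (subst integral_measure_pmf_real[OF S[of R]]) (auto simp: indicator_def intro!: sum.cong)
    then have "?E t base f - (\<Sum>y\<in>S R. f y * pmf (kpow K t base) y)
        = ?E t base (\<lambda>x. f x - f x * indicator (S R) x)"
      using integrable_kpow[where t=t and x=base] by simp
    also have "\<bar>\<dots>\<bar> \<le> ?E t base (\<lambda>x. \<bar>f x - f x * indicator (S R) x\<bar>)" by simp
    also have "\<dots> \<le> ?E t base (\<lambda>x. B * indicator (- S R) x)"
      by (intro integral_mono integrable_kpow) (use f B in \<open>auto simp: indicator_def\<close>)
    also have "\<dots> \<le> B * (b / R)" using mult_left_mono[OF tail[OF R, of t] B] by simp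
    finally show ?thesis .
  qed
  have L_body: "\<bar>L f - (\<Sum>y\<in>S R. f y * p y)\<bar> \<le> B * (b / R)"
    if R: "0 < R" and f: "\<And>x. \<bar>f x\<bar> \<le> B" for R f B
  proof (rule LIMSEQ_le_const2)
    show "(\<lambda>t. \<bar>?E t base f - (\<Sum>y\<in>S R. f y * pmf (kpow K t base) y)\<bar>)
        \<longlonglongrightarrow> \<bar>L f - (\<Sum>y\<in>S R. f y * p y)\<bar>"
      by (intro tendsto_intros L[where f=f, OF f] p)
    show "\<exists>N. \<forall>t\<ge>N. \<bar>?E t base f - (\<Sum>y\<in>S R. f y * pmf (kpow K t base) y)\<bar> \<le> B * (b / R)"
      using body[where f=f, OF R f] by blast
  qed
  have L1: "L (\<lambda>_. 1) = 1" by (simp add: L_def)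
  have mass: "1 - b / R \<le> (\<Sum>y\<in>S R. p y)" if "0 < R" for R
    using L_body[OF that, of "\<lambda>_. 1" 1] L1 by simp
  \<comment> \<open>Fatou gives at most 1, tightness at least 1.\<close>
  have total: "(\<integral>\<^sup>+y. ennreal (p y) \<partial>count_space UNIV) = 1"
  proof (rule antisym)
    have "(\<integral>\<^sup>+y. ennreal (p y) \<partial>count_space UNIV)
       = (\<integral>\<^sup>+y. liminf (\<lambda>t. ennreal (pmf (kpow K t base) y)) \<partial>count_space UNIV)"
      by (intro nn_integral_cong) (use lim_imp_Liminf[OF _ tendsto_ennrealI[OF p]] in auto)
    also have "\<dots> \<le> liminf (\<lambda>t. \<integral>\<^sup>+y. ennreal (pmf (kpow K t base) y) \<partial>count_space UNIV)"
      by (rule nn_integral_liminf) simp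
    also have "\<dots> = 1" by (simp add: nn_integral_pmf Liminf_const)
    finally show "(\<integral>\<^sup>+y. ennreal (p y) \<partial>count_space UNIV) \<le> 1" .
    have "ennreal (1 - b / R) \<le> (\<integral>\<^sup>+y. ennreal (p y) \<partial>count_space UNIV)" if R: "0 < R" for R
    proof -
      have "ennreal (1 - b / R) \<le> ennreal (\<Sum>y\<in>S R. p y)" using mass[OF R] by (rule ennreal_leI)
      also have "\<dots> = (\<integral>\<^sup>+y. ennreal (p y) \<partial>count_space (S R))"
        using S p_nonneg by (simp add: nn_integral_count_space_finite sum_ennreal)
      also have "\<dots> \<le> (\<integral>\<^sup>+y. ennreal (p y) \<partial>count_space UNIV)"
        by (subst nn_integral_count_space_indicator) (auto intro!: nn_integral_mono simp: indicator_def)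
      finally show ?thesis .
    qed
    then have "eventually (\<lambda>R. ennreal (1 - b / R) \<le> (\<integral>\<^sup>+y. ennreal (p y) \<partial>count_space UNIV)) at_top"
      using eventually_gt_at_top[of 0] by (rule eventually_mono[rotated])
    moreover have "((\<lambda>R. ennreal (1 - b / R)) \<longlongrightarrow> ennreal (1 - 0)) at_top"
      by (intro tendsto_ennrealI tendsto_intros tendsto_divide_0[OF tendsto_const]
           filterlim_at_top_imp_at_infinity filterlim_ident)
    ultimately show "1 \<le> (\<integral>\<^sup>+y. ennreal (p y) \<partial>count_space UNIV)"
      using tendsto_upperbound[of "\<lambda>R. ennreal (1 - b / R)" "ennreal (1 - 0)" at_top] by simp
  qed
  define \<pi> where "\<pi> = embed_pmf p"
  have pmf_\<pi>: "pmf \<pi> y = p y" for y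
    unfolding \<pi>_def by (rule pmf_embed_pmf[OF p_nonneg total])
  have L_\<pi>: "L f = measure_pmf.expectation \<pi> f" if f: "\<And>x. \<bar>f x\<bar> \<le> B" for f B
  proof -
    have B: "0 \<le> B" using f[of undefined] by simp
    have \<pi>_tail: "measure_pmf.expectation \<pi> (indicator (- S R)) \<le> b / R" if R: "0 < R" for R
    proof -
      have "measure_pmf.prob \<pi> (S R) = (\<Sum>y\<in>S R. p y)"
        using S by (simp add: measure_measure_pmf_finite pmf_\<pi>)
      moreover have "measure_pmf.prob \<pi> (- S R) = 1 - measure_pmf.prob \<pi> (S R)"
        using measure_pmf.prob_compl[of "S R" \<pi>] by (simp add: Compl_eq_Diff_UNIV)
      ultimately have "measure_pmf.prob \<pi> (- S R) \<le> b / R" using mass[OF R] by simp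
      then show ?thesis by simp
    qed
    have close: "\<bar>L f - measure_pmf.expectation \<pi> f\<bar> \<le> 2 * B * b / R" if R: "0 < R" for R
    proof -
      have int: "integrable (measure_pmf \<pi>) f" by (rule integrable_pmf_bounded[OF f])
      have "(\<Sum>y\<in>S R. f y * p y) = measure_pmf.expectation \<pi> (\<lambda>x. f x * indicator (S R) x)"
        by (subst integral_measure_pmf_real[OF S[of R]]) (auto simp: indicator_def pmf_\<pi> intro!: sum.cong)
      then have "measure_pmf.expectation \<pi> f - (\<Sum>y\<in>S R. f y * p y)
          = measure_pmf.expectation \<pi> (\<lambda>x. f x - f x * indicator (S R) x)"
        using int by (simp add: integrable_real_mult_indicator)
      also have "\<bar>\<dots>\<bar> \<le> measure_pmf.expectation \<pi> (\<lambda>x. \<bar>f x - f x * indicator (S R) x\<bar>)" by simp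
      also have "\<dots> \<le> measure_pmf.expectation \<pi> (\<lambda>x. B * indicator (- S R) x)"
        by (intro integral_mono integrable_pmf_bounded[where B=B])
         (use f B in \<open>auto simp: indicator_def\<close>)
      also have "\<dots> \<le> B * (b / R)" using mult_left_mono[OF \<pi>_tail[OF R] B] by simp
      finally show ?thesis using L_body[where f=f, OF R f] by simp
    qed
    have "\<bar>L f - measure_pmf.expectation \<pi> f\<bar> \<le> 0"
    proof (rule tendsto_lowerbound)
      show "((\<lambda>R. 2 * B * b / R) \<longlongrightarrow> 0) at_top"
        by (intro tendsto_divide_0[OF tendsto_const] filterlim_at_top_imp_at_infinity filterlim_ident)
      show "eventually (\<lambda>R. \<bar>L f - measure_pmf.expectation \<pi> f\<bar> \<le> 2 * B * b / R) at_top"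
        using eventually_gt_at_top[of 0] by eventually_elim (rule close)
    qed simp
    then show ?thesis by simp
  qed
  \<comment> \<open>Invariance is tested on indicators: moving the time by one does not change the
    limit.\<close>
  have "bind_pmf \<pi> K = \<pi>"
  proof (rule pmf_eqI)
    fix y
    let ?f = "indicator {y} :: 'a \<Rightarrow> real"
    let ?g = "\<lambda>x. measure_pmf.expectation (K x) ?f"
    have f1: "\<bar>?f x\<bar> \<le> 1" for x by (simp add: indicator_def)
    have g1: "\<bar>?g x\<bar> \<le> 1" for x by (rule abs_expectation_pmf_le[OF f1])
    have "(\<lambda>t. ?E (Suc t) base ?f) \<longlonglongrightarrow> L ?f" by (rule LIMSEQ_Suc[OF L[where f="?f", OF f1]])
    moreover have "?E (Suc t) base ?f = ?E t base ?g" for t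
      using expectation_kpow_add[where s=t and t=1 and x=base and f="?f"] by (simp add: bind_return_pmf)
    ultimately have "(\<lambda>t. ?E t base ?g) \<longlonglongrightarrow> L ?f" by (simp only:)
    then have "L ?f = L ?g" by (rule LIMSEQ_unique[OF _ L[where f="?g", OF g1]])
    then have "measure_pmf.expectation \<pi> ?f = measure_pmf.expectation \<pi> ?g"
      using L_\<pi>[where f="?f", OF f1] L_\<pi>[where f="?g", OF g1] by simp
    also have "\<dots> = measure_pmf.expectation (bind_pmf \<pi> K) ?f"
      by (rule expectation_bind_pmf_bounded[where f="?f", OF f1, symmetric])
    finally show "pmf (bind_pmf \<pi> K) y = pmf \<pi> y" by (simp add: measure_pmf_single)
  qed
  moreover have "(\<lambda>t. measure_pmf.expectation (chain_law K init t) f) \<longlonglongrightarrow> measure_pmf.expectation \<pi> f"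
    if bf: "bounded (range f)" for init and f :: "'a \<Rightarrow> real"
  proof -
    obtain B where f: "\<And>x. \<bar>f x\<bar> \<le> B" using bf by (auto simp: bounded_iff)
    have "(\<lambda>t. measure_pmf.expectation init (\<lambda>x. ?E t x f)) \<longlonglongrightarrow> measure_pmf.expectation init (\<lambda>_. L f)"
    proof (rule integral_dominated_convergence[where w="\<lambda>_. B" and f="\<lambda>_. L f" and s="\<lambda>t x. ?E t x f"])
      show "AE x in measure_pmf init. (\<lambda>t. ?E t x f) \<longlonglongrightarrow> L f"
        by (rule AE_I2) (rule L[where f=f, OF f])
      show "AE x in measure_pmf init. norm (?E t x f) \<le> B" for t
        by (rule AE_I2) (use abs_expectation_pmf_le[where f=f, OF f] in \<open>simp only: real_norm_def\<close>)
    qed simp_all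
    moreover have "measure_pmf.expectation (chain_law K init t) f
        = measure_pmf.expectation init (\<lambda>x. ?E t x f)" for t
      by (subst chain_law_eq_bind_kpow) (rule expectation_bind_pmf_bounded[where f=f, OF f])
    ultimately show ?thesis by (simp add: L_\<pi>[where f=f, OF f])
  qed
  ultimately show ?thesis
    unfolding stationary_def by (intro exI[of _ \<pi>] conjI allI impI)
qed

end

section \<open>Positive recurrence\<close>

text \<open>The transition operator killed at \<open>x\<close>: its \<open>t\<close>-th power maps the constant 1 to the
  probability of not hitting \<open>x\<close> at times \<open>1, \<dots>, t\<close>.\<close>

definition avoid :: "('a \<Rightarrow> 'a pmf) \<Rightarrow> 'a \<Rightarrow> ('a \<Rightarrow> real) \<Rightarrow> 'a \<Rightarrow> real" where
  "avoid K x \<phi> y = measure_pmf.expectation (K y) (\<lambda>z. if z = x then 0 else \<phi> z)"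

lemma avoid_Suc:
  "(avoid K x ^^ Suc t) \<phi> y
     = measure_pmf.expectation (K y) (\<lambda>z. if z = x then 0 else (avoid K x ^^ t) \<phi> z)"
  unfolding funpow.simps comp_def by (subst avoid_def) (rule refl)

lemma avoid_mono:
  assumes "\<And>y. finite (set_pmf (K y))" and "\<And>y. \<phi> y \<le> \<psi> y"
  shows "avoid K x \<phi> y \<le> avoid K x \<psi> y"
  unfolding avoid_def
  by (intro integral_mono integrable_measure_pmf_finite) (use assms in auto)

lemma avoid_power_mono:
  assumes "\<And>y. finite (set_pmf (K y))" and "\<And>y. \<phi> y \<le> \<psi> y"
  shows "(avoid K x ^^ t) \<phi> y \<le> (avoid K x ^^ t) \<psi> y"
  by (induction t arbitrary: y) (auto intro!: assms avoid_mono)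

lemma avoid_power_affine:
  assumes fin: "\<And>y. finite (set_pmf (K y))"
  shows "(avoid K x ^^ t) (\<lambda>z. a * \<phi> z + b * \<psi> z) y
     = a * (avoid K x ^^ t) \<phi> y + b * (avoid K x ^^ t) \<psi> y"
proof (induction t arbitrary: y)
  case (Suc t)
  have "(avoid K x ^^ Suc t) (\<lambda>z. a * \<phi> z + b * \<psi> z) y
     = measure_pmf.expectation (K y) (\<lambda>z. a * (if z = x then 0 else (avoid K x ^^ t) \<phi> z)
         + b * (if z = x then 0 else (avoid K x ^^ t) \<psi> z))"
    unfolding avoid_Suc by (rule Bochner_Integration.integral_cong) (auto simp: Suc.IH)
  also have "\<dots> = a * (avoid K x ^^ Suc t) \<phi> y + b * (avoid K x ^^ Suc t) \<psi> y"
    unfolding avoid_Suc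
    by (subst Bochner_Integration.integral_add) (auto intro!: integrable_measure_pmf_finite fin)
  finally show ?case .
qed simp

lemma avoid_power_nonneg: "0 \<le> (avoid K x ^^ t) (\<lambda>_. 1) y"
  by (induction t arbitrary: y) (auto simp: avoid_Suc simp del: funpow.simps(2) intro!: Bochner_Integration.integral_nonneg)

text \<open>The constant 1 is superharmonic for the killed operator.\<close>

lemma avoid_power_antimono:
  assumes fin: "\<And>y. finite (set_pmf (K y))" and "s \<le> t"
  shows "(avoid K x ^^ t) (\<lambda>_. 1) y \<le> (avoid K x ^^ s) (\<lambda>_. 1) y"
proof -
  have one: "(avoid K x ^^ d) (\<lambda>_. 1) y \<le> 1" for d y
  proof (induction d arbitrary: y)
    case (Suc d)
    have "(avoid K x ^^ Suc d) (\<lambda>_. 1) y \<le> measure_pmf.expectation (K y) (\<lambda>z. 1)"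
      unfolding avoid_Suc
      by (intro integral_mono integrable_measure_pmf_finite fin) (use Suc in auto)
    then show ?case by simp
  qed simp
  have "(avoid K x ^^ s) ((avoid K x ^^ (t - s)) (\<lambda>_. 1)) y \<le> (avoid K x ^^ s) (\<lambda>_. 1) y"
    by (intro avoid_power_mono fin one)
  then show ?thesis using assms(2) by (simp add: funpow_add[symmetric, THEN fun_cong, unfolded comp_def])
qed

lemma avoid_power_1_le_one:
  assumes fin: "\<And>y. finite (set_pmf (K y))"
  shows "(avoid K x ^^ t) (\<lambda>_. 1) y \<le> 1"
  using avoid_power_antimono[where K=K and s=0 and t=t, OF fin] by simp

text \<open>The path is taken in the transitive, not the reflexive closure: also for y = x at least
  one step has to be made before a visit counts.\<close>

lemma avoid_less_one:
  assumes fin: "\<And>y. finite (set_pmf (K y))" and path: "(y, x) \<in> {(x, y). y \<in> set_pmf (K x)}\<^sup>+"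
  shows "\<exists>t. (avoid K x ^^ t) (\<lambda>_. 1) y < 1"
proof -
  \<comment> \<open>A deficit below 1 at z is passed back along the edge from y to z, diluted by the
    transition probability; hitting x counts as the full deficit.\<close>
  have gap: "avoid K x \<phi> y \<le> 1 - pmf (K y) z * (1 - (if z = x then 0 else \<phi> z))"
    if "\<And>z. \<phi> z \<le> 1" for \<phi> y z
  proof -
    have "pmf (K y) z * (1 - (if z = x then 0 else \<phi> z))
       \<le> measure_pmf.expectation (K y) (\<lambda>z. 1 - (if z = x then 0 else \<phi> z))"
      by (rule expectation_ge_pmf_mult) (use that in \<open>auto intro!: integrable_measure_pmf_finite fin\<close>)
    also have "\<dots> = 1 - avoid K x \<phi> y"
      unfolding avoid_def
      by (subst Bochner_Integration.integral_diff) (auto intro!: integrable_measure_pmf_finite fin)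
    finally show ?thesis by simp
  qed
  show ?thesis using path
  proof (induction rule: converse_trancl_induct)
    case (base y)
    then have "0 < pmf (K y) x" by (simp add: pmf_positive_iff)
    then have "avoid K x (\<lambda>_. 1) y < 1" using gap[of "\<lambda>_. 1" y x] by simp
    then show ?case by (intro exI[of _ 1]) simp
  next
    case (step y z)
    then obtain t where t: "(avoid K x ^^ t) (\<lambda>_. 1) z < 1" by blast
    have "0 < pmf (K y) z" using step(1) by (simp add: pmf_positive_iff)
    moreover have "0 < 1 - (if z = x then 0 else (avoid K x ^^ t) (\<lambda>_. 1) z)" using t by simp
    ultimately have "(avoid K x ^^ Suc t) (\<lambda>_. 1) y < 1"
      using gap[of "(avoid K x ^^ t) (\<lambda>_. 1)" y z] avoid_power_1_le_one[where K=K, OF fin]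
      by (smt (verit) mult_pos_pos funpow.simps(2) comp_apply)
    then show ?case by blast
  qed
qed

text \<open>Hitting by time t is complementary to avoiding until t. The value 0 of
  \<open>first_passage\<close> at time 0 lets the sum start there.\<close>

lemma sum_first_passage:
  assumes fin: "\<And>y. finite (set_pmf (K y))"
  shows "(\<Sum>s\<le>t. first_passage K x s y) = 1 - (avoid K x ^^ t) (\<lambda>_. 1) y"
proof (induction t arbitrary: y)
  case (Suc t)
  note int = integrable_measure_pmf_finite[OF fin]
  have "(\<Sum>s\<le>Suc t. first_passage K x s y) = (\<Sum>s\<le>t. first_passage K x (Suc s) y)"
    by (subst sum.atMost_Suc_shift) simp
  also have "\<dots> = measure_pmf.expectation (K y)
      (\<lambda>z. \<Sum>s\<le>t. if z = x then of_bool (s = 0) else first_passage K x s z)"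
    unfolding first_passage.simps
    by (rule Bochner_Integration.integral_sum[symmetric]) (rule int)
  also have "\<dots> = measure_pmf.expectation (K y)
      (\<lambda>z. 1 - (if z = x then 0 else (avoid K x ^^ t) (\<lambda>_. 1) z))"
    by (rule Bochner_Integration.integral_cong) (auto simp: Suc.IH of_bool_def sum.delta)
  also have "\<dots> = 1 - (avoid K x ^^ Suc t) (\<lambda>_. 1) y"
    unfolding avoid_Suc by (subst Bochner_Integration.integral_diff) (auto intro!: int)
  finally show ?case .
qed simp

context geometric_drift begin

text \<open>The Harris argument for the killed operator. Instead of an atom common to two starting
  points, the mass lost at x is spent: on a finite sublevel set at least \<delta> is lost within m
  steps. One state is treated at a time, so the level R suffices without doubling.\<close>

lemma avoid_geometric_decay:
  assumes x: "(base, x) \<in> accessible K"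
  shows "\<exists>m>0. \<exists>\<alpha> A. \<alpha> < 1 \<and> 0 \<le> \<alpha> \<and> (\<forall>k. (avoid K x ^^ (m * k)) (\<lambda>_. 1) x \<le> A * \<alpha> ^ k)"
proof -
  let ?R = "(4 * D + 4) / (1 - \<gamma>)"
  let ?Q = "\<lambda>t. avoid K x ^^ t"
  have "\<exists>t. ?Q t (\<lambda>_. 1) y < 1" for y
  proof (rule avoid_less_one[OF finite_support])
    have "(base, base) \<in> {(x, y). y \<in> set_pmf (K x)}\<^sup>+" using base_loop by auto
    then show "(y, x) \<in> {(x, y). y \<in> set_pmf (K x)}\<^sup>+"
      using reach_base[of y] x unfolding accessible_def by (meson rtrancl_trancl_trancl trancl_rtrancl_trancl)
  qed
  then obtain \<tau> where \<tau>: "\<And>y. ?Q (\<tau> y) (\<lambda>_. 1) y < 1" by metis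
  let ?S = "{y. V y \<le> ?R}"
  define m where "m = Suc (Max (insert 0 (\<tau> ` ?S)))"
  have less: "?Q m (\<lambda>_. 1) y < 1" if "y \<in> ?S" for y
  proof -
    have "\<tau> y \<le> m" using that finite_sublevel by (auto simp: m_def intro!: le_SucI Max_ge)
    from avoid_power_antimono[where K=K, OF finite_support this, where x=x and y=y] show ?thesis using \<tau>[of y] by simp
  qed
  define \<delta> where "\<delta> = Min (insert 1 ((\<lambda>y. 1 - ?Q m (\<lambda>_. 1) y) ` ?S))"
  have \<delta>: "0 < \<delta>" using less finite_sublevel by (auto simp: \<delta>_def)
  have \<delta>_le: "?Q m (\<lambda>_. 1) y \<le> 1 - \<delta>" if "y \<in> ?S" for y
  proof -
    have "\<delta> \<le> 1 - ?Q m (\<lambda>_. 1) y"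
      unfolding \<delta>_def using that finite_sublevel by (intro Min_le) auto
    then show ?thesis by simp
  qed
  obtain \<beta> \<alpha> where \<beta>: "0 < \<beta>" and \<alpha>: "\<alpha> < 1" "0 \<le> \<alpha>"
    and far: "\<And>v. 0 \<le> v \<Longrightarrow> ?R \<le> v \<Longrightarrow> 1 + \<beta> * (\<gamma> * v + D) \<le> \<alpha> * (1 + \<beta> * v)"
    and near: "\<And>v. 0 \<le> v \<Longrightarrow> 1 - \<delta> + \<beta> * (\<gamma> * v + D) \<le> \<alpha> * (1 + \<beta> * v)"
    using minorization_constants[OF \<gamma> D_nonneg \<delta>] by blast
  \<comment> \<open>Killing can only lower the expectation of the nonnegative function V.\<close>
  have Q_V: "?Q t V y \<le> measure_pmf.expectation (kpow K t y) V" for t y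
  proof (induction t arbitrary: y)
    case (Suc t)
    have "?Q (Suc t) V y \<le> measure_pmf.expectation (K y) (\<lambda>z. measure_pmf.expectation (kpow K t z) V)"
      unfolding avoid_Suc
      by (intro integral_mono integrable_measure_pmf_finite finite_support)
        (use Suc V_nonneg in \<open>auto intro!: Bochner_Integration.integral_nonneg\<close>)
    also have "\<dots> = measure_pmf.expectation (kpow K (Suc t) y) V"
      using expectation_kpow_add[where s=1 and t=t and x=y and f=V] by (simp add: bind_return_pmf)
    finally show ?case .
  qed simp
  \<comment> \<open>The product 1 * 1 keeps the weight in the shape a * \<phi> + b * \<psi> that
    \<open>avoid_power_affine\<close> expects; the summand 0 * V below has the same purpose.\<close>
  let ?W = "\<lambda>y. 1 * 1 + \<beta> * V y"
  have step: "?Q m ?W y \<le> \<alpha> * ?W y" for y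
  proof -
    have "?Q m V y \<le> \<gamma> ^ m * V y + D" using Q_V[of m y] kpow_drift[where t=m and x=y] by simp
    also have "\<gamma> ^ m * V y \<le> \<gamma> ^ 1 * V y"
      using \<gamma> V_nonneg by (intro mult_right_mono power_decreasing) (auto simp: m_def)
    finally have "\<beta> * ?Q m V y \<le> \<beta> * (\<gamma> * V y + D)" using \<beta> by simp
    moreover have "?Q m ?W y = 1 * ?Q m (\<lambda>_. 1) y + \<beta> * ?Q m V y"
      by (rule avoid_power_affine[OF finite_support])
    ultimately show ?thesis
      using far[of "V y"] near[of "V y"] \<delta>_le[of y] V_nonneg[of y]
        avoid_power_1_le_one[where K=K, OF finite_support, where x=x and y=y and t=m]
      by (cases "V y \<le> ?R") auto
  qed
  have "?Q (m * k) (\<lambda>_. 1) y \<le> \<alpha> ^ k * ?W y" for k y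
  proof (induction k arbitrary: y)
    case 0
    then show ?case using \<beta> V_nonneg by simp
  next
    case (Suc k)
    have "?Q (m * Suc k) (\<lambda>_. 1) y = ?Q m (?Q (m * k) (\<lambda>_. 1)) y"
      by (simp add: funpow_add)
    also have "\<dots> \<le> ?Q m (\<lambda>z. \<alpha> ^ k * ?W z + 0 * V z) y"
      using Suc by (intro avoid_power_mono finite_support) simp
    also have "\<dots> = \<alpha> ^ k * ?Q m ?W y + 0 * ?Q m V y"
      by (rule avoid_power_affine[OF finite_support])
    also have "\<dots> \<le> \<alpha> ^ k * (\<alpha> * ?W y)"
      using step[of y] \<alpha> by (simp add: mult_left_mono)
    finally show ?case by (simp add: mult_ac)
  qed
  then show ?thesis using \<alpha>
    by (intro exI[of _ m] exI[of _ \<alpha>] exI[of _ "?W x"] conjI allI) (auto simp: m_def mult.commute)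
qed

text \<open>The survival probabilities of the return time decay geometrically along multiples of m
  and decrease in between, hence are summable. Their limit 0 gives recurrence, their sum bounds the
  mean return time.\<close>

lemma positive_recurrent_state:
  assumes x: "(base, x) \<in> accessible K"
  shows "positive_recurrent_state K x"
proof -
  let ?q = "\<lambda>t. (avoid K x ^^ t) (\<lambda>_. 1) x"
  obtain m \<alpha> A where m: "0 < m" and \<alpha>: "\<alpha> < 1" "0 \<le> \<alpha>"
    and decay: "\<And>k. ?q (m * k) \<le> A * \<alpha> ^ k"
    using avoid_geometric_decay[OF x] by blast
  have q0: "0 \<le> ?q t" for t by (rule avoid_power_nonneg)
  have sumq: "summable ?q"
  proof (rule bounded_imp_summable)
    show "0 \<le> ?q t" for t by (rule q0)
    have A: "0 \<le> A" using decay[of 0] q0[of 0] by simp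
    have sg: "summable (\<lambda>k. A * \<alpha> ^ k)" using \<alpha> by (intro summable_mult summable_geometric) auto
    show "sum ?q {..t} \<le> real m * (\<Sum>k. A * \<alpha> ^ k)" for t
    proof -
      have "{..t} \<subseteq> {..<Suc t * m}" using m by (cases m) auto
      then have "sum ?q {..t} \<le> sum ?q {..<Suc t * m}" using q0 by (intro sum_mono2) auto
      also have "\<dots> = (\<Sum>k<Suc t. \<Sum>j\<in>{k * m..<k * m + m}. ?q j)"
        by (rule sum.nat_group[symmetric])
      also have "\<dots> \<le> (\<Sum>k<Suc t. \<Sum>j\<in>{k * m..<k * m + m}. A * \<alpha> ^ k)"
      proof (intro sum_mono)
        fix k j assume "j \<in> {k * m..<k * m + m}"
        then have "m * k \<le> j" by (simp add: mult.commute)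
        from avoid_power_antimono[where K=K, OF finite_support this, where x=x and y=x] decay[of k]
        show "?q j \<le> A * \<alpha> ^ k" by simp
      qed
      also have "\<dots> = real m * (\<Sum>k<Suc t. A * \<alpha> ^ k)" by (simp only: sum_constant card_atLeastLessThan sum_distrib_left) simp
      also have "\<dots> \<le> real m * (\<Sum>k. A * \<alpha> ^ k)"
        using sg A \<alpha> by (intro mult_left_mono sum_le_suminf) auto
      finally show ?thesis .
    qed
  qed
  have fp_Suc: "first_passage K x (Suc t) x = ?q t - ?q (Suc t)" for t
    using sum_first_passage[where K=K, OF finite_support, where x=x and y=x and t="Suc t"]
      sum_first_passage[where K=K, OF finite_support, where x=x and y=x and t=t] by (simp del: first_passage.simps)
  have fp_nonneg: "0 \<le> first_passage K x t x" for t
  proof (cases t)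
    case (Suc s)
    have "?q (Suc s) \<le> ?q s" by (rule avoid_power_antimono[OF finite_support]) simp
    then show ?thesis unfolding Suc fp_Suc by simp
  qed simp
  have q_lim: "?q \<longlonglongrightarrow> 0" by (rule summable_LIMSEQ_zero[OF sumq])
  have "(\<lambda>t. \<Sum>s\<le>t. first_passage K x s x) \<longlonglongrightarrow> 1 - 0"
    unfolding sum_first_passage[where K=K, OF finite_support] by (intro tendsto_intros q_lim)
  then have one: "(\<lambda>t. first_passage K x t x) sums 1"
    by (simp add: sums_def_le)
  moreover have "summable (\<lambda>t. real t * first_passage K x t x)"
  proof (rule bounded_imp_summable)
    show "0 \<le> real t * first_passage K x t x" for t using fp_nonneg by simp
    \<comment> \<open>Summation by parts; the boundary term has a favourable sign and is
      dropped.\<close>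
    have eq: "(\<Sum>s\<le>t. real s * first_passage K x s x) = (\<Sum>s<t. ?q s) - real t * ?q t" for t
      by (induction t) (simp_all add: fp_Suc algebra_simps del: first_passage.simps(2) funpow.simps)
    show "(\<Sum>s\<le>t. real s * first_passage K x s x) \<le> suminf ?q" for t
    proof -
      have "(\<Sum>s<t. ?q s) \<le> suminf ?q" by (rule sum_le_suminf[OF sumq]) (use q0 in auto)
      moreover have "0 \<le> real t * ?q t" using q0[of t] by simp
      ultimately show ?thesis unfolding eq by linarith
    qed
  qed
  ultimately show ?thesis unfolding positive_recurrent_state_def by blast
qed

text \<open>The set reached from \<open>base\<close> is closed under transitions, and it
  communicates because every state leads back to \<open>base\<close>.\<close>

theorem positive_recurrent:
  "positive_recurrent_on K (accessible K `` {base})"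
  unfolding positive_recurrent_on_def
proof (intro conjI ballI)
  fix x assume x: "x \<in> accessible K `` {base}"
  then have bx: "(base, x) \<in> accessible K" by simp
  then show "positive_recurrent_state K x" by (rule positive_recurrent_state)
  show "set_pmf (K x) \<subseteq> accessible K `` {base}"
  proof
    fix y assume "y \<in> set_pmf (K x)"
    then have "(x, y) \<in> {(x, y). y \<in> set_pmf (K x)}" by simp
    with bx have "(base, y) \<in> accessible K" unfolding accessible_def by (rule rtrancl_into_rtrancl)
    then show "y \<in> accessible K `` {base}" by simp
  qed
  fix y assume "y \<in> accessible K `` {base}"
  then have "(base, y) \<in> accessible K" by simp
  with reach_base[of x] show "(x, y) \<in> accessible K"
    unfolding accessible_def by (rule rtrancl_trans)
qed

end

section \<open>The Birkhoff polytope\<close>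

definition doubly_stochastic :: "(real ^ 'n ^ 'n::finite) set" where
  "doubly_stochastic = {x. (\<forall>i j. 0 \<le> x $ i $ j) \<and>
     (\<forall>i. (\<Sum>j\<in>UNIV. x $ i $ j) = 1) \<and> (\<forall>j. (\<Sum>i\<in>UNIV. x $ i $ j) = 1)}"

lemma doubly_stochastic_le_one:
  assumes "x \<in> doubly_stochastic"
  shows "x $ i $ j \<le> 1"
proof -
  have "x $ i $ j \<le> (\<Sum>j\<in>UNIV. x $ i $ j)"
    using assms by (intro member_le_sum) (auto simp: doubly_stochastic_def)
  then show ?thesis using assms by (simp add: doubly_stochastic_def)
qed

lemma convex_doubly_stochastic: "convex doubly_stochastic"
  unfolding convex_def doubly_stochastic_def
  by (auto simp: sum.distrib simp flip: sum_distrib_left)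

lemma compact_doubly_stochastic: "compact (doubly_stochastic :: (real ^ 'n ^ 'n::finite) set)"
proof -
  have "closed (doubly_stochastic :: (real ^ 'n ^ 'n) set)"
    unfolding doubly_stochastic_def
    by (intro closed_Collect_conj closed_Collect_all closed_Collect_le closed_Collect_eq continuous_intros)
  moreover have "bounded (doubly_stochastic :: (real ^ 'n ^ 'n) set)"
    unfolding bounded_iff
  proof (intro exI ballI)
    fix x :: "real ^ 'n ^ 'n" assume x: "x \<in> doubly_stochastic"
    have "norm x \<le> (\<Sum>i\<in>UNIV. norm (x $ i))"
      unfolding norm_vec_def[of x] by (rule L2_set_le_sum) simp
    also have "\<dots> \<le> (\<Sum>i\<in>UNIV. \<Sum>j\<in>UNIV. \<bar>x $ i $ j\<bar>)"
      by (intro sum_mono norm_le_l1_cart)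
    also have "\<dots> = (\<Sum>i\<in>(UNIV :: 'n set). \<Sum>j\<in>(UNIV :: 'n set). x $ i $ j)"
      using x by (simp add: doubly_stochastic_def)
    also have "\<dots> = (\<Sum>i\<in>(UNIV :: 'n set). 1)" using x by (simp add: doubly_stochastic_def)
    finally show "norm x \<le> (\<Sum>i\<in>(UNIV :: 'n set). 1)" .
  qed
  ultimately show ?thesis by (simp add: compact_eq_bounded_closed)
qed

text \<open>Each row and column containing a fractional entry contains at least two, so there are at
  least as many fractional cells as row and column constraints on them. The constraints are
  linearly dependent (the row sums and the column sums have the same total), whence a nonzero
  matrix supported on the fractional cells with zero margins.\<close>

lemma fractional_perturbation:
  fixes x :: "real ^ 'n ^ 'n::finite"
  assumes x: "x \<in> doubly_stochastic" and frac: "x $ a $ b \<notin> {0, 1}"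
  obtains z :: "real ^ 'n ^ 'n" where "z \<noteq> 0"
    and "\<And>i j. x $ i $ j \<in> {0, 1} \<Longrightarrow> z $ i $ j = 0"
    and "\<And>i. (\<Sum>j\<in>UNIV. z $ i $ j) = 0" and "\<And>j. (\<Sum>i\<in>UNIV. z $ i $ j) = 0"
proof -
  define F where "F = {(i, j). x $ i $ j \<notin> {0, 1}}"
  define R where "R = fst ` F"
  define C where "C = snd ` F"
  have finF: "finite F" by (rule finite_subset[of _ UNIV]) auto
  \<comment> \<open>If the other entries of the row were all integers, so would be this one, being 1
    minus their sum; an integer in [0, 1] is not fractional.\<close>
  have two: "\<exists>j'. j' \<noteq> j \<and> (i, j') \<in> F" if "(i, j) \<in> F" for i j
  proof (rule ccontr)
    assume "\<not> ?thesis"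
    then have int: "x $ i $ j' \<in> \<int>" if "j' \<noteq> j" for j' using that by (auto simp: F_def)
    have "x $ i $ j = 1 - (\<Sum>j'\<in>UNIV - {j}. x $ i $ j')"
      using x sum.remove[of UNIV j "\<lambda>j. x $ i $ j"] by (simp add: doubly_stochastic_def)
    also have "\<dots> \<in> \<int>" using int by (intro Ints_diff Ints_1 Ints_sum) auto
    finally obtain k :: int where k: "x $ i $ j = of_int k" by (auto elim: Ints_cases)
    have "0 \<le> x $ i $ j" "x $ i $ j \<le> 1"
      using x doubly_stochastic_le_one[OF x] by (auto simp: doubly_stochastic_def)
    then have "k = 0 \<or> k = 1" unfolding k by auto
    then show False using that k by (auto simp: F_def)
  qed
  have two': "\<exists>i'. i' \<noteq> i \<and> (i', j) \<in> F" if "(i, j) \<in> F" for i j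
  proof (rule ccontr)
    assume "\<not> ?thesis"
    then have int: "x $ i' $ j \<in> \<int>" if "i' \<noteq> i" for i' using that by (auto simp: F_def)
    have "x $ i $ j = 1 - (\<Sum>i'\<in>UNIV - {i}. x $ i' $ j)"
      using x sum.remove[of UNIV i "\<lambda>i. x $ i $ j"] by (simp add: doubly_stochastic_def)
    also have "\<dots> \<in> \<int>" using int by (intro Ints_diff Ints_1 Ints_sum) auto
    finally obtain k :: int where k: "x $ i $ j = of_int k" by (auto elim: Ints_cases)
    have "0 \<le> x $ i $ j" "x $ i $ j \<le> 1"
      using x doubly_stochastic_le_one[OF x] by (auto simp: doubly_stochastic_def)
    then have "k = 0 \<or> k = 1" unfolding k by auto
    then show False using that k by (auto simp: F_def)
  qed
  have two_le: "2 \<le> card A" if "p \<in> A" "q \<in> A" "p \<noteq> q" "finite A" for p q and A :: "('n \<times> 'n) set"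
    using card_mono[of A "{p, q}"] that by simp
  have cardR: "2 * card R \<le> card F"
  proof -
    have "card F = (\<Sum>i\<in>R. card {p \<in> F. fst p = i})"
      unfolding R_def using finF by (simp add: card_eq_sum sum.image_gen[of F _ fst] del: sum_constant)
    moreover have "2 \<le> card {p \<in> F. fst p = i}" if "i \<in> R" for i
    proof -
      obtain j where j: "(i, j) \<in> F" using \<open>i \<in> R\<close> by (auto simp: R_def)
      obtain j' where "j' \<noteq> j" "(i, j') \<in> F" using two[OF j] by blast
      then show ?thesis using j finF by (intro two_le[of "(i, j)" _ "(i, j')"]) auto
    qed
    ultimately show ?thesis using sum_mono[of R "\<lambda>_. 2" "\<lambda>i. card {p \<in> F. fst p = i}"] by simp
  qed
  have cardC: "2 * card C \<le> card F"
  proof -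
    have "card F = (\<Sum>i\<in>C. card {p \<in> F. snd p = i})"
      unfolding C_def using finF by (simp add: card_eq_sum sum.image_gen[of F _ snd] del: sum_constant)
    moreover have "2 \<le> card {p \<in> F. snd p = j}" if "j \<in> C" for j
    proof -
      obtain i where i: "(i, j) \<in> F" using \<open>j \<in> C\<close> by (auto simp: C_def)
      obtain i' where "i' \<noteq> i" "(i', j) \<in> F" using two'[OF i] by blast
      then show ?thesis using i finF by (intro two_le[of "(i, j)" _ "(i', j)"]) auto
    qed
    ultimately show ?thesis using sum_mono[of C "\<lambda>_. 2" "\<lambda>j. card {p \<in> F. snd p = j}"] by simp
  qed
  define S :: "(real ^ 'n ^ 'n) set" where "S = {z. \<forall>i j. (i, j) \<notin> F \<longrightarrow> z $ i $ j = 0}"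
  define m :: "real ^ 'n ^ 'n \<Rightarrow> (real ^ 'n) \<times> (real ^ 'n)"
    where "m z = ((\<chi> i. \<Sum>j\<in>UNIV. z $ i $ j), (\<chi> j. \<Sum>i\<in>UNIV. z $ i $ j))" for z
  have lin: "linear m"
    by (rule linearI) (auto simp: m_def vec_eq_iff sum.distrib sum_distrib_left)
  have subS: "subspace S" by (auto simp: S_def subspace_def)
  define B where "B = (\<lambda>(i, j). axis i (axis j (1::real))) ` F"
  have dimS: "card F \<le> dim S"
  proof -
    have inj: "inj_on (\<lambda>(i, j). axis i (axis j (1::real)) :: real ^ 'n ^ 'n) F"
      by (auto simp: inj_on_def axis_eq_axis)
    have "independent B"
    proof (rule independent_mono[OF independent_Basis])
      show "B \<subseteq> Basis" by (auto simp: B_def Basis_vec_def)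
    qed
    moreover have "B \<subseteq> S" by (auto simp: B_def S_def axis_def)
    ultimately have "card B \<le> dim S" by (simp add: independent_card_le_dim)
    then show ?thesis using inj by (simp add: B_def card_image)
  qed
  define T :: "((real ^ 'n) \<times> (real ^ 'n)) set" where "T = {(u, v).
     (\<forall>i. i \<notin> R \<longrightarrow> u $ i = 0) \<and> (\<forall>j. j \<notin> C \<longrightarrow> v $ j = 0)}"
  define H :: "((real ^ 'n) \<times> (real ^ 'n)) set" where "H = {(u, v). (\<Sum>i\<in>UNIV. u $ i) = (\<Sum>j\<in>UNIV. v $ j)}"
  have subT: "subspace T" by (auto simp: T_def subspace_def zero_prod_def)
  have subH: "subspace H" by (auto simp: H_def subspace_def zero_prod_def sum.distrib simp flip: sum_distrib_left)
  have mS: "m ` S \<subseteq> T \<inter> H"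
  proof (rule image_subsetI)
    fix z assume z: "z \<in> S"
    have "(\<Sum>i\<in>UNIV. \<Sum>j\<in>UNIV. z $ i $ j) = (\<Sum>j\<in>UNIV. \<Sum>i\<in>UNIV. z $ i $ j)" by (rule sum.swap)
    moreover have "(\<Sum>j\<in>UNIV. z $ i $ j) = 0" if "i \<notin> R" for i
      using z that by (intro sum.neutral) (force simp: S_def R_def)
    moreover have "(\<Sum>i\<in>UNIV. z $ i $ j) = 0" if "j \<notin> C" for j
      using z that by (intro sum.neutral) (force simp: S_def C_def)
    ultimately show "m z \<in> T \<inter> H" by (simp add: m_def T_def H_def)
  qed
  have dimT: "dim T \<le> card R + card C"
  proof -
    let ?B = "(\<lambda>i. (axis i 1, 0)) ` R \<union> (\<lambda>j. (0, axis j 1)) ` C :: ((real ^ 'n) \<times> (real ^ 'n)) set"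
    have "T \<subseteq> span ?B"
    proof clarify
      fix u v :: "real ^ 'n" assume uv: "(u, v) \<in> T"
      have u: "u = (\<Sum>i\<in>R. u $ i *\<^sub>R axis i 1)" and v: "v = (\<Sum>j\<in>C. v $ j *\<^sub>R axis j 1)"
        using uv by (auto simp: T_def vec_eq_iff axis_def sum.delta if_distrib cong: if_cong)
      have "(u, v) = (\<Sum>i\<in>R. u $ i *\<^sub>R (axis i 1, 0)) + (\<Sum>j\<in>C. v $ j *\<^sub>R (0, axis j 1))"
        by (subst u, subst v) (simp add: sum_prod scaleR_prod_def prod_eq_iff fst_sum snd_sum)
      also have "\<dots> \<in> span ?B"
        by (intro span_add span_sum span_scale span_base) auto
      finally show "(u, v) \<in> span ?B" .
    qed
    then have "dim T \<le> card ?B" by (rule dim_le_card) simp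
    also have "\<dots> \<le> card R + card C"
      by (rule order_trans[OF card_Un_le]) (intro add_mono card_image_le; simp)
    finally show ?thesis .
  qed
  \<comment> \<open>The row total and the column total of \<open>(axis a 1, 0)\<close> differ, so
    the equality of totals is a genuine restriction on T. The fractional cell (a, b) is needed here
    to have a in R.\<close>
  have dimTH: "dim (T \<inter> H) < dim T"
  proof -
    have ab: "(a, b) \<in> F" using frac by (simp add: F_def)
    have "(axis a 1, 0) \<in> T" using ab by (force simp: T_def R_def axis_def)
    moreover have "(axis a 1, 0) \<notin> H" by (simp add: H_def axis_def)
    ultimately have "T \<inter> H \<subset> T" by blast
    then have "span (T \<inter> H) \<subset> span T"
      using subT subH by (metis subspace_inter span_eq_iff)
    then show ?thesis by (rule dim_psubset)
  qed
  \<comment> \<open>Otherwise card F \<le> dim S \<le> dim (T \<inter> H) < dim T \<le> card R +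
    card C \<le> card F.\<close>
  have "\<not> inj_on m S"
  proof
    assume inj: "inj_on m S"
    have "dim S = dim (m ` S)"
      using dim_image_eq[of m S] lin inj subS by (simp add: span_eq_iff[THEN iffD2])
    also have "\<dots> \<le> dim (T \<inter> H)" by (rule dim_subset[OF mS])
    finally show False using dimS dimT dimTH cardR cardC by simp
  qed
  then obtain z where z: "z \<in> S" "z \<noteq> 0" "m z = 0"
    using linear_injective_on_subspace_0[OF lin subS] by blast
  show ?thesis
  proof (rule that[OF z(2)])
    show "z $ i $ j = 0" if "x $ i $ j \<in> {0, 1}" for i j
      using z(1) that by (auto simp: S_def F_def)
  qed (use z(3) in \<open>auto simp: m_def vec_eq_iff prod_eq_iff\<close>)
qed

text \<open>A fractional entry allows a motion in both directions along a matrix with zero margins,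
  so the point is the midpoint of a segment in the polytope.\<close>

lemma extreme_point_doubly_stochastic:
  fixes x :: "real ^ 'n ^ 'n::finite"
  assumes ext: "x extreme_point_of doubly_stochastic"
  shows "x $ i $ j \<in> {0, 1}"
proof (rule ccontr)
  assume frac: "x $ i $ j \<notin> {0, 1}"
  have x: "x \<in> doubly_stochastic" using ext by (simp add: extreme_point_of_def)
  obtain z :: "real ^ 'n ^ 'n" where z: "z \<noteq> 0" "\<And>i j. x $ i $ j \<in> {0, 1} \<Longrightarrow> z $ i $ j = 0"
     "\<And>i. (\<Sum>j\<in>UNIV. z $ i $ j) = 0" "\<And>j. (\<Sum>i\<in>UNIV. z $ i $ j) = 0"
    using fractional_perturbation[OF x frac] by metis
  \<comment> \<open>The least nonzero entry of x. Zero entries are replaced by 1, a harmless value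
    since x has entries at most 1 and z vanishes at those cells.\<close>
  define \<mu> where "\<mu> = Min ((\<lambda>(i, j). if x $ i $ j = 0 then 1 else x $ i $ j) ` UNIV)"
  have xnn: "0 \<le> x $ i $ j" for i j using x by (simp add: doubly_stochastic_def)
  have \<mu>: "0 < \<mu>"
    unfolding \<mu>_def by (subst Min_gr_iff) (use xnn in \<open>auto simp: less_le\<close>)
  have \<mu>_le: "\<mu> \<le> x $ i $ j" if "x $ i $ j \<noteq> 0" for i j
  proof -
    have "\<mu> \<le> (\<lambda>(i, j). if x $ i $ j = 0 then 1 else x $ i $ j) (i, j)"
      unfolding \<mu>_def by (intro Min_le imageI) auto
    then show ?thesis using that by simp
  qed
  \<comment> \<open>Every entry of z is at most norm z, so t times it stays below \<mu>; adding 1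
    keeps the denominator positive.\<close>
  define t where "t = \<mu> / (norm z + 1)"
  have t: "0 < t" using \<mu> by (simp add: t_def add_nonneg_pos)
  have tz: "t * \<bar>z $ i $ j\<bar> \<le> x $ i $ j" for i j
  proof (cases "x $ i $ j = 0")
    case False
    have "\<bar>z $ i $ j\<bar> \<le> norm z"
      using component_le_norm_cart[of "z $ i" j] Finite_Cartesian_Product.norm_nth_le[of z i]
      by (rule order_trans)
    then have "t * \<bar>z $ i $ j\<bar> \<le> t * (norm z + 1)" using t by (intro mult_left_mono) auto
    also have "\<dots> = \<mu>" by (simp add: t_def add_nonneg_eq_0_iff)
    finally show ?thesis using \<mu>_le[OF False] by simp
  qed (use z(2) in simp)
  have mem: "x + s *\<^sub>R z \<in> doubly_stochastic" if s: "\<bar>s\<bar> = t" for s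
  proof -
    have "0 \<le> x $ i $ j + s * z $ i $ j" for i j
    proof -
      have "\<bar>s * z $ i $ j\<bar> \<le> x $ i $ j" using tz[of i j] s by (simp add: abs_mult)
      then show ?thesis by simp
    qed
    then show ?thesis using x z(3,4)
      by (simp add: doubly_stochastic_def sum.distrib flip: sum_distrib_left)
  qed
  have "x + t *\<^sub>R z \<in> doubly_stochastic" "x + (- t) *\<^sub>R z \<in> doubly_stochastic"
    using t mem[of t] mem[of "- t"] by simp_all
  moreover have "x \<in> open_segment (x + t *\<^sub>R z) (x + (- t) *\<^sub>R z)"
    unfolding in_segment
  proof (intro conjI exI)
    show "x + t *\<^sub>R z \<noteq> x + (- t) *\<^sub>R z"
    proof
      assume "x + t *\<^sub>R z = x + (- t) *\<^sub>R z"
      then have "t *\<^sub>R z = (- t) *\<^sub>R z" by (simp only: add_left_cancel)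
      then have "t = - t \<or> z = 0" by (simp only: scaleR_cancel_right)
      then show False using t z(1) by simp
    qed
    show "x = (1 - 1 / 2) *\<^sub>R (x + t *\<^sub>R z) + (1 / 2) *\<^sub>R (x + (- t) *\<^sub>R z)"
      by (simp add: algebra_simps flip: scaleR_add_left)
  qed simp_all
  ultimately show False using ext by (auto simp: extreme_point_of_def)
qed

lemma maximal_schedule_of_extreme_point:
  fixes x :: "real ^ 'n ^ 'n::finite"
  assumes "x extreme_point_of doubly_stochastic"
  shows "\<exists>s \<in> maximal_schedules. x = real_vec s"
proof -
  define s :: "'n switch_vec" where "s = (\<chi> i j. of_bool (x $ i $ j = 1))"
  have eq: "x $ i $ j = real (s $ i $ j)" for i j
    using extreme_point_doubly_stochastic[OF assms, of i j] by (auto simp: s_def)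
  have x: "x \<in> doubly_stochastic" using assms by (simp add: extreme_point_of_def)
  have "real (\<Sum>j\<in>UNIV. s $ i $ j) = 1" "real (\<Sum>i\<in>UNIV. s $ i $ j) = 1" for i j
    using x by (simp_all add: doubly_stochastic_def eq)
  then have "(\<Sum>j\<in>UNIV. s $ i $ j) = 1" "(\<Sum>i\<in>UNIV. s $ i $ j) = 1" for i j
    by (metis of_nat_eq_1_iff)+
  then have "s \<in> maximal_schedules" by (auto simp: maximal_schedules_def s_def)
  then show ?thesis using eq by (intro bexI[of _ s]) (auto simp: vec_eq_iff real_vec_def)
qed

text \<open>Birkhoff's theorem in its optimisation form. If all maximal schedules had smaller weight
  than y, the open half-space below y would contain the extreme points and hence, by Krein-Milman, y
  itself.\<close>

lemma birkhoff_linear: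
  fixes q y :: "real ^ 'n ^ 'n::finite"
  assumes y: "y \<in> doubly_stochastic"
  shows "\<exists>s \<in> maximal_schedules. q \<bullet> y \<le> q \<bullet> real_vec s"
proof (rule ccontr)
  assume "\<not> ?thesis"
  then have less: "q \<bullet> real_vec s < q \<bullet> y" if "s \<in> maximal_schedules" for s
    using that by force
  have "convex hull {x :: real ^ 'n ^ 'n. x extreme_point_of doubly_stochastic} \<subseteq> {v. q \<bullet> v < q \<bullet> y}"
  proof (rule hull_minimal)
    show "{x. x extreme_point_of doubly_stochastic} \<subseteq> {v. q \<bullet> v < q \<bullet> y}"
      using maximal_schedule_of_extreme_point less by blast
    show "convex {v. q \<bullet> v < q \<bullet> y}" by (rule convex_halfspace_lt)
  qed
  then show False
    using y Krein_Milman_Minkowski[OF compact_doubly_stochastic convex_doubly_stochastic] by blast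
qed

text \<open>The row deficits r and the column deficits c have the same total T, so adding the
  rank-one matrix r c / T fills every margin up to 1; as q is nonnegative, this does not lower the
  weight. If T = 0 all deficits vanish, and division by zero adds nothing.\<close>

lemma birkhoff_substochastic:
  fixes q y :: "real ^ 'n ^ 'n::finite"
  assumes q: "\<And>i j. 0 \<le> q $ i $ j" and y: "\<And>i j. 0 \<le> y $ i $ j"
    and row: "\<And>i. (\<Sum>j\<in>UNIV. y $ i $ j) \<le> 1" and col: "\<And>j. (\<Sum>i\<in>UNIV. y $ i $ j) \<le> 1"
  shows "\<exists>s \<in> maximal_schedules. q \<bullet> y \<le> q \<bullet> real_vec s"
proof -
  define r where "r i = 1 - (\<Sum>j\<in>UNIV. y $ i $ j)" for i
  define c where "c j = 1 - (\<Sum>i\<in>UNIV. y $ i $ j)" for j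
  define T where "T = (\<Sum>i\<in>UNIV. r i)"
  have T': "T = (\<Sum>j\<in>UNIV. c j)"
    unfolding T_def r_def c_def sum_subtractf by (subst sum.swap) simp
  have r: "0 \<le> r i" and c: "0 \<le> c j" for i j using row col by (simp_all add: r_def c_def)
  have T: "0 \<le> T" using r by (simp add: T_def sum_nonneg)
  have zero: "r i = 0" "c j = 0" if "T = 0" for i j
    using that T' r c by (auto simp: T_def sum_nonneg_eq_0_iff)
  define y' :: "real ^ 'n ^ 'n" where "y' = (\<chi> i j. y $ i $ j + r i * c j / T)"
  have "y' \<in> doubly_stochastic"
    unfolding doubly_stochastic_def mem_Collect_eq
  proof (intro conjI allI)
    show "0 \<le> y' $ i $ j" for i j using y r c T by (simp add: y'_def)
    show "(\<Sum>j\<in>UNIV. y' $ i $ j) = 1" for i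
    proof -
      have "(\<Sum>j\<in>UNIV. y' $ i $ j) = 1 - r i + r i * T / T"
        by (simp add: y'_def sum.distrib r_def T' flip: sum_divide_distrib sum_distrib_left)
      then show ?thesis using zero by (cases "T = 0") simp_all
    qed
    show "(\<Sum>i\<in>UNIV. y' $ i $ j) = 1" for j
    proof -
      have "(\<Sum>i\<in>UNIV. y' $ i $ j) = 1 - c j + T * c j / T"
        by (simp add: y'_def sum.distrib c_def T_def flip: sum_divide_distrib sum_distrib_right)
      then show ?thesis using zero by (cases "T = 0") simp_all
    qed
  qed
  then obtain s where s: "s \<in> maximal_schedules" "q \<bullet> y' \<le> q \<bullet> real_vec s"
    using birkhoff_linear by blast
  have "q \<bullet> y \<le> q \<bullet> y'"
    unfolding inner_vec_def
    by (intro sum_mono) (use q r c T in \<open>auto simp: y'_def intro!: mult_left_mono\<close>)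
  then show ?thesis using s by (meson order_trans)
qed

section \<open>The switch cone\<close>

lemma inner_matrix: "x \<bullet> y = (\<Sum>i\<in>UNIV. \<Sum>j\<in>UNIV. x $ i $ j * y $ i $ j)"
  for x y :: "real ^ 'n::finite ^ 'm::finite"
  by (simp add: inner_vec_def)

text \<open>Together with \<open>col_unit\<close> these generate the cone; tested against them,
  polarity becomes a sign condition on row and column sums.\<close>

definition row_unit :: "'n::finite \<Rightarrow> real ^ 'n ^ 'n" where
  "row_unit i = (\<chi> k l. of_bool (k = i))"

definition col_unit :: "'n::finite \<Rightarrow> real ^ 'n ^ 'n" where
  "col_unit j = (\<chi> k l. of_bool (l = j))"

lemma row_unit_in_cone: "row_unit i \<in> switch_cone"
  unfolding switch_cone_def row_unit_def
  by (intro CollectI exI[of _ "\<lambda>k. of_bool (k = i)"] exI[of _ "\<lambda>_. 0"]) auto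

lemma col_unit_in_cone: "col_unit j \<in> switch_cone"
  unfolding switch_cone_def col_unit_def
  by (intro CollectI exI[of _ "\<lambda>_. 0"] exI[of _ "\<lambda>k. of_bool (k = j)"]) auto

lemma switch_cone_add: "x \<in> switch_cone \<Longrightarrow> y \<in> switch_cone \<Longrightarrow> x + y \<in> switch_cone"
  unfolding switch_cone_def
proof (clarsimp)
  fix w w' v v' :: "'a \<Rightarrow> real"
  assume "\<forall>i. 0 \<le> w i" "\<forall>j. 0 \<le> w' j" "\<forall>i. 0 \<le> v i" "\<forall>j. 0 \<le> v' j"
  then show "\<exists>u. (\<forall>i. 0 \<le> u i) \<and> (\<exists>u'. (\<forall>j. 0 \<le> u' j) \<and> (\<forall>i j. w i + w' j + (v i + v' j) = u i + u' j))"
    by (intro exI[of _ "\<lambda>i. w i + v i"] conjI exI[of _ "\<lambda>i. w' i + v' i"]) auto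
qed

lemma switch_cone_scale: "x \<in> switch_cone \<Longrightarrow> 0 \<le> c \<Longrightarrow> c *\<^sub>R x \<in> switch_cone"
  unfolding switch_cone_def
proof (clarsimp)
  fix w w' :: "'a \<Rightarrow> real"
  assume "\<forall>i. 0 \<le> w i" "\<forall>j. 0 \<le> w' j" "0 \<le> c"
  then show "\<exists>u. (\<forall>i. 0 \<le> u i) \<and> (\<exists>u'. (\<forall>j. 0 \<le> u' j) \<and> (\<forall>i j. c * (w i + w' j) = u i + u' j))"
    by (intro exI[of _ "\<lambda>i. c * w i"] conjI exI[of _ "\<lambda>i. c * w' i"]) (auto simp: algebra_simps)
qed

lemma zero_in_switch_cone: "0 \<in> switch_cone"
  using switch_cone_scale[OF row_unit_in_cone, of 0] by simp

lemma convex_cone_switch_cone: "convex_cone switch_cone"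
  unfolding convex_cone_def conic_def convex_def
  using zero_in_switch_cone by (auto intro!: switch_cone_add switch_cone_scale)

text \<open>Its purpose is closedness, without which the projection need not exist: a finitely
  generated convex cone is closed.\<close>

lemma switch_cone_eq_hull: "switch_cone = convex_cone hull (range row_unit \<union> range col_unit)"
proof
  let ?H = "convex_cone hull (range row_unit \<union> range col_unit) :: (real ^ 'a ^ 'a) set"
  have sum: "(\<Sum>i\<in>A. c i *\<^sub>R g i) \<in> ?H"
    if "finite A" "\<And>i. 0 \<le> c i" "\<And>i. g i \<in> range row_unit \<union> range col_unit" for A :: "'a set" and c g
    using that(1)
  proof induction
    case (insert i A)
    have "c i *\<^sub>R g i \<in> ?H" by (intro convex_cone_hull_mul hull_inc that)
    then have "c i *\<^sub>R g i + (\<Sum>i\<in>A. c i *\<^sub>R g i) \<in> ?H"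
      using insert.IH by (rule convex_cone_hull_add)
    then show ?case using insert.hyps by simp
  qed (simp add: convex_cone_hull_contains_0)
  show "switch_cone \<subseteq> ?H"
  proof
    fix x :: "real ^ 'a ^ 'a" assume "x \<in> switch_cone"
    then obtain w w' where w: "\<And>i. 0 \<le> w i" "\<And>j. 0 \<le> w' j" "\<And>i j. x $ i $ j = w i + w' j"
      unfolding switch_cone_def by blast
    have "x = (\<Sum>i\<in>UNIV. w i *\<^sub>R row_unit i) + (\<Sum>j\<in>UNIV. w' j *\<^sub>R col_unit j)"
      by (simp add: vec_eq_iff w(3) row_unit_def col_unit_def of_bool_def if_distrib cong: if_cong)
    also have "\<dots> \<in> ?H"
      by (intro convex_cone_hull_add sum) (use w in auto)
    finally show "x \<in> ?H" .
  qed
  show "?H \<subseteq> switch_cone"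
    by (rule hull_minimal) (use row_unit_in_cone col_unit_in_cone convex_cone_switch_cone in auto)
qed

lemma closed_switch_cone: "closed switch_cone"
  unfolding switch_cone_eq_hull by (rule closed_convex_cone_hull) simp

lemma convex_switch_cone: "convex switch_cone"
  using convex_cone_switch_cone unfolding convex_cone_def by blast

definition par :: "real ^ 'n ^ 'n \<Rightarrow> real ^ 'n ^ 'n::finite" where
  "par x = closest_point switch_cone x"

lemma par_in_cone: "par x \<in> switch_cone"
  unfolding par_def using closed_switch_cone zero_in_switch_cone by (intro closest_point_in_set) auto

lemma perp_eq: "perp x = x - par x"
  by (simp add: perp_def par_def)

lemma perp_dot: "y \<in> switch_cone \<Longrightarrow> perp x \<bullet> (y - par x) \<le> 0"
  unfolding perp_eq par_def by (intro closest_point_dot convex_switch_cone closed_switch_cone)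

text \<open>The variational inequality of the projection, tested at twice the projection and at
  0.\<close>

lemma perp_dot_par: "perp x \<bullet> par x = 0"
  using perp_dot[OF switch_cone_scale[OF par_in_cone, of 2 x], of x] perp_dot[OF zero_in_switch_cone, of x]
  by (simp add: inner_diff_right)

lemma perp_polar: "y \<in> switch_cone \<Longrightarrow> perp x \<bullet> y \<le> 0"
  using perp_dot[of y x] by (simp add: inner_diff_right perp_dot_par)

lemma inner_perp: "x \<bullet> perp x = (norm (perp x))\<^sup>2"
proof -
  have "x = perp x + par x" by (simp add: perp_eq)
  then have "x \<bullet> perp x = perp x \<bullet> perp x + par x \<bullet> perp x" by (metis inner_add_left)
  then show ?thesis using perp_dot_par[of x] by (simp add: power2_norm_eq_inner inner_commute)
qed

lemma perp_row_sum: "(\<Sum>j\<in>UNIV. perp x $ i $ j) \<le> 0"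
proof -
  have "perp x \<bullet> row_unit i = (\<Sum>k\<in>UNIV. if k = i then \<Sum>j\<in>UNIV. perp x $ k $ j else 0)"
    unfolding inner_matrix row_unit_def by (rule sum.cong) auto
  then show ?thesis using perp_polar[OF row_unit_in_cone, of x i] by simp
qed

lemma perp_col_sum: "(\<Sum>i\<in>UNIV. perp x $ i $ j) \<le> 0"
proof -
  have "perp x \<bullet> col_unit j = (\<Sum>i\<in>UNIV. perp x $ i $ j)"
    by (simp add: inner_matrix col_unit_def of_bool_def if_distrib cong: if_cong)
  then show ?thesis using perp_polar[OF col_unit_in_cone, of x j] by simp
qed

lemma norm_perp_le: "y \<in> switch_cone \<Longrightarrow> norm (perp x) \<le> norm (x - y)"
  using closest_point_le[OF closed_switch_cone, of y x] by (simp add: perp_eq par_def dist_norm)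

text \<open>By polarity the cross terms between the perpendicular part of one point and the
  projection of the other have the right sign, so dropping the difference of the projections only
  shortens the vector.\<close>

lemma norm_perp_diff_le: "norm (perp x - perp y) \<le> norm (x - y)"
proof -
  have "0 \<le> (perp x - perp y) \<bullet> (par x - par y)"
    using perp_polar[OF par_in_cone, of x y] perp_polar[OF par_in_cone, of y x]
    by (simp add: inner_diff_left inner_diff_right perp_dot_par)
  moreover have "x - y = (perp x - perp y) + (par x - par y)" by (simp add: perp_eq)
  ultimately have "(norm (perp x - perp y))\<^sup>2 \<le> (norm (x - y))\<^sup>2"
    by (simp add: power2_norm_eq_inner inner_add_left inner_add_right inner_commute)
  then show ?thesis by (simp add: power2_le_iff_abs_le)
qed

lemma cone_nonneg: "y \<in> switch_cone \<Longrightarrow> 0 \<le> y $ i $ j"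
  by (auto simp: switch_cone_def)

section \<open>Exponential moments from a drift of the square\<close>

lemma exp_le_quadratic:
  fixes x :: real
  assumes "\<bar>x\<bar> \<le> 1"
  shows "exp x \<le> 1 + x + x\<^sup>2"
proof (cases "0 \<le> x")
  case True
  then show ?thesis using exp_bound[of x] assms by simp
next
  case False
  define y where "y = - x"
  have y: "0 \<le> y" using False by (simp add: y_def)
  have "exp (- y) \<le> 1 / (1 + y)"
    using exp_ge_add_one_self[of y] y by (simp add: exp_minus field_simps)
  also have "\<dots> \<le> 1 - y + y\<^sup>2"
  proof -
    have "(1 - y + y\<^sup>2) * (1 + y) = 1 + y ^ 3" by (simp add: power2_eq_square power3_eq_cube algebra_simps)
    then show ?thesis using y by (simp add: pos_divide_le_eq)
  qed
  finally show ?thesis by (simp add: y_def)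
qed

lemma cosh_le_quadratic: "\<bar>x\<bar> \<le> 1 \<Longrightarrow> cosh x \<le> 1 + x\<^sup>2" for x :: real
  using exp_le_quadratic[of x] exp_le_quadratic[of "- x"] by (simp add: cosh_field_def)

lemma sinh_le_quadratic: "\<bar>x\<bar> \<le> 1 \<Longrightarrow> sinh x \<le> x + x\<^sup>2" for x :: real
  using exp_le_quadratic[of x] cosh_real_ge_1[of x] sinh_plus_cosh[of x] by linarith

lemma sinh_le_mult_cosh: "0 \<le> x \<Longrightarrow> sinh x \<le> x * cosh x" for x :: real
proof -
  assume x: "0 \<le> x"
  have "x * cosh x - sinh x \<ge> 0 * cosh 0 - sinh 0"
  proof (rule DERIV_nonneg_imp_nondecreasing[OF x])
    fix y :: real assume "0 \<le> y"
    then show "\<exists>D. ((\<lambda>x. x * cosh x - sinh x) has_real_derivative D) (at y) \<and> 0 \<le> D"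
      by (intro exI[of _ "y * sinh y"] conjI) (auto intro!: derivative_eq_intros)
  qed
  then show ?thesis by simp
qed

lemma sinh_ge_cosh_minus_one: "0 \<le> x \<Longrightarrow> cosh x - 1 \<le> sinh x" for x :: real
proof -
  assume "0 \<le> x"
  then have "exp (- x) \<le> 1" by simp
  then show ?thesis using cosh_minus_sinh[of x] by linarith
qed

text \<open>The hypothesis is a drift of \<open>W\<^sup>2\<close>, valid also near \<open>w = 0\<close> where a drift of \<open>W\<close> itself
  would be useless; since \<open>cosh (\<theta> W)\<close> is a smooth function of \<open>W\<^sup>2\<close>, no exceptional set
  appears in the conclusion.\<close>

lemma cosh_drift:
  fixes W :: "'b \<Rightarrow> real"
  assumes fin: "finite (set_pmf p)"
    and w: "0 \<le> w" and step: "\<And>y. y \<in> set_pmf p \<Longrightarrow> \<bar>W y - w\<bar> \<le> D"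
    and second: "measure_pmf.expectation p (\<lambda>y. (W y)\<^sup>2) \<le> w\<^sup>2 + A - B * w"
    and A: "0 \<le> A" and \<theta>: "0 < \<theta>" "\<theta> * D \<le> 1"
  shows "measure_pmf.expectation p (\<lambda>y. cosh (\<theta> * W y))
     \<le> cosh (\<theta> * w) * (1 + \<theta>\<^sup>2 * (2 * D\<^sup>2 + A / 2)) - \<theta> * B / 2 * sinh (\<theta> * w)"
proof -
  note int = integrable_measure_pmf_finite[OF fin]
  let ?c = "cosh (\<theta> * w)" and ?s = "sinh (\<theta> * w)"
  define d where "d = measure_pmf.expectation p (\<lambda>y. W y - w)"
  have c1: "1 \<le> ?c" by (rule cosh_real_ge_1)
  have s0: "0 \<le> ?s" using w \<theta> by simp
  have sc: "?s \<le> ?c" using sinh_le_cosh_real by blast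
  \<comment> \<open>Addition theorem at \<theta> w plus a small x; the part linear in x keeps the
    factor sinh (\<theta> w), which vanishes at w = 0.\<close>
  have pt: "cosh (\<theta> * W y) \<le> ?c * (1 + \<theta>\<^sup>2 * D\<^sup>2) + ?s * (\<theta> * (W y - w) + \<theta>\<^sup>2 * D\<^sup>2)" if y: "y \<in> set_pmf p" for y
  proof -
    define x where "x = \<theta> * (W y - w)"
    have x: "\<bar>x\<bar> \<le> \<theta> * D" using step[OF y] \<theta> by (simp add: x_def abs_mult)
    then have x1: "\<bar>x\<bar> \<le> 1" using \<theta> by simp
    have "x\<^sup>2 \<le> (\<theta> * D)\<^sup>2" using x by (metis abs_ge_zero order_trans power2_abs power_mono)
    then have x2: "x\<^sup>2 \<le> \<theta>\<^sup>2 * D\<^sup>2" by (simp add: power_mult_distrib)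
    have "cosh (\<theta> * W y) = cosh (\<theta> * w + x)" by (simp add: x_def algebra_simps)
    also have "\<dots> = ?c * cosh x + ?s * sinh x" by (rule cosh_add)
    also have "\<dots> \<le> ?c * (1 + \<theta>\<^sup>2 * D\<^sup>2) + ?s * (x + \<theta>\<^sup>2 * D\<^sup>2)"
      using cosh_le_quadratic[OF x1] sinh_le_quadratic[OF x1] x2 c1 s0
      by (intro add_mono mult_left_mono) auto
    finally show ?thesis by (simp add: x_def)
  qed
  have "measure_pmf.expectation p (\<lambda>y. cosh (\<theta> * W y))
     \<le> measure_pmf.expectation p (\<lambda>y. ?c * (1 + \<theta>\<^sup>2 * D\<^sup>2) + ?s * (\<theta> * (W y - w) + \<theta>\<^sup>2 * D\<^sup>2))"
    by (rule integral_mono_AE[OF int int]) (auto simp: AE_measure_pmf_iff pt)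
  also have "\<dots> = ?c * (1 + \<theta>\<^sup>2 * D\<^sup>2) + ?s * (\<theta> * d + \<theta>\<^sup>2 * D\<^sup>2)"
    using int[where f="W"] by (simp add: d_def)
  also have "\<dots> \<le> ?c * (1 + \<theta>\<^sup>2 * D\<^sup>2) + (\<theta>\<^sup>2 * A / 2 * ?c - \<theta> * B / 2 * ?s) + ?c * (\<theta>\<^sup>2 * D\<^sup>2)"
  proof -
    have "?s * (\<theta> * d) \<le> \<theta>\<^sup>2 * A / 2 * ?c - \<theta> * B / 2 * ?s"
    proof (cases "w = 0")
      case True
      then show ?thesis using A by simp
    next
      case False
      then have w0: "0 < w" using w by simp
      \<comment> \<open>Since (W - w) squared is nonnegative, a drift of the square yields a drift d
        of W itself, with an error A / (2 w) that is singular at 0.\<close>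
      have "2 * w * d \<le> measure_pmf.expectation p (\<lambda>y. (W y)\<^sup>2 - w\<^sup>2)"
      proof -
        have "2 * w * d = measure_pmf.expectation p (\<lambda>y. 2 * w * (W y - w))"
          using int[where f="W"] by (simp add: d_def)
        also have "\<dots> \<le> measure_pmf.expectation p (\<lambda>y. (W y)\<^sup>2 - w\<^sup>2)"
        proof (rule integral_mono[OF int int])
          fix y
          have "0 \<le> (W y - w)\<^sup>2" by simp
          then show "2 * w * (W y - w) \<le> (W y)\<^sup>2 - w\<^sup>2" by (simp add: power2_eq_square algebra_simps)
        qed
        finally show ?thesis .
      qed
      also have "\<dots> = measure_pmf.expectation p (\<lambda>y. (W y)\<^sup>2) - w\<^sup>2"
        by (subst Bochner_Integration.integral_diff[OF int int]) simp
      also have "\<dots> \<le> A - B * w" using second by simp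
      finally have d: "d \<le> A / (2 * w) - B / 2" using w0 by (simp add: field_simps)
      have "?s * (\<theta> * d) \<le> ?s * (\<theta> * (A / (2 * w) - B / 2))"
        using s0 \<theta> d by (intro mult_left_mono) auto
      also have "\<dots> = \<theta> * A / (2 * w) * ?s - \<theta> * B / 2 * ?s" by (simp add: algebra_simps)
      \<comment> \<open>The singular factor 1/w is absorbed by sinh (\<theta> w) \<le> \<theta> w
        cosh (\<theta> w).\<close>
      also have "\<theta> * A / (2 * w) * ?s \<le> \<theta> * A / (2 * w) * (\<theta> * w * ?c)"
        using sinh_le_mult_cosh[of "\<theta> * w"] \<theta> w0 A by (intro mult_left_mono) auto
      also have "\<dots> = \<theta>\<^sup>2 * A / 2 * ?c" using w0 by (simp add: power2_eq_square)
      finally show ?thesis by simp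
    qed
    moreover have "?s * (\<theta>\<^sup>2 * D\<^sup>2) \<le> ?c * (\<theta>\<^sup>2 * D\<^sup>2)" using sc by (intro mult_right_mono) auto
    ultimately show ?thesis by (simp add: algebra_simps)
  qed
  also have "\<dots> = ?c * (1 + \<theta>\<^sup>2 * (2 * D\<^sup>2 + A / 2)) - \<theta> * B / 2 * ?s" by (simp add: algebra_simps)
  finally show ?thesis .
qed

text \<open>The constant e in place of sqrt (2 pi) makes r = 1 an equality. The induction step
  amounts to e \<le> (1 + 1/r) powr (r + 1/2).\<close>

lemma fact_le_stirling:
  assumes "1 \<le> r"
  shows "fact r \<le> exp 1 * sqrt (real r) * (real r / exp 1) ^ r"
  using assms
proof (induction r rule: dec_induct)
  case base
  then show ?case by simp
next
  case (step r)
  have r: "0 < real r" using step by simp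
  \<comment> \<open>Chosen so that (1 + x) / (1 - x) = (r + 1) / r; then the first term 2 x of the
    series of ln ((1 + x) / (1 - x)) is exactly 1 / (r + 1/2).\<close>
  define x where "x = 1 / (2 * real r + 1)"
  have x: "0 \<le> x" "x < 1" using r by (simp_all add: x_def)
  have ln: "2 * x \<le> ln (1 + x) - ln (1 - x)"
  proof -
    have "ln (1 + 0) - ln (1 - 0) - 2 * 0 \<le> ln (1 + x) - ln (1 - x) - 2 * x"
    proof (rule DERIV_nonneg_imp_nondecreasing[OF x(1)])
      fix y :: real assume y: "0 \<le> y" "y \<le> x"
      have "0 \<le> 1 / (1 + y) + 1 / (1 - y) - 2"
      proof -
        have "1 / (1 + y) + 1 / (1 - y) - 2 = 2 * y\<^sup>2 / ((1 + y) * (1 - y))"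
        proof -
          define P where "P = (1 + y) * (1 - y)"
          have P: "0 < P" using x y by (simp add: P_def)
          have "1 / (1 + y) + 1 / (1 - y) = 2 / P"
            using x y unfolding P_def by (subst add_frac_eq) auto
          then have "1 / (1 + y) + 1 / (1 - y) - 2 = 2 * (1 - P) / P" using P by (simp add: field_simps)
          also have "1 - P = y\<^sup>2" by (simp add: P_def algebra_simps power2_eq_square)
          finally show ?thesis unfolding P_def .
        qed
        then show ?thesis using x y by simp
      qed
      then show "\<exists>D. ((\<lambda>x. ln (1 + x) - ln (1 - x) - 2 * x) has_real_derivative D) (at y) \<and> 0 \<le> D"
        using x y by (intro exI[of _ "1 / (1 + y) + 1 / (1 - y) - 2"] conjI)
          (auto intro!: derivative_eq_intros)
    qed
    then show ?thesis by simp
  qed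
  have "ln (1 + x) - ln (1 - x) = ln ((1 + x) / (1 - x))" using x by (simp add: ln_div)
  also have "(1 + x) / (1 - x) = (real r + 1) / real r"
  proof -
    have "1 + x = 2 * (real r + 1) / (2 * real r + 1)" "1 - x = 2 * real r / (2 * real r + 1)"
      using r by (simp_all add: x_def field_simps)
    then have "(1 + x) / (1 - x) = (2 * real r + 2) / (2 * real r)" using r by simp
    also have "\<dots> = (real r + 1) / real r" using r by (simp add: field_simps)
    finally show ?thesis .
  qed
  finally have "1 / (real r + 1 / 2) \<le> ln ((real r + 1) / real r)" using ln r by (simp add: x_def field_simps)
  then have "1 \<le> (real r + 1 / 2) * ln ((real r + 1) / real r)" using r by (simp add: field_simps)
  then have "exp 1 \<le> exp ((real r + 1 / 2) * ln ((real r + 1) / real r))" by simp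
  also have "\<dots> = ((real r + 1) / real r) powr (real r + 1 / 2)" using r by (simp add: powr_def)
  also have "\<dots> = ((real r + 1) / real r) ^ r * sqrt ((real r + 1) / real r)"
    using r by (simp add: powr_add powr_realpow powr_half_sqrt)
  finally have e: "exp 1 \<le> ((real r + 1) / real r) ^ r * sqrt ((real r + 1) / real r)" .
  have "fact (Suc r) = (real r + 1) * fact r" by (simp add: algebra_simps)
  also have "\<dots> \<le> (real r + 1) * (exp 1 * sqrt (real r) * (real r / exp 1) ^ r)"
    using step.IH by (intro mult_left_mono) auto
  also have "\<dots> = (real r + 1) * (sqrt (real r) * (real r / exp 1) ^ r) * exp 1" by simp
  also have "\<dots> \<le> (real r + 1) * (sqrt (real r) * (real r / exp 1) ^ r) *
      (((real r + 1) / real r) ^ r * sqrt ((real r + 1) / real r))"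
    using e r by (intro mult_left_mono) auto
  also have "\<dots> = exp 1 * sqrt (real (Suc r)) * (real (Suc r) / exp 1) ^ Suc r"
    using r by (simp add: power_divide real_sqrt_divide field_simps)
  finally show ?case .
qed

section \<open>One slot of the switch\<close>

lemma finite_bounded_switch_vec: "finite {q :: 'n::finite switch_vec. \<forall>i j. q $ i $ j \<le> N}"
proof (rule finite_subset)
  show "{q :: 'n switch_vec. \<forall>i j. q $ i $ j \<le> N}
      \<subseteq> (\<lambda>f. \<chi> i j. f (i, j)) ` (UNIV \<rightarrow>\<^sub>E {..N})"
  proof
    fix q :: "'n switch_vec" assume "q \<in> {q. \<forall>i j. q $ i $ j \<le> N}"
    then show "q \<in> (\<lambda>f. \<chi> i j. f (i, j)) ` (UNIV \<rightarrow>\<^sub>E {..N})"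
      by (intro image_eqI[of _ _ "\<lambda>(i, j). q $ i $ j"]) (auto simp: vec_eq_iff)
  qed
  show "finite ((\<lambda>f. \<chi> i j. f (i, j)) ` (UNIV \<rightarrow>\<^sub>E {..N}) :: 'n switch_vec set)"
    by (intro finite_imageI finite_PiE) auto
qed

lemma finite_schedules: "finite (schedules :: 'n::finite switch_vec set)"
  by (rule finite_subset[OF _ finite_bounded_switch_vec[of 1]])
    (auto simp: schedules_def le_Suc_eq)

lemma maximal_subset_schedules: "maximal_schedules \<subseteq> schedules"
  by (auto simp: maximal_schedules_def schedules_def)

lemma real_vec_nth [simp]: "real_vec q $ i $ j = real (q $ i $ j)"
  by (simp add: real_vec_def)

lemma uniform_rate_nth [simp]: "(uniform_rate \<epsilon> :: real ^ 'n ^ 'n::finite) $ i $ j = (1 - \<epsilon>) / real CARD('n)"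
  by (simp add: uniform_rate_def)

lemma uniform_rate_bounds:
  assumes "0 < \<epsilon>" "\<epsilon> < 1"
  shows "0 \<le> (1 - \<epsilon>) / real CARD('n::finite)" "(1 - \<epsilon>) / real CARD('n) < 1"
proof -
  have "1 \<le> real CARD('n)" by (simp add: Suc_leI)
  then have "1 - \<epsilon> < real CARD('n)" using assms by linarith
  then show "(1 - \<epsilon>) / real CARD('n) < 1" by (simp add: divide_less_eq)
  show "0 \<le> (1 - \<epsilon>) / real CARD('n)" using assms by simp
qed

section \<open>Bernoulli arrivals: support and moments up to the second order\<close>

lemma arrivals_le_one: "a \<in> set_pmf (bernoulli_arrivals rate) \<Longrightarrow> a $ i $ j \<le> 1"
  by (auto simp: bernoulli_arrivals_def)

lemma finite_set_arrivals: "finite (set_pmf (bernoulli_arrivals rate))"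
  by (rule finite_subset[OF _ finite_bounded_switch_vec[of 1]]) (use arrivals_le_one in blast)

lemma zero_in_arrivals:
  assumes "\<And>i j. 0 \<le> rate $ i $ j" "\<And>i j. rate $ i $ j < 1"
  shows "0 \<in> set_pmf (bernoulli_arrivals rate)"
proof -
  have "(\<lambda>_. False) \<in> set_pmf (Pi_pmf UNIV False (\<lambda>(i, j). bernoulli_pmf (rate $ i $ j)))"
  proof -
    have "False \<in> set_pmf (bernoulli_pmf (rate $ i $ j))" for i j
      using assms[of i j] by (simp add: set_pmf_iff)
    then show ?thesis by (auto simp: set_Pi_pmf PiE_dflt_def)
  qed
  then show ?thesis
    unfolding bernoulli_arrivals_def
    by (auto simp: vec_eq_iff intro!: image_eqI[of _ _ "\<lambda>_. False"])
qed

lemma expectation_arrival: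
  assumes "\<And>i j. 0 \<le> rate $ i $ j" "\<And>i j. rate $ i $ j \<le> 1"
  shows "measure_pmf.expectation (bernoulli_arrivals rate) (\<lambda>a. real (a $ i $ j)) = rate $ i $ j"
proof -
  let ?\<Pi> = "Pi_pmf UNIV False (\<lambda>(i, j). bernoulli_pmf (rate $ i $ j))"
  have "measure_pmf.expectation (bernoulli_arrivals rate) (\<lambda>a. real (a $ i $ j))
     = measure_pmf.expectation ?\<Pi> (\<lambda>b. of_bool (b (i, j)))"
    by (simp add: bernoulli_arrivals_def)
  also have "\<dots> = measure_pmf.expectation (map_pmf (\<lambda>b. b (i, j)) ?\<Pi>) of_bool" by simp
  also have "map_pmf (\<lambda>b. b (i, j)) ?\<Pi> = bernoulli_pmf (rate $ i $ j)"
    by (subst Pi_pmf_component) auto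
  also have "measure_pmf.expectation \<dots> of_bool = rate $ i $ j"
    using assms by simp
  finally show ?thesis .
qed

lemma expectation_arrival_mult:
  assumes r: "\<And>i j. 0 \<le> rate $ i $ j" "\<And>i j. rate $ i $ j \<le> 1" and ne: "(i, j) \<noteq> (k, l)"
  shows "measure_pmf.expectation (bernoulli_arrivals rate) (\<lambda>a. real (a $ i $ j) * real (a $ k $ l))
     = rate $ i $ j * rate $ k $ l"
proof -
  let ?p = "\<lambda>(i, j). bernoulli_pmf (rate $ i $ j)"
  \<comment> \<open>The product of two coordinates is padded with factors 1 at all other cells, to
    fit the product formula for independent families.\<close>
  let ?f = "\<lambda>e b. if e \<in> {(i, j), (k, l)} then of_bool b else 1 :: real"
  have pr: "(\<Prod>e\<in>UNIV. if e \<in> {(i, j), (k, l)} then g e else 1) = g (i, j) * g (k, l)"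
    for g :: "_ \<Rightarrow> real"
    using ne by (subst prod.inter_restrict[symmetric]) auto
  have "measure_pmf.expectation (bernoulli_arrivals rate) (\<lambda>a. real (a $ i $ j) * real (a $ k $ l))
     = measure_pmf.expectation (Pi_pmf UNIV False ?p) (\<lambda>b. of_bool (b (i, j)) * of_bool (b (k, l)))"
    by (simp add: bernoulli_arrivals_def)
  also have "\<dots> = measure_pmf.expectation (Pi_pmf UNIV False ?p) (\<lambda>b. \<Prod>e\<in>UNIV. ?f e (b e))"
    by (subst pr) simp
  also have "\<dots> = (\<Prod>e\<in>UNIV. measure_pmf.expectation (?p e) (?f e))"
    by (rule expectation_prod_Pi_pmf) (auto intro!: integrable_measure_pmf_finite split: prod.splits)
  also have "\<dots> = (\<Prod>e\<in>UNIV. if e \<in> {(i, j), (k, l)} then rate $ fst e $ snd e else 1)"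
    by (intro prod.cong refl) (use r in \<open>auto split: prod.splits\<close>)
  also have "\<dots> = rate $ i $ j * rate $ k $ l"
    by (subst pr) simp
  finally show ?thesis .
qed

lemma expectation_uniform_arrival:
  assumes "0 < \<epsilon>" "\<epsilon> < 1"
  shows "measure_pmf.expectation (bernoulli_arrivals (uniform_rate \<epsilon> :: real ^ 'n ^ 'n::finite))
     (\<lambda>a. real (a $ i $ j)) = (1 - \<epsilon>) / real CARD('n)"
  by (subst expectation_arrival)
    (use uniform_rate_bounds[OF assms, where 'n='n] in \<open>auto intro: less_imp_le\<close>)

text \<open>Binomial variance plus squared bias. It is applied with F a row, a column or all cells,
  and c the service offered to F.\<close>

lemma expectation_arrival_sum_square:
  fixes F :: "('n::finite \<times> 'n) set" and \<epsilon> c :: real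
  assumes \<epsilon>: "0 < \<epsilon>" "\<epsilon> < 1"
  defines "p \<equiv> (1 - \<epsilon>) / real CARD('n)"
  shows "measure_pmf.expectation (bernoulli_arrivals (uniform_rate \<epsilon> :: real ^ 'n ^ 'n))
      (\<lambda>a. ((\<Sum>e\<in>F. real (a $ fst e $ snd e)) - c)\<^sup>2)
     = real (card F) * p * (1 - p) + (real (card F) * p - c)\<^sup>2"
proof -
  let ?A = "bernoulli_arrivals (uniform_rate \<epsilon> :: real ^ 'n ^ 'n)"
  have int: "integrable (measure_pmf ?A) g" for g :: "_ \<Rightarrow> real"
    by (rule integrable_measure_pmf_finite[OF finite_set_arrivals])
  have p: "0 \<le> p" "p \<le> 1"
    using uniform_rate_bounds[OF \<epsilon>, where 'n='n] by (auto simp: p_def)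
  have one: "measure_pmf.expectation ?A (\<lambda>a. real (a $ fst e $ snd e)) = p" for e
    unfolding p_def by (rule expectation_uniform_arrival[OF \<epsilon>])
  have two: "measure_pmf.expectation ?A (\<lambda>a. real (a $ fst e $ snd e) * real (a $ fst f $ snd f))
      = (if e = f then p else p * p)" for e f
  proof (cases "e = f")
    case True
    have "measure_pmf.expectation ?A (\<lambda>a. real (a $ fst f $ snd f) * real (a $ fst f $ snd f))
       = measure_pmf.expectation ?A (\<lambda>a. real (a $ fst f $ snd f))"
      by (intro integral_cong_AE) (auto simp: AE_measure_pmf_iff le_Suc_eq dest!: arrivals_le_one[where i="fst f" and j="snd f"])
    then show ?thesis using True one by simp
  next
    case False
    then show ?thesis
      using expectation_arrival_mult[of "uniform_rate \<epsilon> :: real ^ 'n ^ 'n" "fst e" "snd e" "fst f" "snd f"] p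
      by (auto simp: p_def prod_eq_iff)
  qed
  have "measure_pmf.expectation ?A (\<lambda>a. ((\<Sum>e\<in>F. real (a $ fst e $ snd e)) - c)\<^sup>2)
     = measure_pmf.expectation ?A (\<lambda>a. (\<Sum>e\<in>F. \<Sum>f\<in>F. real (a $ fst e $ snd e) * real (a $ fst f $ snd f))
         - 2 * c * (\<Sum>e\<in>F. real (a $ fst e $ snd e)) + c\<^sup>2)"
    by (simp add: power2_eq_square sum_product algebra_simps)
  also have "\<dots> = (\<Sum>e\<in>F. \<Sum>f\<in>F. measure_pmf.expectation ?A (\<lambda>a. real (a $ fst e $ snd e) * real (a $ fst f $ snd f)))
         - 2 * c * (\<Sum>e\<in>F. measure_pmf.expectation ?A (\<lambda>a. real (a $ fst e $ snd e))) + c\<^sup>2"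
    by (simp add: int Bochner_Integration.integral_sum)
  also have "\<dots> = (\<Sum>e\<in>F. \<Sum>f\<in>F. if e = f then p else p * p) - 2 * c * (real (card F) * p) + c\<^sup>2"
    by (simp only: one two sum_constant)
  also have "(\<Sum>e\<in>F. \<Sum>f\<in>F. if e = f then p else p * p) = (\<Sum>e\<in>F. \<Sum>f\<in>F. p * p + (if e = f then p - p * p else 0))"
    by (intro sum.cong) auto
  also have "\<dots> = (real (card F))\<^sup>2 * (p * p) + real (card F) * (p - p * p)"
    by (simp add: sum.distrib power2_eq_square algebra_simps)
  finally show ?thesis by (simp add: power2_eq_square algebra_simps)
qed

lemma expectation_switch_kernel:
  assumes "finite (set_pmf (P q))"
  shows "measure_pmf.expectation (switch_kernel P rate q) f = measure_pmf.expectation (P q)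
     (\<lambda>s. measure_pmf.expectation (bernoulli_arrivals rate) (\<lambda>a. f (q + a - s) :: real))"
proof -
  have "measure_pmf.expectation (switch_kernel P rate q) f = measure_pmf.expectation (P q)
     (\<lambda>s. measure_pmf.expectation (map_pmf (\<lambda>a. q + a - s) (bernoulli_arrivals rate)) f)"
    unfolding switch_kernel_def
    by (rule expectation_bind_pmf(2))
      (use assms in \<open>auto intro!: integrable_measure_pmf_finite finite_imageI finite_set_arrivals
        simp del: integrable_map_pmf_eq\<close>)
  then show ?thesis by simp
qed

lemma set_switch_kernel:
  "set_pmf (switch_kernel P rate q) = {q + a - s | a s. s \<in> set_pmf (P q) \<and> a \<in> set_pmf (bernoulli_arrivals rate)}"
  by (auto simp: switch_kernel_def)

lemma finite_set_switch_kernel: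
  assumes "finite (set_pmf (P q))"
  shows "finite (set_pmf (switch_kernel P rate q))"
  unfolding switch_kernel_def by (auto intro!: assms finite_imageI finite_set_arrivals)

section \<open>Squared distances over one slot\<close>

lemma norm_matrix_power2: "(norm x)\<^sup>2 = (\<Sum>i\<in>UNIV. \<Sum>j\<in>UNIV. (x $ i $ j)\<^sup>2)"
  for x :: "real ^ 'n::finite ^ 'm::finite"
  unfolding power2_norm_eq_inner inner_matrix by (simp add: power2_eq_square)

text \<open>Truncation at 0 projects onto the nonnegative orthant, so it does not increase the
  distance to a point y of the orthant. The drifts take y = 0 and y = the projection of q onto the
  cone.\<close>

lemma norm_next_state_diff_le:
  fixes q a s :: "'n::finite switch_vec"
  assumes "\<And>i j. 0 \<le> y $ i $ j"
  shows "(norm (real_vec (q + a - s) - y))\<^sup>2 \<le> (norm (real_vec q - y + real_vec a - real_vec s))\<^sup>2"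
proof -
  have "\<bar>real (k - m) - t\<bar> \<le> \<bar>real k - real m - t\<bar>" if "0 \<le> t" for k m :: nat and t
    using that by (cases "m \<le> k") (auto simp: of_nat_diff)
  note pt = this
  have "(real ((q + a - s) $ i $ j) - y $ i $ j)\<^sup>2
     \<le> (real (q $ i $ j) - y $ i $ j + real (a $ i $ j) - real (s $ i $ j))\<^sup>2" for i j
  proof -
    have "real (q $ i $ j) - y $ i $ j + real (a $ i $ j) - real (s $ i $ j)
        = real (q $ i $ j + a $ i $ j) - real (s $ i $ j) - y $ i $ j" by simp
    then show ?thesis
      unfolding abs_le_square_iff[symmetric] vector_minus_component vector_add_component
      using pt[OF assms[of i j]] by metis
  qed
  then show ?thesis unfolding norm_matrix_power2 by (intro sum_mono) simp
qed

lemma sum_maximal_schedule: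
  fixes s :: "'n::finite switch_vec"
  assumes "s \<in> maximal_schedules"
  shows "(\<Sum>j\<in>UNIV. real (s $ i $ j)) = 1" "(\<Sum>i\<in>UNIV. real (s $ i $ j)) = 1" "s $ i $ j \<le> 1"
    "(\<Sum>i\<in>UNIV. \<Sum>j\<in>UNIV. real (s $ i $ j)) = real CARD('n)"
proof -
  have r: "(\<Sum>j\<in>UNIV. s $ i $ j) = 1" and c: "(\<Sum>i\<in>UNIV. s $ i $ j) = 1" for i j
    using assms by (auto simp: maximal_schedules_def)
  show 1: "(\<Sum>j\<in>UNIV. real (s $ i $ j)) = 1" for i
    unfolding of_nat_sum[symmetric] r by simp
  show "(\<Sum>i\<in>UNIV. real (s $ i $ j)) = 1"
    unfolding of_nat_sum[symmetric] c by simp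
  show "s $ i $ j \<le> 1" using assms by (auto simp: maximal_schedules_def le_Suc_eq)
  show "(\<Sum>i\<in>UNIV. \<Sum>j\<in>UNIV. real (s $ i $ j)) = real CARD('n)" by (simp add: 1)
qed

text \<open>For entries in {0, 1} the square of a - s is at most a + s, and the means of a and s add
  up to at most 2n over all cells.\<close>

lemma expectation_norm_increment:
  fixes z :: "real ^ 'n ^ 'n::finite"
  assumes \<epsilon>: "0 < \<epsilon>" "\<epsilon> < 1" and s: "s \<in> maximal_schedules"
  shows "measure_pmf.expectation (bernoulli_arrivals (uniform_rate \<epsilon>))
      (\<lambda>a. (norm (z + real_vec a - real_vec s))\<^sup>2)
    \<le> (norm z)\<^sup>2 + 2 * (z \<bullet> (uniform_rate \<epsilon> - real_vec s)) + 2 * real CARD('n)"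
proof -
  let ?A = "bernoulli_arrivals (uniform_rate \<epsilon> :: real ^ 'n ^ 'n)"
  have int: "integrable (measure_pmf ?A) g" for g :: "_ \<Rightarrow> real"
    by (rule integrable_measure_pmf_finite[OF finite_set_arrivals])
  have "measure_pmf.expectation ?A (\<lambda>a. (norm (z + real_vec a - real_vec s))\<^sup>2)
     \<le> measure_pmf.expectation ?A (\<lambda>a. \<Sum>i\<in>UNIV. \<Sum>j\<in>UNIV. (z $ i $ j)\<^sup>2
        + 2 * z $ i $ j * (real (a $ i $ j) - real (s $ i $ j)) + real (a $ i $ j) + real (s $ i $ j))"
  proof (rule integral_mono_AE[OF int int], unfold AE_measure_pmf_iff, rule ballI)
    fix a assume a: "a \<in> set_pmf ?A"
    show "(norm (z + real_vec a - real_vec s))\<^sup>2 \<le> (\<Sum>i\<in>UNIV. \<Sum>j\<in>UNIV. (z $ i $ j)\<^sup>2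
        + 2 * z $ i $ j * (real (a $ i $ j) - real (s $ i $ j)) + real (a $ i $ j) + real (s $ i $ j))"
      unfolding norm_matrix_power2
    proof (intro sum_mono)
      fix i j
      have "a $ i $ j = 0 \<or> a $ i $ j = 1" "s $ i $ j = 0 \<or> s $ i $ j = 1"
        using arrivals_le_one[OF a, of i j] sum_maximal_schedule(3)[OF s, of i j] by auto
      then show "((z + real_vec a - real_vec s) $ i $ j)\<^sup>2 \<le> (z $ i $ j)\<^sup>2
        + 2 * z $ i $ j * (real (a $ i $ j) - real (s $ i $ j)) + real (a $ i $ j) + real (s $ i $ j)"
        by (auto simp: power2_eq_square algebra_simps)
    qed
  qed
  also have "\<dots> = (\<Sum>i\<in>UNIV. \<Sum>j\<in>UNIV. (z $ i $ j)\<^sup>2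
        + 2 * z $ i $ j * ((1 - \<epsilon>) / real CARD('n) - real (s $ i $ j)) + (1 - \<epsilon>) / real CARD('n) + real (s $ i $ j))"
    by (simp add: int Bochner_Integration.integral_sum expectation_uniform_arrival[OF \<epsilon>])
  also have "\<dots> = (norm z)\<^sup>2 + 2 * (z \<bullet> (uniform_rate \<epsilon> - real_vec s)) + real CARD('n) * (1 - \<epsilon>) + real CARD('n)"
    by (simp add: sum.distrib norm_matrix_power2 inner_matrix sum_distrib_left sum_maximal_schedule(4)[OF s] mult.assoc)
  also have "\<dots> \<le> (norm z)\<^sup>2 + 2 * (z \<bullet> (uniform_rate \<epsilon> - real_vec s)) + 2 * real CARD('n)"
    using \<epsilon> by (simp add: algebra_simps)
  finally show ?thesis .
qed

text \<open>The set of maximisers must be shown to be finite and nonempty before its uniform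
  distribution means anything. A non-maximal schedule is a substochastic matrix, so it cannot beat
  the best maximal one. The third claim allows arbitrary substochastic competitors, which is how the
  drift bounds use it.\<close>

lemma max_weight_optimal:
  fixes q :: "'n::finite switch_vec"
  shows "finite (set_pmf (max_weight q))"
    and "s \<in> set_pmf (max_weight q) \<Longrightarrow> s \<in> maximal_schedules"
    and "s \<in> set_pmf (max_weight q) \<Longrightarrow> (\<And>i j. 0 \<le> y $ i $ j) \<Longrightarrow>
      (\<And>i. (\<Sum>j\<in>UNIV. y $ i $ j) \<le> 1) \<Longrightarrow> (\<And>j. (\<Sum>i\<in>UNIV. y $ i $ j) \<le> 1) \<Longrightarrow>
      real_vec q \<bullet> y \<le> real_vec q \<bullet> real_vec s"
proof -
  let ?M = "{s \<in> maximal_schedules. \<forall>s'\<in>schedules. real_vec q \<bullet> real_vec s' \<le> real_vec q \<bullet> real_vec s}"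
  have sub: "\<exists>s \<in> maximal_schedules. real_vec q \<bullet> y \<le> real_vec q \<bullet> real_vec s"
    if "\<And>i j. 0 \<le> y $ i $ j" "\<And>i. (\<Sum>j\<in>UNIV. y $ i $ j) \<le> 1" "\<And>j. (\<Sum>i\<in>UNIV. y $ i $ j) \<le> 1"
    for y :: "real ^ 'n ^ 'n"
    using that by (intro birkhoff_substochastic) auto
  have fin: "finite (maximal_schedules :: 'n switch_vec set)"
    using finite_subset[OF maximal_subset_schedules finite_schedules] .
  have "maximal_schedules \<noteq> ({} :: 'n switch_vec set)" using sub[of 0] by auto
  then obtain s0 where s0: "s0 \<in> maximal_schedules"
    and best: "\<And>s. s \<in> maximal_schedules \<Longrightarrow> real_vec q \<bullet> real_vec s \<le> real_vec q \<bullet> real_vec s0"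
  proof -
    let ?f = "\<lambda>s. real_vec q \<bullet> real_vec s"
    assume ne: "maximal_schedules \<noteq> ({} :: 'n switch_vec set)"
    have "Max (?f ` maximal_schedules) \<in> ?f ` maximal_schedules"
      by (rule Max_in) (use fin ne in auto)
    then obtain s0 where "s0 \<in> maximal_schedules" "Max (?f ` maximal_schedules) = ?f s0" by blast
    then show thesis
      by (intro that[of s0]) (use fin Max_ge[of "?f ` maximal_schedules"] in auto)
  qed
  have "real_vec q \<bullet> real_vec s' \<le> real_vec q \<bullet> real_vec s0" if s': "s' \<in> schedules" for s'
  proof -
    have "real (\<Sum>j\<in>UNIV. s' $ i $ j) \<le> 1" "real (\<Sum>i\<in>UNIV. s' $ i $ j) \<le> 1" for i j
      using s' by (auto simp: schedules_def simp del: of_nat_sum)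
    then obtain s1 where "s1 \<in> maximal_schedules" "real_vec q \<bullet> real_vec s' \<le> real_vec q \<bullet> real_vec s1"
      using sub[of "real_vec s'"] by auto
    then show ?thesis using best[of s1] by linarith
  qed
  then have ne: "?M \<noteq> {}" using s0 by blast
  have finM: "finite ?M" using fin by simp
  have set: "set_pmf (max_weight q) = ?M"
    unfolding max_weight_def by (rule set_pmf_of_set[OF ne finM])
  show "finite (set_pmf (max_weight q))" unfolding set by (rule finM)
  show "s \<in> maximal_schedules" if "s \<in> set_pmf (max_weight q)" using that unfolding set by blast
  show "real_vec q \<bullet> y \<le> real_vec q \<bullet> real_vec s"
    if s: "s \<in> set_pmf (max_weight q)" and y: "\<And>i j. 0 \<le> y $ i $ j"
      "\<And>i. (\<Sum>j\<in>UNIV. y $ i $ j) \<le> 1" "\<And>j. (\<Sum>i\<in>UNIV. y $ i $ j) \<le> 1"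
  proof -
    obtain s1 where s1: "s1 \<in> maximal_schedules" "real_vec q \<bullet> y \<le> real_vec q \<bullet> real_vec s1"
      using sub[OF y] by blast
    have "real_vec q \<bullet> real_vec s1 \<le> real_vec q \<bullet> real_vec s"
      using s s1(1) maximal_subset_schedules unfolding set by blast
    then show ?thesis using s1(2) by linarith
  qed
qed

section \<open>Drift under MaxWeight\<close>

lemma abs_sum_matrix_le: "\<bar>\<Sum>i\<in>UNIV. \<Sum>j\<in>UNIV. x $ i $ j\<bar> \<le> real CARD('n) * norm x"
  for x :: "real ^ 'n::finite ^ 'n"
proof -
  let ?one = "(\<chi> i j. 1) :: real ^ 'n ^ 'n"
  have "(norm ?one)\<^sup>2 = (real CARD('n))\<^sup>2"
    unfolding norm_matrix_power2 by (simp add: power2_eq_square)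
  then have "norm ?one = real CARD('n)" by (rule power2_eq_imp_eq) simp_all
  then have "\<bar>x \<bullet> ?one\<bar> \<le> real CARD('n) * norm x"
    using Cauchy_Schwarz_ineq2[of x ?one] by (simp add: mult.commute)
  then show ?thesis by (simp add: inner_matrix)
qed

lemma norm_le_sum_matrix:
  fixes x :: "real ^ 'n::finite ^ 'm::finite"
  assumes "\<And>i j. 0 \<le> x $ i $ j"
  shows "norm x \<le> (\<Sum>i\<in>UNIV. \<Sum>j\<in>UNIV. x $ i $ j)"
proof -
  have "norm x \<le> (\<Sum>i\<in>UNIV. norm (x $ i))"
    unfolding norm_vec_def[of x] by (rule L2_set_le_sum) simp
  also have "\<dots> \<le> (\<Sum>i\<in>UNIV. \<Sum>j\<in>UNIV. \<bar>x $ i $ j\<bar>)"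
    by (intro sum_mono norm_le_l1_cart)
  finally show ?thesis using assms by simp
qed

lemma real_total_queue: "real (total_queue q) = (\<Sum>i\<in>UNIV. \<Sum>j\<in>UNIV. real_vec q $ i $ j)"
  by (simp add: total_queue_def)

text \<open>On the cone all maximal schedules weigh as much as the matrix with entries 1/n: the
  projected part of the queue is indifferent to the choice of the schedule.\<close>

lemma cone_inner_schedule:
  fixes y :: "real ^ 'n ^ 'n::finite"
  assumes y: "y \<in> switch_cone" and s: "s \<in> maximal_schedules"
  shows "y \<bullet> real_vec s = (\<Sum>i\<in>UNIV. \<Sum>j\<in>UNIV. y $ i $ j) / real CARD('n)"
proof -
  obtain w w' where w: "\<And>i j. y $ i $ j = w i + w' j" using y by (auto simp: switch_cone_def)
  have "y \<bullet> real_vec s = (\<Sum>i\<in>UNIV. \<Sum>j\<in>UNIV. w i * real (s $ i $ j)) + (\<Sum>i\<in>UNIV. \<Sum>j\<in>UNIV. w' j * real (s $ i $ j))"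
    by (simp add: inner_matrix w distrib_right sum.distrib)
  also have "(\<Sum>i\<in>UNIV. \<Sum>j\<in>UNIV. w' j * real (s $ i $ j)) = (\<Sum>j\<in>UNIV. \<Sum>i\<in>UNIV. w' j * real (s $ i $ j))"
    by (rule sum.swap)
  finally have "y \<bullet> real_vec s = sum w UNIV + sum w' UNIV"
    using sum_maximal_schedule[OF s] by (simp flip: sum_distrib_left)
  moreover have "(\<Sum>i\<in>UNIV. \<Sum>j\<in>UNIV. y $ i $ j) = real CARD('n) * (sum w UNIV + sum w' UNIV)"
    by (simp add: w sum.distrib distrib_left flip: sum_distrib_left)
  ultimately show ?thesis by simp
qed

lemma expectation_le_const:
  assumes "finite (set_pmf p)" and "\<And>x. x \<in> set_pmf p \<Longrightarrow> f x \<le> (c :: real)"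
  shows "measure_pmf.expectation p f \<le> c"
proof -
  have "measure_pmf.expectation p f \<le> measure_pmf.expectation p (\<lambda>_. c)"
    by (rule integral_mono_AE) (use assms in \<open>auto intro!: integrable_measure_pmf_finite simp: AE_measure_pmf_iff\<close>)
  then show ?thesis by simp
qed

abbreviation (input) mw_kernel :: "real \<Rightarrow> 'n::finite switch_vec \<Rightarrow> 'n switch_vec pmf" where
  "mw_kernel \<epsilon> \<equiv> switch_kernel max_weight (uniform_rate \<epsilon>)"

lemma finite_set_mw_kernel: "finite (set_pmf (mw_kernel \<epsilon> q))"
  by (rule finite_set_switch_kernel[OF max_weight_optimal(1)])

lemma mw_norm_drift:
  fixes q :: "'n::finite switch_vec" and y :: "real ^ 'n ^ 'n"
  assumes \<epsilon>: "0 < \<epsilon>" "\<epsilon> < 1" and y: "\<And>i j. 0 \<le> y $ i $ j"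
    and c: "\<And>s. s \<in> set_pmf (max_weight q) \<Longrightarrow>
      (real_vec q - y) \<bullet> (uniform_rate \<epsilon> - real_vec s) \<le> c"
  shows "measure_pmf.expectation (mw_kernel \<epsilon> q) (\<lambda>q'. (norm (real_vec q' - y))\<^sup>2)
    \<le> (norm (real_vec q - y))\<^sup>2 + 2 * c + 2 * real CARD('n)"
proof -
  have "measure_pmf.expectation (bernoulli_arrivals (uniform_rate \<epsilon>))
      (\<lambda>a. (norm (real_vec (q + a - s) - y))\<^sup>2) \<le> (norm (real_vec q - y))\<^sup>2 + 2 * c + 2 * real CARD('n)"
    if s: "s \<in> set_pmf (max_weight q)" for s
  proof -
    have "measure_pmf.expectation (bernoulli_arrivals (uniform_rate \<epsilon>))
      (\<lambda>a. (norm (real_vec (q + a - s) - y))\<^sup>2)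
      \<le> measure_pmf.expectation (bernoulli_arrivals (uniform_rate \<epsilon>))
      (\<lambda>a. (norm (real_vec q - y + real_vec a - real_vec s))\<^sup>2)"
      by (intro integral_mono integrable_measure_pmf_finite finite_set_arrivals norm_next_state_diff_le y)
    also have "\<dots> \<le> (norm (real_vec q - y))\<^sup>2
        + 2 * ((real_vec q - y) \<bullet> (uniform_rate \<epsilon> - real_vec s)) + 2 * real CARD('n)"
      by (rule expectation_norm_increment[OF \<epsilon> max_weight_optimal(2)[OF s]])
    finally show ?thesis using c[OF s] by simp
  qed
  then show ?thesis
    unfolding expectation_switch_kernel[where P=max_weight, OF max_weight_optimal(1)]
    by (rule expectation_le_const[OF max_weight_optimal(1)])
qed

text \<open>The competitor is the matrix with all entries 1/n, which exceeds the arrival rate by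
  \<epsilon>/n in every cell.\<close>

lemma mw_queue_drift:
  fixes q :: "'n::finite switch_vec"
  assumes \<epsilon>: "0 < \<epsilon>" "\<epsilon> < 1"
  shows "measure_pmf.expectation (mw_kernel \<epsilon> q) (\<lambda>q'. (norm (real_vec q'))\<^sup>2)
    \<le> (norm (real_vec q))\<^sup>2 + 2 * real CARD('n) - 2 * \<epsilon> / real CARD('n) * norm (real_vec q)"
proof -
  let ?n = "real CARD('n)" and ?T = "\<Sum>i\<in>UNIV. \<Sum>j\<in>UNIV. real_vec q $ i $ j"
  have "(real_vec q - 0) \<bullet> (uniform_rate \<epsilon> - real_vec s) \<le> - (\<epsilon> / ?n * norm (real_vec q))"
    if s: "s \<in> set_pmf (max_weight q)" for s
  proof -
    have "real_vec q \<bullet> (\<chi> i j. 1 / ?n) \<le> real_vec q \<bullet> real_vec s"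
      by (rule max_weight_optimal(3)[OF s]) simp_all
    moreover have "real_vec q \<bullet> (\<chi> i j. 1 / ?n) = ?T / ?n"
      by (simp add: inner_matrix sum_divide_distrib)
    moreover have "real_vec q \<bullet> uniform_rate \<epsilon> = (1 - \<epsilon>) / ?n * ?T"
      by (simp add: inner_matrix sum_distrib_left mult.commute)
    moreover have "\<epsilon> / ?n * norm (real_vec q) \<le> \<epsilon> / ?n * ?T"
      using \<epsilon> by (intro mult_left_mono norm_le_sum_matrix) auto
    ultimately show ?thesis by (simp add: inner_diff_right diff_divide_distrib left_diff_distrib)
  qed
  from mw_norm_drift[where y=0, OF \<epsilon> _ this] show ?thesis by simp
qed

text \<open>The old projection is a point of the cone, hence an admissible competitor for the new
  state. This bounds the new perpendicular norm by the distance to a fixed point, to which the drift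
  of squared distances applies.\<close>

lemma mw_perp_drift:
  fixes q :: "'n::finite switch_vec"
  assumes \<epsilon>: "0 < \<epsilon>" "\<epsilon> < 1" "\<epsilon> \<le> 1 / (2 * real CARD('n))"
  shows "measure_pmf.expectation (mw_kernel \<epsilon> q) (\<lambda>q'. (norm (perp (real_vec q')))\<^sup>2)
    \<le> (norm (perp (real_vec q)))\<^sup>2 + 2 * real CARD('n) - 1 / real CARD('n) * norm (perp (real_vec q))"
proof -
  let ?n = "real CARD('n)" and ?sum = "\<lambda>x :: real ^ 'n ^ 'n. \<Sum>i\<in>UNIV. \<Sum>j\<in>UNIV. x $ i $ j"
  let ?x = "real_vec q"
  define W where "W = norm (perp ?x)"
  have q: "?x = par ?x + perp ?x" by (simp add: perp_eq)
  have sumq: "?sum ?x = ?sum (par ?x) + ?sum (perp ?x)"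
    by (subst q) (simp add: sum.distrib)
  \<comment> \<open>The case W = 0 is separate because the test matrix divides by W; there the
    uniform matrix suffices.\<close>
  have opt: "?sum ?x / ?n + W / ?n \<le> ?x \<bullet> real_vec s" if s: "s \<in> set_pmf (max_weight q)" for s
  proof (cases "W = 0")
    case True
    have "?x \<bullet> (\<chi> i j. 1 / ?n) \<le> ?x \<bullet> real_vec s"
      by (rule max_weight_optimal(3)[OF s]) simp_all
    then show ?thesis using True by (simp add: inner_matrix sum_divide_distrib)
  next
    case False
    then have W: "0 < W" by (simp add: W_def)
    define y where "y = (\<chi> i j. 1 / ?n) + (1 / (?n * W)) *\<^sub>R perp ?x"
    have "?x \<bullet> y \<le> ?x \<bullet> real_vec s"
    proof (rule max_weight_optimal(3)[OF s])
      fix i j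
      have "\<bar>perp ?x $ i $ j\<bar> \<le> W"
        using component_le_norm_cart[of "perp ?x $ i" j] Finite_Cartesian_Product.norm_nth_le[of "perp ?x" i]
        unfolding W_def by (rule order_trans)
      then have "- 1 \<le> perp ?x $ i $ j / W" using W by (simp add: field_simps)
      then have "0 \<le> (1 + perp ?x $ i $ j / W) / ?n" by simp
      then show "0 \<le> y $ i $ j" by (simp add: y_def add_divide_distrib mult.commute)
    next
      fix i
      have "(\<Sum>j\<in>UNIV. y $ i $ j) = 1 + 1 / (?n * W) * (\<Sum>j\<in>UNIV. perp ?x $ i $ j)"
        by (simp add: y_def sum.distrib sum_divide_distrib)
      moreover have "1 / (?n * W) * (\<Sum>j\<in>UNIV. perp ?x $ i $ j) \<le> 0"
        using W perp_row_sum[of ?x i] by (intro mult_nonneg_nonpos) auto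
      ultimately show "(\<Sum>j\<in>UNIV. y $ i $ j) \<le> 1" by simp
    next
      fix j
      have "(\<Sum>i\<in>UNIV. y $ i $ j) = 1 + 1 / (?n * W) * (\<Sum>i\<in>UNIV. perp ?x $ i $ j)"
        by (simp add: y_def sum.distrib sum_divide_distrib)
      moreover have "1 / (?n * W) * (\<Sum>i\<in>UNIV. perp ?x $ i $ j) \<le> 0"
        using W perp_col_sum[of ?x j] by (intro mult_nonneg_nonpos) auto
      ultimately show "(\<Sum>i\<in>UNIV. y $ i $ j) \<le> 1" by simp
    qed
    moreover have "?x \<bullet> y = ?sum ?x / ?n + W / ?n"
    proof -
      have "?x \<bullet> (\<chi> i j. 1 / ?n) = ?sum ?x / ?n" by (simp add: inner_matrix sum_divide_distrib)
      moreover have "?x \<bullet> ((1 / (?n * W)) *\<^sub>R perp ?x) = W / ?n"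
        using W by (simp add: inner_perp W_def power2_eq_square)
      ultimately show ?thesis by (simp add: y_def inner_add_right)
    qed
    ultimately show ?thesis by simp
  qed
  have "(?x - par ?x) \<bullet> (uniform_rate \<epsilon> - real_vec s) \<le> \<epsilon> * W - W / ?n"
    if s: "s \<in> set_pmf (max_weight q)" for s
  proof -
    have x: "?x - par ?x = perp ?x" by (simp add: perp_eq)
    have "perp ?x \<bullet> real_vec s = ?x \<bullet> real_vec s - ?sum (par ?x) / ?n"
      using cone_inner_schedule[OF par_in_cone max_weight_optimal(2)[OF s], of ?x]
      by (simp add: perp_eq inner_diff_left)
    moreover have "perp ?x \<bullet> uniform_rate \<epsilon> = (1 - \<epsilon>) / ?n * ?sum (perp ?x)"
      by (simp add: inner_matrix sum_distrib_left mult.commute)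
    \<comment> \<open>The price of arrival rates below 1/n, by Cauchy-Schwarz against the all-ones
      matrix of norm n.\<close>
    moreover have "- (\<epsilon> / ?n * ?sum (perp ?x)) \<le> \<epsilon> * W"
    proof -
      have "\<epsilon> / ?n * (- ?sum (perp ?x)) \<le> \<epsilon> / ?n * (?n * W)"
        using abs_sum_matrix_le[of "perp ?x"] \<epsilon> unfolding W_def by (intro mult_left_mono) auto
      then show ?thesis by simp
    qed
    moreover have "(1 - \<epsilon>) / ?n * ?sum (perp ?x) = ?sum (perp ?x) / ?n - \<epsilon> / ?n * ?sum (perp ?x)"
      by (simp add: diff_divide_distrib left_diff_distrib)
    ultimately show ?thesis
      using opt[OF s] unfolding x sumq by (simp add: inner_diff_right add_divide_distrib)
  qed
  from mw_norm_drift[where y="par ?x", OF \<epsilon>(1,2) cone_nonneg[OF par_in_cone] this]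
  have "measure_pmf.expectation (mw_kernel \<epsilon> q) (\<lambda>q'. (norm (real_vec q' - par ?x))\<^sup>2)
    \<le> W\<^sup>2 + 2 * (\<epsilon> * W - W / ?n) + 2 * ?n" by (simp add: W_def perp_eq)
  moreover have "measure_pmf.expectation (mw_kernel \<epsilon> q) (\<lambda>q'. (norm (perp (real_vec q')))\<^sup>2)
     \<le> measure_pmf.expectation (mw_kernel \<epsilon> q) (\<lambda>q'. (norm (real_vec q' - par ?x))\<^sup>2)"
    by (intro integral_mono integrable_measure_pmf_finite finite_set_mw_kernel power_mono
         norm_perp_le par_in_cone) simp
  \<comment> \<open>The range of \<epsilon> enters here: half of the restoring drift 2 W / n pays
    for 2 \<epsilon> W, and W / n remains, independently of \<epsilon>.\<close>
  moreover have "\<epsilon> * W \<le> 1 / (2 * ?n) * W"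
    using \<epsilon> by (intro mult_right_mono) (auto simp: W_def)
  ultimately show ?thesis unfolding W_def[symmetric] by simp
qed

lemma mw_kernel_step:
  fixes q :: "'n::finite switch_vec"
  assumes q': "q' \<in> set_pmf (mw_kernel \<epsilon> q)"
  shows "norm (real_vec q' - real_vec q) \<le> real CARD('n)"
proof -
  obtain a s where as: "q' = q + a - s" "s \<in> maximal_schedules"
      "a \<in> set_pmf (bernoulli_arrivals (uniform_rate \<epsilon>))"
    using q' max_weight_optimal(2) unfolding set_switch_kernel by blast
  have "(real (q' $ i $ j) - real (q $ i $ j))\<^sup>2 \<le> 1" for i j
  proof -
    have "\<bar>real (q' $ i $ j) - real (q $ i $ j)\<bar> \<le> 1"
      using arrivals_le_one[OF as(3), of i j] sum_maximal_schedule(3)[OF as(2), of i j]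
      by (simp add: as(1))
    then show ?thesis by (simp add: abs_square_le_1)
  qed
  then have "(norm (real_vec q' - real_vec q))\<^sup>2 \<le> (\<Sum>i\<in>(UNIV :: 'n set). \<Sum>j\<in>(UNIV :: 'n set). 1)"
    unfolding norm_matrix_power2 by (intro sum_mono) simp
  also have "\<dots> = (real CARD('n))\<^sup>2" by (simp add: power2_eq_square)
  finally show ?thesis by (simp add: power2_le_iff_abs_le)
qed

section \<open>Reachability, Lyapunov functions and moments of the MaxWeight chain\<close>

lemma mw_reach_zero:
  fixes q :: "'n::finite switch_vec"
  assumes \<epsilon>: "0 < \<epsilon>" "\<epsilon> < 1"
  shows "(q, 0) \<in> accessible (mw_kernel \<epsilon>)"
proof (induction "total_queue q" arbitrary: q rule: less_induct)
  case less
  show ?case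
  proof (cases "q = 0")
    case True
    then show ?thesis by (simp add: accessible_def)
  next
    case False
    then obtain k l where kl: "0 < q $ k $ l" by (auto simp: vec_eq_iff)
    \<comment> \<open>A slot without arrivals has positive probability. The chosen schedule has
      positive weight on a nonzero queue, so it serves some nonempty cell and the total
      decreases.\<close>
    obtain s where s: "s \<in> set_pmf (max_weight q)" using set_pmf_not_empty by fast
    have "0 \<in> set_pmf (bernoulli_arrivals (uniform_rate \<epsilon> :: real ^ 'n ^ 'n))"
      using uniform_rate_bounds[OF \<epsilon>, where 'n='n] by (intro zero_in_arrivals) auto
    then have step: "q - s \<in> set_pmf (mw_kernel \<epsilon> q)"
      using s unfolding set_switch_kernel by force
    have "real_vec q \<bullet> (\<chi> i j. 1 / real CARD('n)) \<le> real_vec q \<bullet> real_vec s"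
      by (rule max_weight_optimal(3)[OF s]) simp_all
    moreover have "0 < real_vec q \<bullet> (\<chi> i j. 1 / real CARD('n))"
      unfolding inner_matrix
      by (intro sum_pos2[of _ k] sum_pos2[of _ l] sum_nonneg) (use kl in auto)
    ultimately have pos: "0 < real_vec q \<bullet> real_vec s" by simp
    obtain i j where ij: "0 < q $ i $ j" "0 < s $ i $ j"
    proof (rule ccontr)
      assume "\<not> thesis"
      then have z: "real (q $ i $ j) * real (s $ i $ j) = 0" for i j using that by (metis mult_eq_0_iff neq0_conv of_nat_0)
      have "real_vec q \<bullet> real_vec s = 0" unfolding inner_matrix real_vec_nth z by simp
      then show False using pos by simp
    qed
    have "total_queue (q - s) < total_queue q"
      unfolding total_queue_def
    proof (rule sum_strict_mono_ex1)
      show "\<forall>i\<in>UNIV. (\<Sum>j\<in>UNIV. (q - s) $ i $ j) \<le> (\<Sum>j\<in>UNIV. q $ i $ j)"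
        by (intro ballI sum_mono) simp
      have "(\<Sum>j\<in>UNIV. (q - s) $ i $ j) < (\<Sum>j\<in>UNIV. q $ i $ j)"
        by (rule sum_strict_mono_ex1) (use ij in \<open>auto intro!: exI[of _ j]\<close>)
      then show "\<exists>i\<in>UNIV. (\<Sum>j\<in>UNIV. (q - s) $ i $ j) < (\<Sum>j\<in>UNIV. q $ i $ j)" by blast
    qed simp
    from less[OF this] have "(q - s, 0) \<in> {(x, y). y \<in> set_pmf (mw_kernel \<epsilon> x)}\<^sup>*"
      by (simp only: accessible_def)
    moreover have "(q, q - s) \<in> {(x, y). y \<in> set_pmf (mw_kernel \<epsilon> x)}" using step by simp
    ultimately show ?thesis unfolding accessible_def by (rule converse_rtrancl_into_rtrancl[rotated])
  qed
qed

lemma mw_zero_loop: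
  assumes \<epsilon>: "0 < \<epsilon>" "\<epsilon> < 1"
  shows "0 \<in> set_pmf (mw_kernel \<epsilon> (0 :: 'n::finite switch_vec))"
proof -
  obtain s where s: "s \<in> set_pmf (max_weight (0 :: 'n switch_vec))" using set_pmf_not_empty by fast
  have "0 \<in> set_pmf (bernoulli_arrivals (uniform_rate \<epsilon> :: real ^ 'n ^ 'n))"
    using uniform_rate_bounds[OF \<epsilon>, where 'n='n] by (intro zero_in_arrivals) auto
  moreover have "0 = 0 + 0 - s" by (simp add: vec_eq_iff)
  ultimately show ?thesis using s unfolding set_switch_kernel by blast
qed

text \<open>The constant term of the series is kept as - 1, which matters for the moments below:
  from a mean of cosh of at most 4/3 it gives the factor 2 * 4/3 - 1 = 5/3, within the factor 2 of
  \<open>M_bound\<close>; the factor 8/3 would not fit.\<close>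

lemma exp_ge_power_over_fact:
  fixes x :: real
  assumes "0 \<le> x" "1 \<le> r"
  shows "x ^ r / fact r \<le> exp x - 1"
proof -
  have sm: "summable (\<lambda>k. x ^ k /\<^sub>R fact k)" by (rule summable_exp_generic)
  have "(\<Sum>k\<in>{0, r}. x ^ k /\<^sub>R fact k) \<le> (\<Sum>k. x ^ k /\<^sub>R fact k)"
    by (rule sum_le_suminf[OF sm]) (use assms in auto)
  then show ?thesis using assms by (simp add: exp_def divide_inverse mult.commute)
qed

lemma exp_le_two_cosh: "exp x \<le> 2 * cosh x" for x :: real
  by (simp add: cosh_field_def)

lemma mw_geometric_drift:
  assumes \<epsilon>: "0 < \<epsilon>" "\<epsilon> < 1"
  shows "\<exists>\<theta>>0. \<exists>\<gamma> C. geometric_drift (mw_kernel \<epsilon> :: 'n::finite switch_vec \<Rightarrow> _)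
     (\<lambda>q. cosh (\<theta> * norm (real_vec q))) \<gamma> C 0"
proof -
  let ?n = "real CARD('n)"
  have n: "1 \<le> ?n" by (simp add: Suc_leI)
  \<comment> \<open>N is the coefficient 2 D^2 + A/2 of \<open>cosh_drift\<close> for D = n and A =
    2 n. The exponent \<theta> is then chosen so that the growth \<theta>^2 N is half of the decay
    rate b.\<close>
  define N where "N = 2 * ?n\<^sup>2 + ?n"
  define \<theta> where "\<theta> = \<epsilon> / (2 * ?n * N)"
  define b where "b = \<theta> * \<epsilon> / ?n"
  have nn: "1 \<le> ?n\<^sup>2" using n by simp
  have N: "?n \<le> N" "1 \<le> N" unfolding N_def using n nn by linarith+
  have \<theta>: "0 < \<theta>" using \<epsilon> n N by (simp add: \<theta>_def)
  have nN: "1 \<le> ?n * N" using n N mult_mono[of 1 ?n 1 N] by simp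
  have \<theta>1: "\<theta> \<le> 1 / ?n"
  proof -
    have "\<theta> * ?n = \<epsilon> / (2 * N)" using n N by (simp add: \<theta>_def)
    also have "\<dots> \<le> 1" using \<epsilon> N by (simp add: divide_le_eq)
    finally show ?thesis using n by (simp add: field_simps)
  qed
  have \<theta>n: "\<theta> * ?n \<le> 1" using \<theta>1 n by (simp add: field_simps)
  have b0: "0 < b" using \<theta> \<epsilon> n by (simp add: b_def)
  have b1: "b \<le> 1"
  proof -
    have "b \<le> \<theta> * ?n"
    proof -
      have "\<epsilon> / ?n \<le> ?n" using \<epsilon> n nn by (simp add: divide_le_eq power2_eq_square)
      then show ?thesis using mult_left_mono[of "\<epsilon> / ?n" ?n \<theta>] \<theta> by (simp add: b_def)
    qed
    then show ?thesis using \<theta>n by simp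
  qed
  have quad: "\<theta>\<^sup>2 * (2 * ?n\<^sup>2 + 2 * ?n / 2) = b / 2"
  proof -
    have "2 * ?n\<^sup>2 + 2 * ?n / 2 = N" by (simp add: N_def)
    moreover have "\<theta> * N = \<epsilon> / (2 * ?n)" using N(2) by (simp add: \<theta>_def)
    ultimately show ?thesis by (simp add: b_def power2_eq_square mult.assoc)
  qed
  let ?V = "\<lambda>q :: 'n switch_vec. cosh (\<theta> * norm (real_vec q))"
  have drift: "measure_pmf.expectation (mw_kernel \<epsilon> q) ?V \<le> (1 - b / 2) * ?V q + b" for q :: "'n switch_vec"
  proof -
    let ?w = "norm (real_vec q)"
    have "measure_pmf.expectation (mw_kernel \<epsilon> q) ?V
       \<le> cosh (\<theta> * ?w) * (1 + \<theta>\<^sup>2 * (2 * ?n\<^sup>2 + 2 * ?n / 2)) - \<theta> * (2 * \<epsilon> / ?n) / 2 * sinh (\<theta> * ?w)"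
    proof (rule cosh_drift[OF finite_set_mw_kernel])
      show "\<bar>norm (real_vec y) - norm (real_vec q)\<bar> \<le> ?n" if "y \<in> set_pmf (mw_kernel \<epsilon> q)" for y
        using norm_triangle_ineq3[of "real_vec y" "real_vec q"] mw_kernel_step[OF that] by simp
    qed (use \<theta> \<theta>n mw_queue_drift[OF \<epsilon>, of q] in simp_all)
    also have "\<dots> = cosh (\<theta> * ?w) * (1 + b / 2) - b * sinh (\<theta> * ?w)"
      by (simp only: quad) (simp add: b_def)
    \<comment> \<open>Replacing sinh by cosh - 1 turns the decay into a true contraction at the cost
      of the additive constant b.\<close>
    also have "\<dots> \<le> cosh (\<theta> * ?w) * (1 + b / 2) - b * (cosh (\<theta> * ?w) - 1)"
      using b0 \<theta> sinh_ge_cosh_minus_one[of "\<theta> * ?w"] by simp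
    also have "\<dots> = (1 - b / 2) * ?V q + b" by (simp add: algebra_simps)
    finally show ?thesis .
  qed
  have fin: "finite {q. ?V q \<le> R}" for R
  proof (rule finite_subset[OF _ finite_bounded_switch_vec[of "nat \<lceil>2 * R / \<theta>\<rceil>"]], clarify)
    fix q :: "'n switch_vec" and i j assume "?V q \<le> R"
    then have "\<theta> * norm (real_vec q) \<le> 2 * R"
      using exp_le_two_cosh[of "\<theta> * norm (real_vec q)"] exp_ge_add_one_self[of "\<theta> * norm (real_vec q)"] by linarith
    then have "norm (real_vec q) \<le> 2 * R / \<theta>" using \<theta> by (simp add: field_simps)
    moreover have "\<bar>real_vec q $ i $ j\<bar> \<le> norm (real_vec q)"
      using component_le_norm_cart[of "real_vec q $ i" j] Finite_Cartesian_Product.norm_nth_le[of "real_vec q" i]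
      by (rule order_trans)
    ultimately have "real (q $ i $ j) \<le> 2 * R / \<theta>" by simp
    then show "q $ i $ j \<le> nat \<lceil>2 * R / \<theta>\<rceil>" by linarith
  qed
  have "geometric_drift (mw_kernel \<epsilon>) ?V (1 - b / 2) b 0"
    by unfold_locales
      (use b0 b1 drift fin finite_set_mw_kernel mw_reach_zero[OF \<epsilon>] mw_zero_loop[OF \<epsilon>] in auto)
  then show ?thesis using \<theta> by blast
qed

text \<open>Needed before the stationary drift of a quadratic form may be set to zero.\<close>

lemma mw_stationary_second_moment:
  fixes \<pi> :: "'n::finite switch_vec pmf"
  assumes \<epsilon>: "0 < \<epsilon>" "\<epsilon> < 1" and st: "stationary (mw_kernel \<epsilon>) \<pi>"
  shows "integrable (measure_pmf \<pi>) (\<lambda>q. (real (total_queue q))\<^sup>2)"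
proof -
  obtain \<theta> \<gamma> C where \<theta>: "0 < \<theta>"
    and "geometric_drift (mw_kernel \<epsilon> :: 'n switch_vec \<Rightarrow> _) (\<lambda>q. cosh (\<theta> * norm (real_vec q))) \<gamma> C 0"
    using mw_geometric_drift[OF \<epsilon>] by blast
  then interpret geometric_drift "mw_kernel \<epsilon> :: 'n switch_vec \<Rightarrow> _"
      "\<lambda>q. cosh (\<theta> * norm (real_vec q))" \<gamma> C 0 by simp
  let ?V = "\<lambda>q :: 'n switch_vec. cosh (\<theta> * norm (real_vec q))"
  have "integrable (measure_pmf \<pi>) (\<lambda>q. (1 - \<gamma>) * ?V q)"
  proof (rule stationary_drift_bound(1)[where F="?V" and g=C, OF st finite_support])
    show "measure_pmf.expectation (mw_kernel \<epsilon> x) ?V + (1 - \<gamma>) * ?V x \<le> ?V x + C" for x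
      using drift[of x] by (simp add: algebra_simps)
  qed (use \<gamma> C in auto)
  then have V: "integrable (measure_pmf \<pi>) ?V" using \<gamma> by simp
  define c where "c = (real CARD('n))\<^sup>2 * (4 / \<theta>\<^sup>2)"
  have le: "(real (total_queue q))\<^sup>2 \<le> c * ?V q" for q :: "'n switch_vec"
  proof -
    let ?x = "\<theta> * norm (real_vec q)"
    have "?x ^ 2 / fact 2 \<le> exp ?x - 1" using \<theta> by (intro exp_ge_power_over_fact) auto
    then have "?x\<^sup>2 \<le> 4 * ?V q" using exp_le_two_cosh[of ?x] by (simp add: fact_2)
    then have nq: "(norm (real_vec q))\<^sup>2 \<le> 4 / \<theta>\<^sup>2 * ?V q" using \<theta> by (simp add: field_simps)
    have "real (total_queue q) \<le> real CARD('n) * norm (real_vec q)"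
      using abs_sum_matrix_le[of "real_vec q"] unfolding real_total_queue by simp
    then have "(real (total_queue q))\<^sup>2 \<le> (real CARD('n) * norm (real_vec q))\<^sup>2"
      by (intro power_mono) auto
    also have "\<dots> = (real CARD('n))\<^sup>2 * (norm (real_vec q))\<^sup>2" by (simp add: power_mult_distrib)
    also have "\<dots> \<le> (real CARD('n))\<^sup>2 * (4 / \<theta>\<^sup>2 * ?V q)" by (intro mult_left_mono nq) simp
    finally show ?thesis by (simp add: c_def)
  qed
  show ?thesis
    by (rule Bochner_Integration.integrable_bound[of _ "\<lambda>q. c * ?V q"])
      (use V le in \<open>auto intro!: AE_I2 intro: order_trans[OF _ abs_ge_self]\<close>)
qed

text \<open>Shows the origin of the constant: twice the Stirling bound for the factorial of r, times
  the r-th power of 16 n^2 (n + 1), the reciprocal of the exponent \<theta> used for the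
  perpendicular part.\<close>

lemma M_bound_power:
  assumes "1 \<le> r"
  shows "M_bound n r ^ r = 2 * (exp 1 * sqrt (real r) * (real r / exp 1) ^ r) * (16 * real n ^ 2 * (real n + 1)) ^ r"
proof -
  have "((2 * sqrt (real r) * exp 1) powr (1 / real r)) ^ r = 2 * sqrt (real r) * exp 1"
    using assms by (simp add: powr_power)
  moreover have "M_bound n r = (2 * sqrt (real r) * exp 1) powr (1 / real r) *
      (real r / exp 1 * (16 * real n ^ 2 * (real n + 1)))"
    by (simp add: M_bound_def)
  ultimately show ?thesis by (simp only: power_mult_distrib) (simp add: mult_ac)
qed

text \<open>State space collapse: the drift constants 2 n and 1/n do not involve \<epsilon>, hence
  neither do the moment bounds.\<close>

lemma mw_perp_moment:
  fixes \<pi> :: "'n::finite switch_vec pmf"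
  assumes \<epsilon>: "0 < \<epsilon>" "\<epsilon> < 1" "\<epsilon> \<le> 1 / (2 * real CARD('n))" and st: "stationary (mw_kernel \<epsilon>) \<pi>"
    and r: "1 \<le> r"
  shows "integrable (measure_pmf \<pi>) (\<lambda>q. norm (perp (real_vec q)) ^ r)"
    and "measure_pmf.expectation \<pi> (\<lambda>q. norm (perp (real_vec q)) ^ r) \<le> M_bound CARD('n) r ^ r"
proof -
  let ?n = "real CARD('n)"
  have n: "1 \<le> ?n" by (simp add: Suc_leI)
  define \<tau> where "\<tau> = 16 * ?n ^ 2 * (?n + 1)"
  define \<theta> where "\<theta> = 1 / \<tau>"
  define b where "b = \<theta> / (2 * ?n)"
  have nn: "?n \<le> ?n\<^sup>2" using n by (simp add: power2_eq_square)
  have \<tau>: "?n \<le> \<tau>" "0 < \<tau>"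
  proof -
    have "?n\<^sup>2 * 1 \<le> (16 * ?n\<^sup>2) * (?n + 1)" using n by (intro mult_mono) auto
    then show "?n \<le> \<tau>" unfolding \<tau>_def using nn by linarith
    then show "0 < \<tau>" using n by linarith
  qed
  have \<theta>: "0 < \<theta>" "\<theta> * ?n \<le> 1" using \<tau> by (simp_all add: \<theta>_def)
  have b: "0 < b" using \<theta> n by (simp add: b_def)
  \<comment> \<open>This is what fixes \<tau>: it dominates 8 n (2 n^2 + n), so the quadratic growth
    costs at most a quarter of the decay rate b = \<theta> / (2 n).\<close>
  have quad: "\<theta>\<^sup>2 * (2 * ?n\<^sup>2 + 2 * ?n / 2) \<le> b / 4"
  proof -
    have "8 * ?n * (2 * ?n\<^sup>2 + ?n) \<le> \<tau>"
      using n by (simp add: \<tau>_def power2_eq_square algebra_simps)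
    then have "\<theta> * (8 * ?n * (2 * ?n\<^sup>2 + ?n)) \<le> 1" using \<tau> by (simp add: \<theta>_def)
    then have "\<theta> * (2 * ?n\<^sup>2 + ?n) \<le> 1 / (8 * ?n)" using n by (simp add: field_simps)
    then have "\<theta> * (\<theta> * (2 * ?n\<^sup>2 + ?n)) \<le> \<theta> * (1 / (8 * ?n))" using \<theta> by (intro mult_left_mono) auto
    then show ?thesis by (simp add: b_def power2_eq_square mult.assoc)
  qed
  let ?W = "\<lambda>q :: 'n switch_vec. norm (perp (real_vec q))"
  let ?V = "\<lambda>q :: 'n switch_vec. cosh (\<theta> * ?W q)"
  have drift: "measure_pmf.expectation (mw_kernel \<epsilon> q) ?V + 3 * b / 4 * ?V q \<le> ?V q + b" for q :: "'n switch_vec"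
  proof -
    have "measure_pmf.expectation (mw_kernel \<epsilon> q) ?V
       \<le> ?V q * (1 + \<theta>\<^sup>2 * (2 * ?n\<^sup>2 + 2 * ?n / 2)) - \<theta> * (1 / ?n) / 2 * sinh (\<theta> * ?W q)"
    proof (rule cosh_drift[OF finite_set_mw_kernel])
      show "\<bar>?W y - ?W q\<bar> \<le> ?n" if "y \<in> set_pmf (mw_kernel \<epsilon> q)" for y
        using norm_triangle_ineq3[of "perp (real_vec y)" "perp (real_vec q)"]
          norm_perp_diff_le[of "real_vec y" "real_vec q"] mw_kernel_step[OF that] by simp
    qed (use \<theta> mw_perp_drift[OF \<epsilon>, of q] in simp_all)
    also have "\<dots> \<le> ?V q * (1 + b / 4) - b * (?V q - 1)"
    proof -
      have "?V q * (1 + \<theta>\<^sup>2 * (2 * ?n\<^sup>2 + 2 * ?n / 2)) \<le> ?V q * (1 + b / 4)"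
        using quad by (intro mult_left_mono) auto
      moreover have "b * (?V q - 1) \<le> b * sinh (\<theta> * ?W q)"
        using b \<theta> by (intro mult_left_mono sinh_ge_cosh_minus_one) auto
      moreover have be: "\<theta> * (1 / ?n) / 2 = b" by (simp add: b_def)
      ultimately show ?thesis unfolding be by linarith
    qed
    finally show ?thesis by (simp add: algebra_simps)
  qed
  have i34: "integrable (measure_pmf \<pi>) (\<lambda>q. 3 * b / 4 * ?V q)"
    and e34: "measure_pmf.expectation \<pi> (\<lambda>q. 3 * b / 4 * ?V q) \<le> b"
    using stationary_drift_bound[where F="?V" and g=b and f="\<lambda>q. 3 * b / 4 * ?V q", OF st finite_set_mw_kernel _ _ _ drift] b
    by (simp_all add: less_imp_le)
  have "integrable (measure_pmf \<pi>) (\<lambda>q. 4 / (3 * b) * (3 * b / 4 * ?V q))"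
    by (rule integrable_mult_right[OF i34])
  then have V: "integrable (measure_pmf \<pi>) ?V" using b by simp
  \<comment> \<open>Three quarters of the decay rate are left, whence 4/3.\<close>
  have EV: "measure_pmf.expectation \<pi> ?V \<le> 4 / 3" using e34 b by (simp add: field_simps)
  have pt: "?W q ^ r \<le> fact r * \<tau> ^ r * (2 * ?V q - 1)" for q :: "'n switch_vec"
  proof -
    have "(\<theta> * ?W q) ^ r / fact r \<le> exp (\<theta> * ?W q) - 1" using \<theta> r by (intro exp_ge_power_over_fact) auto
    also have "\<dots> \<le> 2 * ?V q - 1" using exp_le_two_cosh[of "\<theta> * ?W q"] by simp
    finally have "fact r * \<tau> ^ r * ((\<theta> * ?W q) ^ r / fact r) \<le> fact r * \<tau> ^ r * (2 * ?V q - 1)"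
      using \<tau> by (intro mult_left_mono) auto
    moreover have "fact r * \<tau> ^ r * ((\<theta> * ?W q) ^ r / fact r) = ?W q ^ r"
      using \<tau> by (simp add: \<theta>_def power_divide)
    ultimately show ?thesis by simp
  qed
  have ib: "integrable (measure_pmf \<pi>) (\<lambda>q. fact r * \<tau> ^ r * (2 * ?V q - 1))" using V by simp
  show int: "integrable (measure_pmf \<pi>) (\<lambda>q. ?W q ^ r)"
    by (rule Bochner_Integration.integrable_bound[OF ib])
      (use pt in \<open>auto intro!: AE_I2 intro: order_trans[OF _ abs_ge_self]\<close>)
  have "measure_pmf.expectation \<pi> (\<lambda>q. ?W q ^ r) \<le> measure_pmf.expectation \<pi> (\<lambda>q. fact r * \<tau> ^ r * (2 * ?V q - 1))"
    by (rule integral_mono[OF int ib pt])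
  also have "\<dots> = fact r * \<tau> ^ r * (2 * measure_pmf.expectation \<pi> ?V - 1)" using V by simp
  also have "\<dots> \<le> fact r * \<tau> ^ r * 2" using EV \<tau> by (intro mult_left_mono) auto
  also have "\<dots> \<le> (exp 1 * sqrt (real r) * (real r / exp 1) ^ r) * \<tau> ^ r * 2"
    using fact_le_stirling[OF r] \<tau> by (intro mult_right_mono) auto
  also have "\<dots> = M_bound CARD('n) r ^ r" unfolding M_bound_power[OF r] \<tau>_def by simp
  finally show "measure_pmf.expectation \<pi> (\<lambda>q. ?W q ^ r) \<le> M_bound CARD('n) r ^ r" .
qed

section \<open>Heavy traffic\<close>

text \<open>Given in polarised form, since a cross term is needed. It depends on the margins only;
  the matrices with zero margins, which form the orthogonal complement of the span of the cone, are
  its kernel.\<close>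

definition mform :: "real ^ 'n ^ 'n \<Rightarrow> real ^ 'n ^ 'n::finite \<Rightarrow> real" where
  "mform x y = (\<Sum>i\<in>UNIV. (\<Sum>j\<in>UNIV. x $ i $ j) * (\<Sum>j\<in>UNIV. y $ i $ j))
     + (\<Sum>j\<in>UNIV. (\<Sum>i\<in>UNIV. x $ i $ j) * (\<Sum>i\<in>UNIV. y $ i $ j))
     - (\<Sum>i\<in>UNIV. \<Sum>j\<in>UNIV. x $ i $ j) * (\<Sum>i\<in>UNIV. \<Sum>j\<in>UNIV. y $ i $ j) / real CARD('n)"

lemma mform_commute: "mform x y = mform y x"
  by (simp add: mform_def mult.commute)

lemma mform_add_left: "mform (x + y) z = mform x z + mform y z"
  by (simp add: mform_def sum.distrib distrib_right add_divide_distrib)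

lemma mform_add_right: "mform z (x + y) = mform z x + mform z y"
  by (simp add: mform_commute[of z] mform_add_left)

lemma mform_square_increment:
  assumes "x' = x + d + v"
  shows "mform x' x' - 2 * mform x' v + mform v v = mform x x + 2 * mform x d + mform d d"
  unfolding assms by (simp add: mform_add_left mform_add_right mform_commute[of v x] mform_commute[of v d] mform_commute[of d x])

lemma mform_cone:
  fixes p v :: "real ^ 'n ^ 'n::finite"
  assumes "p \<in> switch_cone"
  shows "mform p v = real CARD('n) * (p \<bullet> v)"
proof -
  let ?n = "real CARD('n)"
  obtain w w' where w: "\<And>i j. p $ i $ j = w i + w' j" using assms by (auto simp: switch_cone_def)
  define r where "r i = (\<Sum>j\<in>UNIV. v $ i $ j)" for i
  define c where "c j = (\<Sum>i\<in>UNIV. v $ i $ j)" for j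
  have tot: "(\<Sum>i\<in>UNIV. r i) = (\<Sum>j\<in>UNIV. c j)" unfolding r_def c_def by (rule sum.swap)
  have rp: "(\<Sum>j\<in>UNIV. p $ i $ j) = ?n * w i + sum w' UNIV" for i by (simp add: w sum.distrib)
  have cp: "(\<Sum>i\<in>UNIV. p $ i $ j) = sum w UNIV + ?n * w' j" for j by (simp add: w sum.distrib)
  have tp: "(\<Sum>i\<in>UNIV. ?n * w i + sum w' UNIV) = ?n * (sum w UNIV + sum w' UNIV)"
    by (simp add: sum.distrib sum_distrib_left[symmetric] distrib_left)
  have "mform p v = (\<Sum>i\<in>UNIV. (?n * w i + sum w' UNIV) * r i) + (\<Sum>j\<in>UNIV. (sum w UNIV + ?n * w' j) * c j)
     - (sum w UNIV + sum w' UNIV) * sum r UNIV"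
    unfolding mform_def rp cp r_def[symmetric] c_def[symmetric] tp by simp
  also have "\<dots> = ?n * ((\<Sum>i\<in>UNIV. w i * r i) + (\<Sum>j\<in>UNIV. w' j * c j))"
    unfolding tot
    by (simp add: distrib_right distrib_left sum.distrib sum_distrib_left[symmetric] tot mult.assoc)
  also have "(\<Sum>j\<in>UNIV. w' j * c j) = (\<Sum>i\<in>UNIV. \<Sum>j\<in>UNIV. w' j * v $ i $ j)"
    unfolding c_def sum_distrib_left by (rule sum.swap)
  also have "(\<Sum>i\<in>UNIV. w i * r i) + \<dots> = p \<bullet> v"
    by (simp add: inner_matrix w r_def sum_distrib_left distrib_right sum.distrib)
  finally show ?thesis .
qed

lemma truncation_decomposition:
  "real_vec (q + a - s) = real_vec q + (real_vec a - real_vec s) + real_vec (s - (q + a))"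
  unfolding vec_eq_iff
proof (intro allI)
  fix i j
  have trunc: "real (k - m) = real k - real m + real (m - k)" for k m :: nat
    by (cases "m \<le> k") (simp_all add: of_nat_diff)
  have "real ((q + a - s) $ i $ j) = real (q $ i $ j) + (real (a $ i $ j) - real (s $ i $ j)) + real ((s - (q + a)) $ i $ j)"
    using trunc[of "q $ i $ j + a $ i $ j" "s $ i $ j"]
    unfolding vector_add_component vector_minus_component of_nat_add by linarith
  then show "real_vec (q + a - s) $ i $ j
     = (real_vec q + (real_vec a - real_vec s) + real_vec (s - (q + a))) $ i $ j"
    by (simp only: vector_add_component vector_minus_component real_vec_nth)
qed

lemma inner_next_state_unused: "real_vec (q + a - s) \<bullet> real_vec (s - (q + a)) = 0"
proof -
  have z: "real ((q + a - s) $ i $ j) * real ((s - (q + a)) $ i $ j) = 0" for i j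
    using nat_le_linear[of "q $ i $ j + a $ i $ j" "s $ i $ j"] by auto
  show ?thesis unfolding inner_matrix real_vec_nth z by simp
qed

text \<open>Being dominated by a permutation matrix, v has entries and margins in {0, 1}, which
  equal their own squares.\<close>

lemma unused_service:
  fixes v s :: "'n::finite switch_vec"
  assumes s: "s \<in> maximal_schedules" and le: "\<And>i j. v $ i $ j \<le> s $ i $ j"
  shows "(\<Sum>j\<in>UNIV. v $ i $ j) \<le> 1" "(\<Sum>i\<in>UNIV. v $ i $ j) \<le> 1" "v $ i $ j \<le> 1"
    "total_queue v \<le> CARD('n)"
    "(norm (real_vec v))\<^sup>2 = real (total_queue v)"
    "mform (real_vec v) (real_vec v) = 2 * real (total_queue v) - (real (total_queue v))\<^sup>2 / real CARD('n)"
proof -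
  have rs: "(\<Sum>j\<in>UNIV. s $ i $ j) = 1" and cs: "(\<Sum>i\<in>UNIV. s $ i $ j) = 1" for i j
    using s by (auto simp: maximal_schedules_def)
  show r: "(\<Sum>j\<in>UNIV. v $ i $ j) \<le> 1" for i
    using sum_mono[of UNIV "\<lambda>j. v $ i $ j" "\<lambda>j. s $ i $ j"] le rs by simp
  show c: "(\<Sum>i\<in>UNIV. v $ i $ j) \<le> 1" for j
    using sum_mono[of UNIV "\<lambda>i. v $ i $ j" "\<lambda>i. s $ i $ j"] le cs by simp
  show e: "v $ i $ j \<le> 1" for i j
    using le[of i j] sum_maximal_schedule(3)[OF s, of i j] by simp
  show "total_queue v \<le> CARD('n)"
    unfolding total_queue_def using sum_mono[of UNIV "\<lambda>i. \<Sum>j\<in>UNIV. v $ i $ j" "\<lambda>_. 1"] r by simp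
  have sq: "(real k)\<^sup>2 = real k" if "k \<le> 1" for k :: nat using that by (cases k) auto
  show "(norm (real_vec v))\<^sup>2 = real (total_queue v)"
    unfolding norm_matrix_power2 real_total_queue real_vec_nth by (simp only: sq[OF e])
  have rsq: "(\<Sum>j\<in>UNIV. real (v $ i $ j)) * (\<Sum>j\<in>UNIV. real (v $ i $ j)) = (\<Sum>j\<in>UNIV. real (v $ i $ j))" for i
    using sq[OF r[of i]] by (simp add: power2_eq_square)
  have csq: "(\<Sum>i\<in>UNIV. real (v $ i $ j)) * (\<Sum>i\<in>UNIV. real (v $ i $ j)) = (\<Sum>i\<in>UNIV. real (v $ i $ j))" for j
    using sq[OF c[of j]] by (simp add: power2_eq_square)
  have "(\<Sum>j\<in>UNIV. \<Sum>i\<in>UNIV. real (v $ i $ j)) = real (total_queue v)"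
    unfolding real_total_queue real_vec_nth by (rule sum.swap)
  then show "mform (real_vec v) (real_vec v) = 2 * real (total_queue v) - (real (total_queue v))\<^sup>2 / real CARD('n)"
    unfolding mform_def real_vec_nth rsq csq by (simp add: real_total_queue power2_eq_square)
qed

text \<open>On the projection of x the form is n times the inner product, and since x is orthogonal
  to v this equals - n times the inner product of the perpendicular part with v. Four terms remain,
  each of size at most h. Polarity makes the row and column terms nonpositive and the contribution
  of the total nonnegative, so only two terms count above and three below; this is the source of the
  factors 2 and 3 in the error terms.\<close>

lemma mform_unused_bounds:
  fixes q a s :: "'n::finite switch_vec"
  assumes s: "s \<in> maximal_schedules"
  defines "x \<equiv> real_vec (q + a - s)" and "v \<equiv> s - (q + a)"
  defines "h \<equiv> real CARD('n) * (norm (perp x) * sqrt (real (total_queue v)))"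
  shows "mform x (real_vec v) \<le> 2 * h" and "- 3 * h \<le> mform x (real_vec v)"
proof -
  let ?n = "real CARD('n)" and ?z = "perp x" and ?m = "real (total_queue v)"
  have n: "1 \<le> ?n" by (simp add: Suc_leI)
  have le: "v $ i $ j \<le> s $ i $ j" for i j by (simp add: v_def)
  note us = unused_service[OF s le]
  have nv: "norm (real_vec v) = sqrt ?m" using us(5) by (metis norm_ge_zero real_sqrt_unique)
  have m_le: "?m \<le> ?n * sqrt ?m"
  proof -
    have "sqrt ?m \<le> sqrt ?n" using us(4) by simp
    also have "\<dots> \<le> ?n" using n by (simp add: real_le_lsqrt power2_eq_square)
    finally have "sqrt ?m * sqrt ?m \<le> ?n * sqrt ?m" by (intro mult_right_mono) auto
    then show ?thesis by simp
  qed
  define r where "r i = (\<Sum>j\<in>UNIV. real (v $ i $ j))" for i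
  define c where "c j = (\<Sum>i\<in>UNIV. real (v $ i $ j))" for j
  have r01: "0 \<le> r i" "(r i)\<^sup>2 = r i" for i
  proof -
    have "r i = 0 \<or> r i = 1"
      unfolding r_def of_nat_sum[symmetric] of_nat_eq_0_iff of_nat_eq_1_iff using us(1)[of i] by linarith
    then show "0 \<le> r i" "(r i)\<^sup>2 = r i" by auto
  qed
  have c01: "0 \<le> c j" "(c j)\<^sup>2 = c j" for j
  proof -
    have "c j = 0 \<or> c j = 1"
      unfolding c_def of_nat_sum[symmetric] of_nat_eq_0_iff of_nat_eq_1_iff using us(2)[of j] by linarith
    then show "0 \<le> c j" "(c j)\<^sup>2 = c j" by auto
  qed
  have sumr: "(\<Sum>i\<in>UNIV. r i) = ?m" by (simp add: r_def real_total_queue)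
  have sumc: "(\<Sum>j\<in>UNIV. c j) = ?m"
    unfolding c_def real_total_queue real_vec_nth by (rule sum.swap)
  let ?R = "\<Sum>i\<in>UNIV. (\<Sum>j\<in>UNIV. ?z $ i $ j) * r i"
  let ?C = "\<Sum>j\<in>UNIV. (\<Sum>i\<in>UNIV. ?z $ i $ j) * c j"
  let ?T = "\<Sum>i\<in>UNIV. \<Sum>j\<in>UNIV. ?z $ i $ j"
  have eq: "mform x (real_vec v) = - ?n * (?z \<bullet> real_vec v) + ?R + ?C - ?T * ?m / ?n"
  proof -
    have x: "x = par x + ?z" by (simp add: perp_eq)
    have "x \<bullet> real_vec v = 0" unfolding x_def v_def by (rule inner_next_state_unused)
    then have "par x \<bullet> real_vec v = - (?z \<bullet> real_vec v)" by (simp add: perp_eq inner_diff_left)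
    moreover have "mform x (real_vec v) = ?n * (par x \<bullet> real_vec v) + mform ?z (real_vec v)"
      using mform_cone[OF par_in_cone, of x "real_vec v"] x by (metis mform_add_left)
    moreover have "mform ?z (real_vec v) = ?R + ?C - ?T * ?m / ?n"
      by (simp add: mform_def r_def c_def real_total_queue)
    ultimately show ?thesis by simp
  qed
  have h0: "0 \<le> h" by (simp add: h_def)
  have zv: "\<bar>?n * (?z \<bullet> real_vec v)\<bar> \<le> h"
    using Cauchy_Schwarz_ineq2[of ?z "real_vec v"] unfolding h_def nv by (simp add: abs_mult)
  have R0: "?R \<le> 0" by (rule sum_nonpos) (rule mult_nonpos_nonneg[OF perp_row_sum r01(1)])
  have C0: "?C \<le> 0" by (rule sum_nonpos) (rule mult_nonpos_nonneg[OF perp_col_sum c01(1)])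
  have T0: "?T \<le> 0" by (rule sum_nonpos) (rule perp_row_sum)
  have Tm: "- h \<le> ?T * ?m / ?n" "?T * ?m / ?n \<le> 0"
  proof -
    have "- ?T \<le> ?n * norm ?z" using abs_sum_matrix_le[of ?z] by linarith
    then have "- ?T * ?m \<le> ?n * norm ?z * (?n * sqrt ?m)"
      using m_le T0 by (intro mult_mono) auto
    then have "- ?T * ?m / ?n \<le> ?n * norm ?z * (?n * sqrt ?m) / ?n" by (intro divide_right_mono) auto
    moreover have "?n * norm ?z * (?n * sqrt ?m) / ?n = h" using n by (simp add: h_def)
    ultimately have "- (?T * ?m / ?n) \<le> h" by simp
    then show "- h \<le> ?T * ?m / ?n" by linarith
    show "?T * ?m / ?n \<le> 0" using T0 by (intro divide_nonpos_nonneg mult_nonpos_nonneg) auto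
  qed
  have sq: "sqrt (?n * ?m) \<le> ?n * sqrt ?m"
  proof -
    have "sqrt ?n \<le> ?n" using n by (simp add: real_le_lsqrt power2_eq_square)
    then show ?thesis by (simp add: real_sqrt_mult mult_right_mono)
  qed
  have R1: "- h \<le> ?R"
  proof -
    \<comment> \<open>The row term as an inner product with a matrix constant along rows, whose norm
      is sqrt (n m).\<close>
    define Y :: "real ^ 'n ^ 'n" where "Y = (\<chi> i j. r i)"
    have "(norm Y)\<^sup>2 = ?n * ?m" by (simp add: norm_matrix_power2 Y_def r01 sumr flip: sum_distrib_left)
    then have "norm Y = sqrt (?n * ?m)" by (metis norm_ge_zero real_sqrt_unique)
    then have "norm ?z * norm Y \<le> h"
      using mult_left_mono[OF sq, of "norm ?z"] by (simp add: h_def mult_ac)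
    moreover have "?z \<bullet> Y = ?R" by (simp add: inner_matrix Y_def sum_distrib_right)
    ultimately show ?thesis using Cauchy_Schwarz_ineq2[of ?z Y] by linarith
  qed
  have C1: "- h \<le> ?C"
  proof -
    define Y :: "real ^ 'n ^ 'n" where "Y = (\<chi> i j. c j)"
    have "(norm Y)\<^sup>2 = ?n * ?m" by (simp add: norm_matrix_power2 Y_def c01 sumc)
    then have "norm Y = sqrt (?n * ?m)" by (metis norm_ge_zero real_sqrt_unique)
    then have "norm ?z * norm Y \<le> h"
      using mult_left_mono[OF sq, of "norm ?z"] by (simp add: h_def mult_ac)
    moreover have "?z \<bullet> Y = ?C"
      unfolding inner_matrix Y_def by (subst sum.swap) (simp add: sum_distrib_right)
    ultimately show ?thesis using Cauchy_Schwarz_ineq2[of ?z Y] by linarith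
  qed
  show "mform x (real_vec v) \<le> 2 * h" using eq zv R0 C0 Tm by linarith
  show "- 3 * h \<le> mform x (real_vec v)" using eq zv R1 C1 Tm by linarith
qed

text \<open>Hoelder with exponents r and r / (r - 1), obtained from Young's inequality after
  normalising both factors by their bounds. Because m takes natural values and 1 - 1/r is at least
  1/2, sqrt m may be replaced by m powr (1 - 1/r).\<close>

lemma expectation_mult_sqrt_le:
  fixes X :: "'a \<Rightarrow> real" and m :: "'a \<Rightarrow> nat"
  assumes r: "2 \<le> r" and M: "0 < M" and X: "\<And>x. 0 \<le> X x"
    and iX: "integrable (measure_pmf p) (\<lambda>x. X x ^ r)" and EX: "measure_pmf.expectation p (\<lambda>x. X x ^ r) \<le> M ^ r"
    and im: "integrable (measure_pmf p) (\<lambda>x. real (m x))" and Em: "measure_pmf.expectation p (\<lambda>x. real (m x)) \<le> \<delta>"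
    and \<delta>: "0 < \<delta>"
  shows "integrable (measure_pmf p) (\<lambda>x. X x * sqrt (real (m x)))"
    and "measure_pmf.expectation p (\<lambda>x. X x * sqrt (real (m x))) \<le> M * \<delta> powr (1 - 1 / real r)"
proof -
  define c where "c = M * \<delta> powr (1 - 1 / real r)"
  have c: "0 < c" using M \<delta> by (simp add: c_def)
  define g where "g = (\<lambda>x. c * (1 / real r * (X x ^ r / M ^ r) + (1 - 1 / real r) * (real (m x) / \<delta>)))"
  have r1: "0 < 1 / real r" "0 \<le> 1 - 1 / real r" "1 / 2 \<le> 1 - 1 / real r"
    using r by (auto simp: field_simps)
  have pt: "X x * sqrt (real (m x)) \<le> g x" for x
  proof (cases "X x = 0 \<or> m x = 0")
    case True
    have "0 \<le> g x" using c r1 X M \<delta> by (auto simp: g_def intro!: mult_nonneg_nonneg add_nonneg_nonneg)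
    then show ?thesis using True by auto
  next
    case False
    then have pos: "0 < X x" "1 \<le> real (m x)" using X[of x] by auto
    define e where "e = 1 - 1 / real r"
    have young: "(X x ^ r / M ^ r) powr (1 / real r) * (real (m x) / \<delta>) powr e
      \<le> 1 / real r * (X x ^ r / M ^ r) + e * (real (m x) / \<delta>)"
      using r1 pos M \<delta> unfolding e_def by (intro Youngs_inequality_0) auto
    have "X x ^ r / M ^ r = (X x / M) powr real r"
      using pos M by (simp add: powr_realpow power_divide)
    then have 1: "(X x ^ r / M ^ r) powr (1 / real r) = X x / M"
      using pos M r by (simp add: powr_powr)
    have 2: "(real (m x) / \<delta>) powr e = real (m x) powr e / \<delta> powr e"
      using \<delta> by (simp add: powr_divide)
    have "real (m x) powr (1 / 2) \<le> real (m x) powr e"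
      using pos r1 unfolding e_def by (intro powr_mono) auto
    then have 3: "sqrt (real (m x)) \<le> real (m x) powr e" using pos by (simp add: powr_half_sqrt)
    have "X x / M * (sqrt (real (m x)) / \<delta> powr e) \<le> X x / M * (real (m x) powr e / \<delta> powr e)"
      using 3 pos M by (intro mult_left_mono divide_right_mono) auto
    also have "\<dots> \<le> 1 / real r * (X x ^ r / M ^ r) + e * (real (m x) / \<delta>)"
      using young unfolding 1 2 .
    finally have "c * (X x / M * (sqrt (real (m x)) / \<delta> powr e)) \<le> g x"
      unfolding g_def e_def[symmetric] using c by (intro mult_left_mono) auto
    moreover have "c * (X x / M * (sqrt (real (m x)) / \<delta> powr e)) = X x * sqrt (real (m x))"
      using M \<delta> by (simp add: c_def e_def[symmetric])
    ultimately show ?thesis by simp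
  qed
  have ig: "integrable (measure_pmf p) g"
    unfolding g_def by (intro integrable_mult_right Bochner_Integration.integrable_add integrable_divide iX im)
  show int: "integrable (measure_pmf p) (\<lambda>x. X x * sqrt (real (m x)))"
  proof (rule Bochner_Integration.integrable_bound[OF ig])
    have "norm (X x * sqrt (real (m x))) \<le> norm (g x)" for x
      using pt[of x] X[of x] by (simp add: abs_mult)
    then show "AE x in measure_pmf p. norm (X x * sqrt (real (m x))) \<le> norm (g x)" by simp
  qed simp
  have "measure_pmf.expectation p (\<lambda>x. X x * sqrt (real (m x))) \<le> measure_pmf.expectation p g"
    by (rule integral_mono[OF int ig pt])
  also have "\<dots> = c * (1 / real r * (measure_pmf.expectation p (\<lambda>x. X x ^ r) / M ^ r)
      + (1 - 1 / real r) * (measure_pmf.expectation p (\<lambda>x. real (m x)) / \<delta>))"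
    unfolding g_def
    by (simp only: integral_mult_right_zero integral_divide_zero
      Bochner_Integration.integral_add[OF integrable_mult_right[OF integrable_divide[OF iX]]
        integrable_mult_right[OF integrable_divide[OF im]]])
  also have "\<dots> \<le> c * (1 / real r * 1 + (1 - 1 / real r) * 1)"
  proof -
    have "measure_pmf.expectation p (\<lambda>x. X x ^ r) / M ^ r \<le> 1" using EX M by (simp add: divide_le_eq)
    moreover have "measure_pmf.expectation p (\<lambda>x. real (m x)) / \<delta> \<le> 1" using Em \<delta> by (simp add: divide_le_eq)
    ultimately show ?thesis using c r1 by (intro mult_left_mono add_mono) auto
  qed
  finally show "measure_pmf.expectation p (\<lambda>x. X x * sqrt (real (m x))) \<le> M * \<delta> powr (1 - 1 / real r)"
    by (simp add: c_def)
qed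

text \<open>Current queue, schedule and arrivals on one space. The current and the next queue are
  both functions of the triple, so a pathwise identity can be integrated term by term, and under
  stationarity both have law \<pi>.\<close>

definition slot_law :: "'n::finite switch_policy \<Rightarrow> real ^ 'n ^ 'n \<Rightarrow> 'n switch_vec pmf \<Rightarrow>
    ('n switch_vec \<times> 'n switch_vec \<times> 'n switch_vec) pmf" where
  "slot_law P rate \<pi> = bind_pmf \<pi> (\<lambda>q. bind_pmf (P q) (\<lambda>s. map_pmf (\<lambda>a. (q, s, a)) (bernoulli_arrivals rate)))"

lemma set_slot_law:
  "set_pmf (slot_law P rate \<pi>) = {(q, s, a). q \<in> set_pmf \<pi> \<and> s \<in> set_pmf (P q) \<and> a \<in> set_pmf (bernoulli_arrivals rate)}"
  by (auto simp: slot_law_def)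

lemma map_fst_slot_law: "map_pmf fst (slot_law P rate \<pi>) = \<pi>"
  by (simp add: slot_law_def map_bind_pmf map_pmf_comp comp_def bind_return_pmf')

lemma map_next_slot_law:
  "map_pmf (\<lambda>(q, s, a). q + a - s) (slot_law P rate \<pi>) = bind_pmf \<pi> (switch_kernel P rate)"
  by (simp add: slot_law_def map_bind_pmf map_pmf_comp comp_def switch_kernel_def[abs_def])

lemma integrable_slot_law_fst:
  fixes f :: "'n::finite switch_vec \<Rightarrow> real"
  shows "integrable (measure_pmf (slot_law P rate \<pi>)) (\<lambda>x. f (fst x)) \<longleftrightarrow> integrable (measure_pmf \<pi>) f"
  using integrable_map_pmf_eq[of fst "slot_law P rate \<pi>" f] unfolding map_fst_slot_law by simp

lemma expectation_slot_law_fst: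
  fixes f :: "'n::finite switch_vec \<Rightarrow> real"
  shows "measure_pmf.expectation (slot_law P rate \<pi>) (\<lambda>x. f (fst x)) = measure_pmf.expectation \<pi> f"
  using integral_map_pmf[of fst "slot_law P rate \<pi>" f] unfolding map_fst_slot_law by simp

lemma slot_law_next:
  fixes f :: "'n::finite switch_vec \<Rightarrow> real"
  assumes "stationary (switch_kernel P rate) \<pi>"
  shows "integrable (measure_pmf (slot_law P rate \<pi>)) (\<lambda>(q, s, a). f (q + a - s)) \<longleftrightarrow> integrable (measure_pmf \<pi>) f"
    and "measure_pmf.expectation (slot_law P rate \<pi>) (\<lambda>(q, s, a). f (q + a - s)) = measure_pmf.expectation \<pi> f"
  using integrable_map_pmf_eq[of "\<lambda>(q, s, a). q + a - s" "slot_law P rate \<pi>" f]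
    integral_map_pmf[of "\<lambda>(q, s, a). q + a - s" "slot_law P rate \<pi>" f] assms
  unfolding map_next_slot_law stationary_def by (simp_all add: case_prod_unfold)

lemma expectation_slot_law:
  fixes f :: "'n::finite switch_vec \<times> 'n switch_vec \<times> 'n switch_vec \<Rightarrow> real"
  assumes fin: "\<And>q. finite (set_pmf (P q))" and int: "integrable (measure_pmf (slot_law P rate \<pi>)) f"
  shows "measure_pmf.expectation (slot_law P rate \<pi>) f = measure_pmf.expectation \<pi>
     (\<lambda>q. measure_pmf.expectation (P q) (\<lambda>s. measure_pmf.expectation (bernoulli_arrivals rate) (\<lambda>a. f (q, s, a))))"
proof -
  let ?A = "\<lambda>q s. map_pmf (\<lambda>a. (q, s, a)) (bernoulli_arrivals rate)"
  have iA: "integrable (measure_pmf (?A q s)) f" for q s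
    by (rule integrable_measure_pmf_finite) (auto intro!: finite_imageI finite_set_arrivals)
  have iP: "integrable (measure_pmf (bind_pmf (P q) (?A q))) f" for q
    by (rule integrable_measure_pmf_finite) (auto intro!: finite_imageI finite_set_arrivals fin)
  have "measure_pmf.expectation (slot_law P rate \<pi>) f
     = measure_pmf.expectation \<pi> (\<lambda>q. measure_pmf.expectation (bind_pmf (P q) (?A q)) f)"
    unfolding slot_law_def by (rule expectation_bind_pmf(2)[OF iP int[unfolded slot_law_def]])
  also have "\<dots> = measure_pmf.expectation \<pi>
     (\<lambda>q. measure_pmf.expectation (P q) (\<lambda>s. measure_pmf.expectation (?A q s) f))"
    by (simp only: expectation_bind_pmf(2)[OF iA iP])
  finally show ?thesis by (simp only: integral_map_pmf)
qed

lemma sum_switch_cells: "(\<Sum>e\<in>UNIV. f (fst e) (snd e)) = (\<Sum>i\<in>UNIV. \<Sum>j\<in>UNIV. f i j)"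
  unfolding UNIV_Times_UNIV[symmetric] by (simp add: sum.cartesian_product case_prod_unfold)

text \<open>A maximal schedule removes exactly 1 from each row and column and n in total, so its
  choice drops out. The linear part is (- \<epsilon> - \<epsilon> + \<epsilon>) times the total. In
  the quadratic part 2 n row and column variances, minus 1/n times the variance of the total, leave
  2 n - 1 copies of one row variance.\<close>

lemma expectation_mform_increment:
  fixes s :: "'n::finite switch_vec"
  assumes \<epsilon>: "0 < \<epsilon>" "\<epsilon> < 1" and s: "s \<in> maximal_schedules"
  defines "n \<equiv> real CARD('n)"
  defines "d \<equiv> \<lambda>a. real_vec a - real_vec s"
  shows "measure_pmf.expectation (bernoulli_arrivals (uniform_rate \<epsilon>)) (\<lambda>a. mform x (d a))
      = - \<epsilon> * (\<Sum>i\<in>UNIV. \<Sum>j\<in>UNIV. x $ i $ j)"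
    and "measure_pmf.expectation (bernoulli_arrivals (uniform_rate \<epsilon>)) (\<lambda>a. mform (d a) (d a))
      = (2 * n - 1) * ((1 - \<epsilon>) * (1 - (1 - \<epsilon>) / n)) + n * \<epsilon>\<^sup>2"
proof -
  let ?A = "bernoulli_arrivals (uniform_rate \<epsilon> :: real ^ 'n ^ 'n)"
  let ?E = "measure_pmf.expectation ?A"
  have n: "1 \<le> n" by (simp add: n_def Suc_leI)
  have int: "integrable (measure_pmf ?A) g" for g :: "_ \<Rightarrow> real"
    by (rule integrable_measure_pmf_finite[OF finite_set_arrivals])
  define R where "R i a = (\<Sum>j\<in>UNIV. real (a $ i $ j)) - 1" for i and a :: "'n switch_vec"
  define C where "C j a = (\<Sum>i\<in>UNIV. real (a $ i $ j)) - 1" for j and a :: "'n switch_vec"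
  define T where "T a = (\<Sum>i\<in>UNIV. \<Sum>j\<in>UNIV. real (a $ i $ j)) - n" for a :: "'n switch_vec"
  note ss = sum_maximal_schedule[OF s]
  have dR: "(\<Sum>j\<in>UNIV. d a $ i $ j) = R i a" for i a by (simp add: d_def R_def sum_subtractf ss)
  have dC: "(\<Sum>i\<in>UNIV. d a $ i $ j) = C j a" for j a by (simp add: d_def C_def sum_subtractf ss)
  have dT: "(\<Sum>i\<in>UNIV. R i a) = T a" for a by (simp add: R_def T_def sum_subtractf n_def)
  have E1: "?E (\<lambda>a. real (a $ i $ j)) = (1 - \<epsilon>) / n" for i j
    unfolding n_def by (rule expectation_uniform_arrival[OF \<epsilon>])
  have ER: "?E (R i) = - \<epsilon>" for i
    using n by (simp add: R_def[abs_def] int Bochner_Integration.integral_sum E1) (simp add: n_def)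
  have EC: "?E (C j) = - \<epsilon>" for j
    using n by (simp add: C_def[abs_def] int Bochner_Integration.integral_sum E1) (simp add: n_def)
  have ET: "?E T = - n * \<epsilon>"
  proof -
    have "?E T = ?E (\<lambda>a. \<Sum>i\<in>UNIV. R i a)" by (simp add: dT)
    also have "\<dots> = - n * \<epsilon>" by (simp add: int Bochner_Integration.integral_sum ER n_def)
    finally show ?thesis .
  qed
  have "?E (\<lambda>a. mform x (d a)) = (\<Sum>i\<in>UNIV. (\<Sum>j\<in>UNIV. x $ i $ j) * ?E (R i))
     + (\<Sum>j\<in>UNIV. (\<Sum>i\<in>UNIV. x $ i $ j) * ?E (C j)) - (\<Sum>i\<in>UNIV. \<Sum>j\<in>UNIV. x $ i $ j) * ?E T / n"
    unfolding mform_def dR dC dT n_def[symmetric] by (simp add: int Bochner_Integration.integral_sum)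
  also have "(\<Sum>j\<in>UNIV. (\<Sum>i\<in>UNIV. x $ i $ j) * ?E (C j)) = - \<epsilon> * (\<Sum>i\<in>UNIV. \<Sum>j\<in>UNIV. x $ i $ j)"
    unfolding EC sum_distrib_right[symmetric] by (subst sum.swap) simp
  also have "(\<Sum>i\<in>UNIV. (\<Sum>j\<in>UNIV. x $ i $ j) * ?E (R i)) = - \<epsilon> * (\<Sum>i\<in>UNIV. \<Sum>j\<in>UNIV. x $ i $ j)"
    unfolding ER sum_distrib_right[symmetric] by simp
  finally show "?E (\<lambda>a. mform x (d a)) = - \<epsilon> * (\<Sum>i\<in>UNIV. \<Sum>j\<in>UNIV. x $ i $ j)"
    using n unfolding ET by simp
  define p where "p = (1 - \<epsilon>) / n"
  have np: "n * p = 1 - \<epsilon>" using n by (simp add: p_def)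
  note sq = expectation_arrival_sum_square[OF \<epsilon>, where 'n='n, folded n_def, folded p_def]
  have ER2: "?E (\<lambda>a. R i a * R i a) = (1 - \<epsilon>) * (1 - p) + \<epsilon>\<^sup>2" for i
  proof -
    have "(\<Sum>e\<in>Pair i ` UNIV. real (a $ fst e $ snd e)) = (\<Sum>j\<in>UNIV. real (a $ i $ j))" for a :: "'n switch_vec"
      by (subst sum.reindex) (auto simp: inj_on_def)
    moreover have "card (Pair i ` (UNIV :: 'n set)) = CARD('n)" by (rule card_image) (auto simp: inj_on_def)
    ultimately show ?thesis
      using sq[of "Pair i ` UNIV" 1] by (simp add: R_def power2_eq_square n_def[symmetric] np)
  qed
  have EC2: "?E (\<lambda>a. C j a * C j a) = (1 - \<epsilon>) * (1 - p) + \<epsilon>\<^sup>2" for j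
  proof -
    have "(\<Sum>e\<in>(\<lambda>i. (i, j)) ` UNIV. real (a $ fst e $ snd e)) = (\<Sum>i\<in>UNIV. real (a $ i $ j))" for a :: "'n switch_vec"
      by (subst sum.reindex) (auto simp: inj_on_def)
    moreover have "card ((\<lambda>i. (i, j)) ` (UNIV :: 'n set)) = CARD('n)" by (rule card_image) (auto simp: inj_on_def)
    ultimately show ?thesis
      using sq[of "(\<lambda>i. (i, j)) ` UNIV" 1] by (simp add: C_def power2_eq_square n_def[symmetric] np)
  qed
  have ET2: "?E (\<lambda>a. T a * T a) = n * ((1 - \<epsilon>) * (1 - p)) + n\<^sup>2 * \<epsilon>\<^sup>2"
  proof -
    have cells: "(\<Sum>i\<in>UNIV. \<Sum>j\<in>UNIV. real (a $ i $ j)) = (\<Sum>e\<in>UNIV. real (a $ fst e $ snd e))"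
      for a :: "'n switch_vec"
      by (rule sum_switch_cells[symmetric])
    have "real CARD('n \<times> 'n) = n * n" by (simp add: n_def)
    then have "?E (\<lambda>a. T a * T a) = n * n * p * (1 - p) + (n * n * p - n)\<^sup>2"
      using sq[of UNIV n] by (simp add: T_def cells power2_eq_square)
    also have "\<dots> = n * ((n * p) * (1 - p)) + (n * (n * p - 1))\<^sup>2" by (simp add: algebra_simps)
    finally show ?thesis unfolding np by (simp add: power_mult_distrib)
  qed
  have "?E (\<lambda>a. mform (d a) (d a)) = (\<Sum>i\<in>UNIV. ?E (\<lambda>a. R i a * R i a))
     + (\<Sum>j\<in>UNIV. ?E (\<lambda>a. C j a * C j a)) - ?E (\<lambda>a. T a * T a) / n"
    unfolding mform_def dR dC dT n_def[symmetric] by (simp add: int Bochner_Integration.integral_sum)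
  also have "\<dots> = 2 * n * ((1 - \<epsilon>) * (1 - p) + \<epsilon>\<^sup>2) - ((1 - \<epsilon>) * (1 - p) + n * \<epsilon>\<^sup>2)"
    unfolding ER2 EC2 ET2 using n by (simp add: n_def[symmetric] add_divide_distrib power2_eq_square)
  finally show "?E (\<lambda>a. mform (d a) (d a)) = (2 * n - 1) * ((1 - \<epsilon>) * (1 - (1 - \<epsilon>) / n)) + n * \<epsilon>\<^sup>2"
    unfolding p_def[symmetric] by (simp add: algebra_simps)
qed

lemma abs_mform_le:
  "\<bar>mform (real_vec q) (real_vec q)\<bar> \<le> 3 * (real (total_queue q))\<^sup>2" for q :: "'n::finite switch_vec"
proof -
  let ?T = "real (total_queue q)" and ?n = "real CARD('n)"
  have sq: "(\<Sum>i\<in>UNIV. f i * f i) \<le> (sum f UNIV)\<^sup>2" if "\<And>i. 0 \<le> f i" for f :: "'n \<Rightarrow> real"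
  proof -
    have "(\<Sum>i\<in>UNIV. f i * f i) \<le> (\<Sum>i\<in>UNIV. f i * sum f UNIV)"
      using that by (intro sum_mono mult_left_mono member_le_sum) auto
    then show ?thesis by (simp add: power2_eq_square flip: sum_distrib_right)
  qed
  have 1: "(\<Sum>i\<in>UNIV. (\<Sum>j\<in>UNIV. real_vec q $ i $ j) * (\<Sum>j\<in>UNIV. real_vec q $ i $ j)) \<le> ?T\<^sup>2"
    unfolding real_total_queue by (rule sq) (simp add: sum_nonneg)
  have 2: "(\<Sum>j\<in>UNIV. (\<Sum>i\<in>UNIV. real_vec q $ i $ j) * (\<Sum>i\<in>UNIV. real_vec q $ i $ j)) \<le> ?T\<^sup>2"
    unfolding real_total_queue by (subst sum.swap) (rule sq, simp add: sum_nonneg)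
  have 3: "0 \<le> ?T * ?T / ?n" "?T * ?T / ?n \<le> ?T\<^sup>2"
  proof -
    have "?T * ?T / ?n \<le> ?T * ?T / 1" by (intro divide_left_mono) (auto simp: Suc_leI)
    then show "?T * ?T / ?n \<le> ?T\<^sup>2" by (simp add: power2_eq_square)
  qed simp
  have 4: "0 \<le> (\<Sum>i\<in>UNIV. (\<Sum>j\<in>UNIV. real_vec q $ i $ j) * (\<Sum>j\<in>UNIV. real_vec q $ i $ j))"
    "0 \<le> (\<Sum>j\<in>UNIV. (\<Sum>i\<in>UNIV. real_vec q $ i $ j) * (\<Sum>i\<in>UNIV. real_vec q $ i $ j))"
    by (intro sum_nonneg mult_nonneg_nonneg; simp)+
  show ?thesis
    unfolding mform_def real_total_queue[symmetric] using 1 2 3 4 by linarith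
qed

lemma heavy_traffic_algebra:
  fixes n \<epsilon> :: real
  assumes n: "1 \<le> n" and \<epsilon>: "0 < \<epsilon>"
  shows "((2 * n - 1) * ((1 - \<epsilon>) * (1 - (1 - \<epsilon>) / n)) + n * \<epsilon>\<^sup>2) / (2 * \<epsilon>)
    = 1 / \<epsilon> * (n - 3 / 2 + 1 / (2 * n)) - (1 - \<epsilon> / 2) * (n - 2 + 1 / n) + 1 / 2"
proof -
  have "((2 * n - 1) * ((1 - \<epsilon>) * (1 - (1 - \<epsilon>) / n)) + n * \<epsilon>\<^sup>2) * n
      = ((1 / \<epsilon> * (n - 3 / 2 + 1 / (2 * n)) - (1 - \<epsilon> / 2) * (n - 2 + 1 / n) + 1 / 2) * (2 * \<epsilon>)) * n"
    using n \<epsilon> by (simp add: field_simps power2_eq_square)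
  then have "(2 * n - 1) * ((1 - \<epsilon>) * (1 - (1 - \<epsilon>) / n)) + n * \<epsilon>\<^sup>2
      = (1 / \<epsilon> * (n - 3 / 2 + 1 / (2 * n)) - (1 - \<epsilon> / 2) * (n - 2 + 1 / n) + 1 / 2) * (2 * \<epsilon>)"
    using n by simp
  then show ?thesis using \<epsilon> by simp
qed


lemma slot_law_expectation_arrivals:
  fixes f :: "'n::finite switch_vec \<times> 'n switch_vec \<times> 'n switch_vec \<Rightarrow> real"
  assumes fin: "\<And>q. finite (set_pmf (P q))" and int: "integrable (measure_pmf (slot_law P rate \<pi>)) f"
    and f: "\<And>q s. s \<in> set_pmf (P q) \<Longrightarrow>
      measure_pmf.expectation (bernoulli_arrivals rate) (\<lambda>a. f (q, s, a)) = g q"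
  shows "measure_pmf.expectation (slot_law P rate \<pi>) f = measure_pmf.expectation \<pi> g"
proof -
  have "measure_pmf.expectation (P q)
     (\<lambda>s. measure_pmf.expectation (bernoulli_arrivals rate) (\<lambda>a. f (q, s, a))) = g q" for q
  proof -
    have "measure_pmf.expectation (P q)
     (\<lambda>s. measure_pmf.expectation (bernoulli_arrivals rate) (\<lambda>a. f (q, s, a)))
      = measure_pmf.expectation (P q) (\<lambda>s. g q)"
      by (rule integral_cong_AE) (auto simp: AE_measure_pmf_iff f)
    then show ?thesis by simp
  qed
  then show ?thesis by (simp add: expectation_slot_law[OF fin int])
qed

lemmas mw_slot_expectation = slot_law_expectation_arrivals[where P=max_weight, OF max_weight_optimal(1)]

lemma mw_stationary_first_moment:
  fixes \<pi> :: "'n::finite switch_vec pmf"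
  assumes \<epsilon>: "0 < \<epsilon>" "\<epsilon> < 1" and st: "stationary (mw_kernel \<epsilon>) \<pi>"
  shows "integrable (measure_pmf \<pi>) (\<lambda>q. real (total_queue q))"
proof (rule Bochner_Integration.integrable_bound[OF mw_stationary_second_moment[OF \<epsilon> st]])
  have "real (total_queue q) \<le> (real (total_queue q))\<^sup>2" for q :: "'n switch_vec"
    by (cases "total_queue q") (auto simp: power2_eq_square)
  then show "AE q in measure_pmf \<pi>. norm (real (total_queue q)) \<le> norm ((real (total_queue q))\<^sup>2)" by simp
qed simp

lemma M_bound_pos: "1 \<le> r \<Longrightarrow> 1 \<le> n \<Longrightarrow> 0 < M_bound n r"
  by (simp add: M_bound_def)

theorem mw_heavy_traffic_bounds:
  fixes \<pi> :: "'n::finite switch_vec pmf"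
  assumes \<epsilon>: "0 < \<epsilon>" "\<epsilon> < 1" "\<epsilon> \<le> 1 / (2 * real CARD('n))" and st: "stationary (mw_kernel \<epsilon>) \<pi>"
    and r: "2 \<le> r"
  defines "n \<equiv> real CARD('n)" and "ET \<equiv> measure_pmf.expectation \<pi> (\<lambda>q. real (total_queue q))"
  shows "1 / \<epsilon> * (n - 3 / 2 + 1 / (2 * n)) - B1_bound CARD('n) r \<epsilon> \<le> ET"
    and "ET \<le> 1 / \<epsilon> * (n - 3 / 2 + 1 / (2 * n)) + B2_bound CARD('n) r \<epsilon>"
proof -
  let ?J = "slot_law max_weight (uniform_rate \<epsilon>) \<pi>"
  let ?E = "measure_pmf.expectation ?J"
  let ?T = "\<lambda>q. real (total_queue q)"
  have n: "1 \<le> n" by (simp add: n_def Suc_leI)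
  have iT2: "integrable (measure_pmf \<pi>) (\<lambda>q. (?T q)\<^sup>2)"
    by (rule mw_stationary_second_moment[OF \<epsilon>(1,2) st])
  have iT: "integrable (measure_pmf \<pi>) ?T"
    by (rule mw_stationary_first_moment[OF \<epsilon>(1,2) st])
  have iQ: "integrable (measure_pmf \<pi>) (\<lambda>q. mform (real_vec q) (real_vec q))"
    by (rule Bochner_Integration.integrable_bound[OF integrable_mult_right[OF iT2, of 3]])
      (use abs_mform_le in auto)
  define nx where "nx = (\<lambda>(q :: 'n switch_vec, s :: 'n switch_vec, a :: 'n switch_vec). q + a - s)"
  define v where "v = (\<lambda>(q :: 'n switch_vec, s :: 'n switch_vec, a :: 'n switch_vec). s - (q + a))"
  define d where "d = (\<lambda>(q :: 'n switch_vec, s :: 'n switch_vec, a :: 'n switch_vec). real_vec a - real_vec s)"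
  define m where "m x = total_queue (v x)" for x
  have maximal: "fst (snd x) \<in> maximal_schedules" if "x \<in> set_pmf ?J" for x
    using that max_weight_optimal(2) by (auto simp: set_slot_law)
  have v_le: "v x $ i $ j \<le> fst (snd x) $ i $ j" for x i j by (simp add: v_def case_prod_unfold)
  have decomp: "real_vec (nx x) = real_vec (fst x) + d x + real_vec (v x)" for x
    using truncation_decomposition[of "fst x" "snd (snd x)" "fst (snd x)"]
    by (simp add: nx_def d_def v_def case_prod_unfold)
  have i_nx: "integrable (measure_pmf ?J) (\<lambda>x. f (nx x)) \<longleftrightarrow> integrable (measure_pmf \<pi>) f"
    and e_nx: "?E (\<lambda>x. f (nx x)) = measure_pmf.expectation \<pi> f" for f :: "'n switch_vec \<Rightarrow> real"
    using slot_law_next[OF st, of f] by (simp_all add: nx_def case_prod_unfold)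
  \<comment> \<open>Schedule and arrivals range over a finite set, so every function of them alone
    is integrable.\<close>
  have i_snd: "integrable (measure_pmf ?J) (\<lambda>x. g (snd x))" for g :: "_ \<Rightarrow> real"
  proof -
    have "set_pmf (map_pmf snd ?J) \<subseteq> schedules \<times> {a. \<forall>i j. a $ i $ j \<le> 1}"
      using max_weight_optimal(2) maximal_subset_schedules
      by (fastforce simp: set_slot_law dest: arrivals_le_one)
    then have "finite (set_pmf (map_pmf snd ?J))"
      by (rule finite_subset) (intro finite_cartesian_product finite_schedules finite_bounded_switch_vec)
    then have "integrable (measure_pmf (map_pmf snd ?J)) g" by (rule integrable_measure_pmf_finite)
    then show ?thesis by simp
  qed
  have d_snd: "d x = (\<lambda>(s, a). real_vec a - real_vec s) (snd x)" for x by (simp add: d_def case_prod_unfold)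

  have im: "integrable (measure_pmf ?J) (\<lambda>x. real (m x))" and Em: "?E (\<lambda>x. real (m x)) = n * \<epsilon>"
  proof -
    let ?D = "\<lambda>x. \<Sum>i\<in>UNIV. \<Sum>j\<in>UNIV. d x $ i $ j"
    have meq: "real (m x) = ?T (nx x) - ?T (fst x) - ?D x" for x
    proof -
      have "?T (nx x) = (\<Sum>i\<in>UNIV. \<Sum>j\<in>UNIV. (real_vec (fst x) + d x + real_vec (v x)) $ i $ j)"
        unfolding real_total_queue decomp ..
      also have "\<dots> = ?T (fst x) + ?D x + real (m x)"
        unfolding m_def real_total_queue by (simp add: sum.distrib)
      finally show ?thesis by simp
    qed
    have iD: "integrable (measure_pmf ?J) ?D" unfolding d_snd by (rule i_snd)
    have i1: "integrable (measure_pmf ?J) (\<lambda>x. ?T (nx x))" using iT i_nx[of ?T] by simp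
    have i2: "integrable (measure_pmf ?J) (\<lambda>x. ?T (fst x))" using iT integrable_slot_law_fst[where f="?T"] by blast
    show "integrable (measure_pmf ?J) (\<lambda>x. real (m x))" unfolding meq using i1 i2 iD by simp
    have ED: "?E ?D = measure_pmf.expectation \<pi> (\<lambda>q. - (n * \<epsilon>))"
    proof (rule mw_slot_expectation[OF iD])
      fix q s :: "'n switch_vec" assume "s \<in> set_pmf (max_weight q)"
      then have s: "s \<in> maximal_schedules" by (rule max_weight_optimal(2))
      have Deq: "?D (q, s, a) = (\<Sum>i\<in>UNIV. \<Sum>j\<in>UNIV. real (a $ i $ j)) - n" for a
        by (simp add: d_def sum_subtractf sum_maximal_schedule(4)[OF s] n_def)
      show "measure_pmf.expectation (bernoulli_arrivals (uniform_rate \<epsilon>)) (\<lambda>a. ?D (q, s, a)) = - (n * \<epsilon>)"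
        unfolding Deq using n by (simp add: integrable_measure_pmf_finite[OF finite_set_arrivals]
          Bochner_Integration.integral_sum expectation_uniform_arrival[OF \<epsilon>(1,2)] n_def field_simps)
    qed
    show "?E (\<lambda>x. real (m x)) = n * \<epsilon>"
      unfolding meq using i1 i2 iD ED e_nx[of ?T] expectation_slot_law_fst[of max_weight "uniform_rate \<epsilon>" \<pi> ?T]
      by simp
  qed

  define X where "X x = norm (perp (real_vec (nx x)))" for x
  have iX: "integrable (measure_pmf ?J) (\<lambda>x. X x ^ r)"
    and EX: "?E (\<lambda>x. X x ^ r) \<le> M_bound CARD('n) r ^ r"
    using mw_perp_moment[OF \<epsilon> st, of r] r i_nx[of "\<lambda>q. norm (perp (real_vec q)) ^ r"]
      e_nx[of "\<lambda>q. norm (perp (real_vec q)) ^ r"] unfolding X_def by simp_all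
  have M: "0 < M_bound CARD('n) r" using r by (intro M_bound_pos) (auto simp: Suc_leI)
  define H where "H = ?E (\<lambda>x. X x * sqrt (real (m x)))"
  have n\<epsilon>: "0 < n * \<epsilon>" using n \<epsilon> by simp
  have iH: "integrable (measure_pmf ?J) (\<lambda>x. X x * sqrt (real (m x)))"
    and H: "H \<le> M_bound CARD('n) r * (n * \<epsilon>) powr (1 - 1 / real r)"
    using expectation_mult_sqrt_le[OF r M _ iX EX im eq_refl[OF Em] n\<epsilon>] unfolding H_def by (simp_all add: X_def)
  \<comment> \<open>The common error term of both bounds: n (n \<epsilon>) powr (1 - 1/r) /
    \<epsilon> = n powr (2 - 1/r) * \<epsilon> powr (- 1/r).\<close>
  define U where "U = real CARD('n) powr (2 - 1 / real r) * \<epsilon> powr (- 1 / real r) * M_bound CARD('n) r"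
  have HU: "n * H / \<epsilon> \<le> U"
  proof -
    have "n * H / \<epsilon> \<le> n * (M_bound CARD('n) r * (n * \<epsilon>) powr (1 - 1 / real r)) / \<epsilon>"
      using H n \<epsilon> by (intro divide_right_mono mult_left_mono) auto
    also have "\<dots> = U"
    proof -
      have "n powr (2 - 1 / real r) = n powr 1 * n powr (1 - 1 / real r)"
        using powr_add[of n 1 "1 - 1 / real r"] by simp
      moreover have "\<epsilon> powr (1 - 1 / real r) = \<epsilon> powr 1 * \<epsilon> powr (- 1 / real r)"
        using powr_add[of \<epsilon> 1 "- 1 / real r"] by simp
      ultimately show ?thesis
        using n \<epsilon> unfolding U_def n_def[symmetric] by (simp add: powr_mult)
    qed
    finally show ?thesis .
  qed

  define F3 where "F3 x = mform (real_vec (nx x)) (real_vec (v x))" for x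
  define F4 where "F4 x = mform (real_vec (v x)) (real_vec (v x))" for x
  have F3_le: "F3 x \<le> 2 * (n * (X x * sqrt (real (m x))))" and F3_ge: "- 3 * (n * (X x * sqrt (real (m x)))) \<le> F3 x"
    if "x \<in> set_pmf ?J" for x
    using mform_unused_bounds[OF maximal[OF that], of "fst x" "snd (snd x)"]
    by (simp_all add: F3_def X_def m_def nx_def v_def n_def case_prod_unfold)
  have iF3: "integrable (measure_pmf ?J) F3"
  proof (rule Bochner_Integration.integrable_bound[OF integrable_mult_right[OF iH, of "3 * n"]])
    have "norm (F3 x) \<le> norm (3 * n * (X x * sqrt (real (m x))))" if "x \<in> set_pmf ?J" for x
    proof -
      have "0 \<le> n * (X x * sqrt (real (m x)))" using n by (simp add: X_def)
      then show ?thesis using F3_le[OF that] F3_ge[OF that] by (simp add: abs_le_iff)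
    qed
    then show "AE x in measure_pmf ?J. norm (F3 x) \<le> norm (3 * n * (X x * sqrt (real (m x))))"
      by (simp add: AE_measure_pmf_iff)
  qed simp
  have F4_bounds: "real (m x) \<le> F4 x" "F4 x \<le> (2 - 1 / n) * real (m x)" if "x \<in> set_pmf ?J" for x
  proof -
    note us = unused_service[OF maximal[OF that] v_le]
    have F4: "F4 x = 2 * real (m x) - (real (m x))\<^sup>2 / n" using us(6) by (simp add: F4_def m_def n_def)
    have "real (m x) * 1 \<le> real (m x) * real (m x)" by (cases "m x") auto
    then have "real (m x) / n \<le> (real (m x))\<^sup>2 / n" using n by (intro divide_right_mono) (auto simp: power2_eq_square)
    then show "F4 x \<le> (2 - 1 / n) * real (m x)" unfolding F4 by (simp add: left_diff_distrib)
    have "real (m x) * real (m x) \<le> real (m x) * n" using us(4) by (intro mult_left_mono) (auto simp: m_def n_def)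
    then have "(real (m x))\<^sup>2 / n \<le> real (m x)" using n by (simp add: divide_le_eq power2_eq_square)
    then show "real (m x) \<le> F4 x" unfolding F4 by simp
  qed
  have iF4: "integrable (measure_pmf ?J) F4"
  proof (rule Bochner_Integration.integrable_bound[OF integrable_mult_right[OF im, of 2]])
    have "norm (F4 x) \<le> norm (2 * real (m x))" if "x \<in> set_pmf ?J" for x
    proof -
      have "0 \<le> 1 / n * real (m x)" using n by simp
      then have "(2 - 1 / n) * real (m x) \<le> 2 * real (m x)" by (simp add: left_diff_distrib)
      then show ?thesis using F4_bounds[OF that] by simp
    qed
    then show "AE x in measure_pmf ?J. norm (F4 x) \<le> norm (2 * real (m x))"
      by (simp add: AE_measure_pmf_iff)
  qed simp
  have EF3: "?E F3 \<le> 2 * (n * H)" "- 3 * (n * H) \<le> ?E F3"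
  proof -
    have "?E F3 \<le> ?E (\<lambda>x. 2 * (n * (X x * sqrt (real (m x)))))"
      by (rule integral_mono_AE) (use iF3 iH F3_le in \<open>auto simp: AE_measure_pmf_iff\<close>)
    then show "?E F3 \<le> 2 * (n * H)" by (simp add: H_def)
    have "?E (\<lambda>x. - 3 * (n * (X x * sqrt (real (m x))))) \<le> ?E F3"
      by (rule integral_mono_AE) (use iF3 iH F3_ge in \<open>auto simp: AE_measure_pmf_iff\<close>)
    then show "- 3 * (n * H) \<le> ?E F3" by (simp add: H_def)
  qed
  have EF4: "n * \<epsilon> \<le> ?E F4" "?E F4 \<le> (2 - 1 / n) * (n * \<epsilon>)"
  proof -
    have "?E (\<lambda>x. real (m x)) \<le> ?E F4"
      by (rule integral_mono_AE) (use im iF4 F4_bounds(1) in \<open>auto simp: AE_measure_pmf_iff\<close>)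
    then show "n * \<epsilon> \<le> ?E F4" by (simp add: Em)
    have "?E F4 \<le> ?E (\<lambda>x. (2 - 1 / n) * real (m x))"
      by (rule integral_mono_AE) (use im iF4 F4_bounds(2) in \<open>auto simp: AE_measure_pmf_iff\<close>)
    then show "?E F4 \<le> (2 - 1 / n) * (n * \<epsilon>)" by (simp add: Em)
  qed

  define F1 where "F1 x = mform (real_vec (fst x)) (real_vec (fst x))" for x :: "'n switch_vec \<times> 'n switch_vec \<times> 'n switch_vec"
  define F2 where "F2 x = mform (real_vec (nx x)) (real_vec (nx x))" for x
  define F5 where "F5 x = mform (real_vec (fst x)) (d x)" for x
  define F6 where "F6 x = mform (d x) (d x)" for x
  \<comment> \<open>After integration \<open>F1\<close> and \<open>F2\<close> cancel by
    stationarity, and \<open>F5\<close> gives - \<epsilon> times the mean total queue.\<close>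
  have ident: "2 * F5 x = F2 x - 2 * F3 x + F4 x - F1 x - F6 x" for x
    using mform_square_increment[OF decomp[of x]] by (simp add: F1_def F2_def F3_def F4_def F5_def F6_def)
  have iF1: "integrable (measure_pmf ?J) F1"
    using iQ unfolding F1_def[abs_def] by (subst integrable_slot_law_fst[of _ _ _ "\<lambda>q. mform (real_vec q) (real_vec q)"])
  have iF2: "integrable (measure_pmf ?J) F2"
    using iQ unfolding F2_def[abs_def] by (subst i_nx[of "\<lambda>q. mform (real_vec q) (real_vec q)"])
  have EF12: "?E F1 = ?E F2"
    unfolding F1_def[abs_def] F2_def[abs_def]
    using e_nx[of "\<lambda>q. mform (real_vec q) (real_vec q)"]
      expectation_slot_law_fst[of max_weight "uniform_rate \<epsilon>" \<pi> "\<lambda>q. mform (real_vec q) (real_vec q)"] by simp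
  have iF6: "integrable (measure_pmf ?J) F6"
    unfolding F6_def[abs_def] d_snd by (rule i_snd)
  have i2F5: "integrable (measure_pmf ?J) (\<lambda>x. 2 * F5 x)"
    unfolding ident using iF1 iF2 iF3 iF4 iF6 by simp
  then have iF5: "integrable (measure_pmf ?J) F5" by simp
  define c0 where "c0 = (2 * n - 1) * ((1 - \<epsilon>) * (1 - (1 - \<epsilon>) / n)) + n * \<epsilon>\<^sup>2"
  have EF5: "?E F5 = - \<epsilon> * ET"
  proof -
    have "?E F5 = measure_pmf.expectation \<pi> (\<lambda>q. - \<epsilon> * ?T q)"
    proof (rule mw_slot_expectation[OF iF5])
      fix q s :: "'n switch_vec" assume "s \<in> set_pmf (max_weight q)"
      then have s: "s \<in> maximal_schedules" by (rule max_weight_optimal(2))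
      show "measure_pmf.expectation (bernoulli_arrivals (uniform_rate \<epsilon>)) (\<lambda>a. F5 (q, s, a)) = - \<epsilon> * ?T q"
        using expectation_mform_increment(1)[OF \<epsilon>(1,2) s, of "real_vec q"]
        unfolding F5_def d_def real_total_queue by simp
    qed
    then show ?thesis by (simp add: ET_def)
  qed
  have EF6: "?E F6 = c0"
  proof -
    have "?E F6 = measure_pmf.expectation \<pi> (\<lambda>q. c0)"
    proof (rule mw_slot_expectation[OF iF6])
      fix q s :: "'n switch_vec" assume "s \<in> set_pmf (max_weight q)"
      then have s: "s \<in> maximal_schedules" by (rule max_weight_optimal(2))
      show "measure_pmf.expectation (bernoulli_arrivals (uniform_rate \<epsilon>)) (\<lambda>a. F6 (q, s, a)) = c0"
        using expectation_mform_increment(2)[OF \<epsilon>(1,2) s]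
        unfolding F6_def d_def c0_def n_def by simp
    qed
    then show ?thesis by simp
  qed
  have "2 * ?E F5 = ?E (\<lambda>x. F2 x - 2 * F3 x + F4 x - F1 x - F6 x)"
    unfolding ident[symmetric] by simp
  also have "\<dots> = ?E F2 - 2 * ?E F3 + ?E F4 - ?E F1 - ?E F6"
    using iF1 iF2 iF3 iF4 iF6 by simp
  finally have "2 * \<epsilon> * ET = c0 - ?E F4 + 2 * ?E F3" using EF12 EF5 EF6 by simp
  then have ET: "ET = c0 / (2 * \<epsilon>) - ?E F4 / (2 * \<epsilon>) + ?E F3 / \<epsilon>" using \<epsilon> by (simp add: field_simps)
  define \<alpha> where "\<alpha> = 1 / \<epsilon> * (n - 3 / 2 + 1 / (2 * n))"
  define \<beta> where "\<beta> = (1 - \<epsilon> / 2) * (n - 2 + 1 / n)"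
  define e3 e4 where "e3 = ?E F3 / \<epsilon>" and "e4 = ?E F4 / (2 * \<epsilon>)"
  have c0: "c0 / (2 * \<epsilon>) = \<alpha> - \<beta> + 1 / 2"
    unfolding c0_def \<alpha>_def \<beta>_def by (rule heavy_traffic_algebra[OF n \<epsilon>(1)])
  \<comment> \<open>With the 1/2 from c0 these two bounds yield the constants (1 - n) / 2 above and
    1 - n below, within those of \<open>B2_bound\<close> and \<open>B1_bound\<close>.\<close>
  have 1: "n / 2 \<le> ?E F4 / (2 * \<epsilon>)" using EF4(1) \<epsilon> by (simp add: field_simps)
  have 2: "?E F4 / (2 * \<epsilon>) \<le> n - 1 / 2"
  proof -
    have "(2 - 1 / n) * (n * \<epsilon>) = (n - 1 / 2) * (2 * \<epsilon>)" using n by (simp add: field_simps)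
    with EF4(2) have "?E F4 \<le> (n - 1 / 2) * (2 * \<epsilon>)" by (simp only:)
    then show ?thesis using \<epsilon>(1) by (subst pos_divide_le_eq) simp_all
  qed
  have 3: "?E F3 / \<epsilon> \<le> 2 * U"
  proof -
    have "?E F3 / \<epsilon> \<le> 2 * (n * H / \<epsilon>)" using EF3(1) \<epsilon> by (simp add: divide_le_eq)
    then show ?thesis using HU by simp
  qed
  have 4: "- 3 * U \<le> ?E F3 / \<epsilon>"
  proof -
    have "- 3 * (n * H / \<epsilon>) \<le> ?E F3 / \<epsilon>" using EF3(2) \<epsilon> by (simp add: le_divide_eq)
    then show ?thesis using HU by simp
  qed
  have B1: "B1_bound CARD('n) r \<epsilon> = \<beta> + n - 1 / 2 + 3 * U"
    by (simp add: B1_bound_def U_def n_def \<beta>_def)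
  have B2: "B2_bound CARD('n) r \<epsilon> = - \<beta> + (n + 1) / 2 + 2 * U"
    unfolding B2_bound_def U_def n_def \<beta>_def by (simp only: mult_minus_left mult.assoc)
  show "1 / \<epsilon> * (n - 3 / 2 + 1 / (2 * n)) - B1_bound CARD('n) r \<epsilon> \<le> ET"
    unfolding B1 ET c0 \<alpha>_def[symmetric] using 2 4 unfolding e3_def[symmetric] e4_def[symmetric] by linarith
  show "ET \<le> 1 / \<epsilon> * (n - 3 / 2 + 1 / (2 * n)) + B2_bound CARD('n) r \<epsilon>"
    unfolding B2 ET c0 \<alpha>_def[symmetric] add_divide_distrib
    using 1 3 n unfolding e3_def[symmetric] e4_def[symmetric] by linarith
qed

section \<open>Universal lower bound\<close>

text \<open>A finite product of discrete spaces is discrete, so convergence in distribution may be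
  tested on every bounded function.\<close>

lemma open_switch_vec: "open (S :: 'n::finite switch_vec set)"
proof -
  have "open {q :: 'n switch_vec}" for q
  proof -
    have "{q} = (\<Inter>i\<in>UNIV. \<Inter>j\<in>UNIV. (\<lambda>x. x $ i $ j) -` {q $ i $ j})"
      by (auto simp: vec_eq_iff)
    moreover have "open ((\<lambda>x :: 'n switch_vec. x $ i $ j) -` {q $ i $ j})" for i j
    proof (rule open_vimage)
      show "open {q $ i $ j}" by (rule discrete_topology_class.open_discrete)
      show "continuous_on UNIV (\<lambda>x :: 'n switch_vec. x $ i $ j)" by (intro continuous_intros)
    qed
    ultimately show ?thesis by (auto intro!: open_INT)
  qed
  then have "open (\<Union>q\<in>S. {q})" by (intro open_UN) auto
  then show ?thesis by simp
qed

lemma continuous_on_switch_vec: "continuous_on UNIV (f :: 'n::finite switch_vec \<Rightarrow> real)"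
  by (simp add: continuous_on_open_vimage open_switch_vec)

text \<open>The one-step average of an indicator is again an admissible test function, so shifting
  the time by one identifies the limits.\<close>

lemma limit_law_stationary:
  fixes K :: "'n::finite switch_vec \<Rightarrow> 'n switch_vec pmf"
  assumes "converges_in_distribution (chain_law K init) \<pi>"
  shows "stationary K \<pi>"
  unfolding stationary_def
proof (rule pmf_eqI)
  fix y
  let ?f = "indicator {y} :: 'n switch_vec \<Rightarrow> real"
  let ?g = "\<lambda>x. measure_pmf.expectation (K x) ?f"
  have conv: "(\<lambda>t. measure_pmf.expectation (chain_law K init t) f) \<longlonglongrightarrow> measure_pmf.expectation \<pi> f"
    if "\<And>x. \<bar>f x\<bar> \<le> 1" for f :: "'n switch_vec \<Rightarrow> real"
    using assms that continuous_on_switch_vec[of f]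
    unfolding converges_in_distribution_def bounded_iff by auto
  have f1: "\<bar>?f x\<bar> \<le> 1" for x by (simp add: indicator_def)
  have g1: "\<bar>?g x\<bar> \<le> 1" for x by (rule abs_expectation_pmf_le[OF f1])
  have "(\<lambda>t. measure_pmf.expectation (chain_law K init (Suc t)) ?f) \<longlonglongrightarrow> measure_pmf.expectation \<pi> ?f"
    by (rule LIMSEQ_Suc[OF conv[where f="?f", OF f1]])
  moreover have "measure_pmf.expectation (chain_law K init (Suc t)) ?f = measure_pmf.expectation (chain_law K init t) ?g" for t
    unfolding chain_law.simps by (rule expectation_bind_pmf_bounded[where f="?f", OF f1])
  ultimately have "(\<lambda>t. measure_pmf.expectation (chain_law K init t) ?g) \<longlonglongrightarrow> measure_pmf.expectation \<pi> ?f"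
    by (simp only:)
  then have "measure_pmf.expectation \<pi> ?f = measure_pmf.expectation \<pi> ?g"
    by (rule LIMSEQ_unique[OF _ conv[where f="?g", OF g1]])
  also have "\<dots> = measure_pmf.expectation (bind_pmf \<pi> K) ?f"
    by (rule expectation_bind_pmf_bounded[where f="?f", OF f1, symmetric])
  finally show "pmf (bind_pmf \<pi> K) y = pmf \<pi> y" by (simp add: measure_pmf_single)
qed

definition row_queue :: "'n::finite \<Rightarrow> 'n switch_vec \<Rightarrow> real" where
  "row_queue i q = (\<Sum>j\<in>UNIV. real (q $ i $ j))"

lemma row_queue_nonneg: "0 \<le> row_queue i q"
  by (simp add: row_queue_def sum_nonneg)

lemma sum_row_queue: "(\<Sum>i\<in>UNIV. row_queue i q) = real (total_queue q)"
  by (simp add: row_queue_def total_queue_def)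

lemma row_queue_of_nat: "row_queue i q = real (\<Sum>j\<in>UNIV. q $ i $ j)"
  by (simp add: row_queue_def)

text \<open>A single input is at best a unit-rate server fed by all its arrivals. The square of the
  workload need not be integrable, so the drift is taken of \<open>min(x, M)\<^sup>2\<close>; the limit \<open>M \<rightarrow> \<infinity>\<close> is
  dominated because the increments are bounded and the workload is integrable.\<close>

lemma row_queue_lower_bound:
  fixes \<pi> :: "'n::finite switch_vec pmf"
  assumes \<epsilon>: "0 < \<epsilon>" "\<epsilon> < 1" and P: "scheduling_policy P"
    and st: "stationary (switch_kernel P (uniform_rate \<epsilon>)) \<pi>"
    and iX: "integrable (measure_pmf \<pi>) (row_queue i)"
  defines "n \<equiv> real CARD('n)"
  shows "(1 - \<epsilon>)\<^sup>2 / (2 * \<epsilon>) * (n - 1) / n \<le> measure_pmf.expectation \<pi> (row_queue i)"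
proof -
  let ?r = "uniform_rate \<epsilon> :: real ^ 'n ^ 'n"
  let ?J = "slot_law P ?r \<pi>"
  let ?E = "measure_pmf.expectation ?J"
  have n: "1 \<le> n" by (simp add: n_def Suc_leI)
  have fin: "finite (set_pmf (P q))" for q
    by (rule finite_subset[OF _ finite_schedules]) (use P in \<open>simp add: scheduling_policy_def\<close>)
  have iA: "integrable (measure_pmf (bernoulli_arrivals ?r)) g" for g :: "_ \<Rightarrow> real"
    by (rule integrable_measure_pmf_finite[OF finite_set_arrivals])
  define X where "X x = row_queue i (fst x)" for x :: "'n switch_vec \<times> 'n switch_vec \<times> 'n switch_vec"
  define X' where "X' = (\<lambda>(q :: 'n switch_vec, s :: 'n switch_vec, a :: 'n switch_vec). row_queue i (q + a - s))"
  define A where "A x = row_queue i (snd (snd x))" for x :: "'n switch_vec \<times> 'n switch_vec \<times> 'n switch_vec"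
  \<comment> \<open>Lindley's recursion for a server of rate one; I marks the slots in which its
    unit of service is wasted.\<close>
  define Y where "Y x = max (X x + A x - 1) 0" for x
  define I :: "_ \<Rightarrow> real" where "I x = of_bool (X x + A x = 0)" for x
  have X0: "0 \<le> X x" and A0: "0 \<le> A x" and Y0: "0 \<le> Y x" for x
    by (simp_all add: X_def A_def Y_def row_queue_nonneg)
  have A_le: "A x \<le> n" if "x \<in> set_pmf ?J" for x
  proof -
    have "snd (snd x) \<in> set_pmf (bernoulli_arrivals ?r)" using that by (auto simp: set_slot_law)
    then have "A x \<le> (\<Sum>j\<in>(UNIV :: 'n set). 1)"
      unfolding A_def row_queue_def by (intro sum_mono) (use arrivals_le_one in fastforce)
    then show ?thesis by (simp add: n_def)
  qed
  \<comment> \<open>Integrality matters: X + A is a natural number, so truncation changes X + A - 1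
    only at 0, and then by exactly 1.\<close>
  have YI: "Y x = X x + A x - 1 + I x" for x
  proof -
    have "X x + A x = real ((\<Sum>j\<in>UNIV. fst x $ i $ j) + (\<Sum>j\<in>UNIV. snd (snd x) $ i $ j))"
      by (simp add: X_def A_def row_queue_of_nat)
    then obtain k :: nat where "X x + A x = real k" by blast
    then show ?thesis by (cases k) (auto simp: Y_def I_def)
  qed
  have X'_ge: "Y x \<le> X' x" if "x \<in> set_pmf ?J" for x
  proof -
    obtain q s a where x: "x = (q, s, a)" by (cases x)
    have "s \<in> schedules" using that P by (auto simp: x set_slot_law scheduling_policy_def)
    then have "(\<Sum>j\<in>UNIV. s $ i $ j) \<le> 1" by (simp add: schedules_def)
    then have S: "(\<Sum>j\<in>UNIV. real (s $ i $ j)) \<le> 1" by (metis of_nat_sum of_nat_le_1_iff)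
    have "X x + A x - (\<Sum>j\<in>UNIV. real (s $ i $ j)) = (\<Sum>j\<in>UNIV. real (q $ i $ j) + real (a $ i $ j) - real (s $ i $ j))"
      by (simp add: x X_def A_def row_queue_def sum.distrib sum_subtractf)
    also have "\<dots> \<le> (\<Sum>j\<in>UNIV. real (q $ i $ j + a $ i $ j - s $ i $ j))"
      by (intro sum_mono) linarith
    also have "\<dots> = X' x" by (simp add: x X'_def row_queue_def)
    finally have "X x + A x - 1 \<le> X' x" using S by linarith
    moreover have "0 \<le> X' x" by (simp add: x X'_def row_queue_nonneg)
    ultimately show ?thesis by (simp add: Y_def)
  qed
  have iXJ: "integrable (measure_pmf ?J) X"
    using iX integrable_slot_law_fst[of P ?r \<pi> "row_queue i"] unfolding X_def[abs_def] by simp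
  have iX'J: "integrable (measure_pmf ?J) X'"
    using iX slot_law_next(1)[OF st, of "row_queue i"] unfolding X'_def by simp
  have EX': "?E X' = ?E X"
    using slot_law_next(2)[OF st, of "row_queue i"] expectation_slot_law_fst[of P ?r \<pi> "row_queue i"]
    unfolding X'_def X_def[abs_def] by simp
  have iAJ: "integrable (measure_pmf ?J) (\<lambda>x. g (snd (snd x)))" for g :: "_ \<Rightarrow> real"
  proof -
    have "set_pmf (map_pmf (\<lambda>x. snd (snd x)) ?J) \<subseteq> set_pmf (bernoulli_arrivals ?r)"
      by (auto simp: set_slot_law)
    then have "integrable (measure_pmf (map_pmf (\<lambda>x. snd (snd x)) ?J)) g"
      by (intro integrable_measure_pmf_finite) (rule finite_subset[OF _ finite_set_arrivals])
    then show ?thesis by simp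
  qed
  have iI: "integrable (measure_pmf ?J) I"
    by (rule integrable_pmf_bounded[where B=1]) (simp add: I_def)

  have EA: "measure_pmf.expectation (bernoulli_arrivals ?r) (row_queue i) = 1 - \<epsilon>"
    using n unfolding row_queue_def
    by (simp add: iA Bochner_Integration.integral_sum expectation_uniform_arrival[OF \<epsilon>] n_def)
  have EA2: "measure_pmf.expectation (bernoulli_arrivals ?r) (\<lambda>a. (row_queue i a - 1)\<^sup>2)
      = (1 - \<epsilon>) * (1 - (1 - \<epsilon>) / n) + \<epsilon>\<^sup>2"
  proof -
    have "(\<Sum>e\<in>Pair i ` UNIV. real (a $ fst e $ snd e)) = row_queue i a" for a :: "'n switch_vec"
      unfolding row_queue_def by (subst sum.reindex) (auto simp: inj_on_def)
    moreover have "card (Pair i ` (UNIV :: 'n set)) = CARD('n)" by (rule card_image) (auto simp: inj_on_def)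
    ultimately have "measure_pmf.expectation (bernoulli_arrivals ?r) (\<lambda>a. (row_queue i a - 1)\<^sup>2)
      = n * ((1 - \<epsilon>) / n) * (1 - (1 - \<epsilon>) / n) + (n * ((1 - \<epsilon>) / n) - 1)\<^sup>2"
      using expectation_arrival_sum_square[OF \<epsilon>, of "Pair i ` UNIV" 1] by (simp only: n_def)
    moreover have "n * ((1 - \<epsilon>) / n) = 1 - \<epsilon>" using n by simp
    ultimately show ?thesis by simp
  qed
  have iXA: "integrable (measure_pmf ?J) (\<lambda>x. X x * (A x - 1))"
  proof (rule Bochner_Integration.integrable_bound[OF integrable_mult_right[OF iXJ, of n]])
    have "norm (X x * (A x - 1)) \<le> norm (n * X x)" if "x \<in> set_pmf ?J" for x
    proof -
      have "\<bar>A x - 1\<bar> \<le> n" using A_le[OF that] A0[of x] n by linarith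
      then have "X x * \<bar>A x - 1\<bar> \<le> X x * n" using X0 by (intro mult_left_mono)
      then show ?thesis using X0[of x] n by (simp add: abs_mult mult.commute)
    qed
    then show "AE x in measure_pmf ?J. norm (X x * (A x - 1)) \<le> norm (n * X x)"
      by (simp add: AE_measure_pmf_iff)
  qed (auto intro!: borel_measurable_integrable)
  have EXA: "?E (\<lambda>x. X x * (A x - 1)) = - \<epsilon> * ?E X"
  proof -
    have "?E (\<lambda>x. X x * (A x - 1)) = measure_pmf.expectation \<pi> (\<lambda>q. - \<epsilon> * row_queue i q)"
    proof (rule slot_law_expectation_arrivals[where P=P, OF fin iXA])
      show "measure_pmf.expectation (bernoulli_arrivals ?r) (\<lambda>a. X (q, s, a) * (A (q, s, a) - 1)) = - \<epsilon> * row_queue i q" for q s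
        by (simp add: X_def A_def EA iA)
    qed
    also have "\<dots> = - \<epsilon> * ?E X"
      using expectation_slot_law_fst[of P ?r \<pi> "row_queue i"] unfolding X_def[abs_def] by simp
    finally show ?thesis .
  qed
  have EA1J: "?E (\<lambda>x. A x - 1) = - \<epsilon>"
  proof -
    have "?E (\<lambda>x. A x - 1) = measure_pmf.expectation \<pi> (\<lambda>q. - \<epsilon>)"
      by (rule slot_law_expectation_arrivals[where P=P, OF fin])
        (use iAJ[of "\<lambda>a. row_queue i a - 1"] in \<open>simp_all add: A_def EA iA\<close>)
    then show ?thesis by simp
  qed
  have EA2J: "?E (\<lambda>x. (A x - 1)\<^sup>2) = (1 - \<epsilon>) * (1 - (1 - \<epsilon>) / n) + \<epsilon>\<^sup>2"
  proof -
    have "?E (\<lambda>x. (A x - 1)\<^sup>2) = measure_pmf.expectation \<pi> (\<lambda>q. (1 - \<epsilon>) * (1 - (1 - \<epsilon>) / n) + \<epsilon>\<^sup>2)"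
      by (rule slot_law_expectation_arrivals[where P=P, OF fin])
        (use iAJ[of "\<lambda>a. (row_queue i a - 1)\<^sup>2"] in \<open>simp_all add: A_def EA2\<close>)
    then show ?thesis by simp
  qed
  have iA1: "integrable (measure_pmf ?J) (\<lambda>x. A x - 1)" "integrable (measure_pmf ?J) (\<lambda>x. (A x - 1)\<^sup>2)"
    using iAJ[of "\<lambda>a. row_queue i a - 1"] iAJ[of "\<lambda>a. (row_queue i a - 1)\<^sup>2"] by (simp_all add: A_def)
  have Y_eq: "Y = (\<lambda>x. X x + (A x - 1) + I x)" by (auto simp: YI)
  have iY: "integrable (measure_pmf ?J) Y" unfolding Y_eq using iXJ iA1(1) iI by simp
  \<comment> \<open>The true workload X' has the stationary mean of X and dominates Y, which bounds
    the idle probability by the slack.\<close>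
  have EI: "?E I \<le> \<epsilon>"
  proof -
    have "?E Y \<le> ?E X'"
      by (rule integral_mono_AE[OF iY iX'J]) (simp add: AE_measure_pmf_iff X'_ge)
    moreover have "?E Y = ?E X + ?E (\<lambda>x. A x - 1) + ?E I"
    proof -
      have "?E Y = ?E (\<lambda>x. X x + (A x - 1) + I x)" by (simp only: Y_eq)
      also have "\<dots> = ?E X + ?E (\<lambda>x. A x - 1) + ?E I"
        using iXJ iA1(1) iI by (simp only: Bochner_Integration.integral_add Bochner_Integration.integrable_add)
      finally show ?thesis .
    qed
    ultimately show ?thesis using EX' EA1J by simp
  qed

  define h where "h M x = (min x (real M))\<^sup>2" for M :: nat and x :: real
  have h_bound: "\<bar>h M x\<bar> \<le> (real M)\<^sup>2" if "0 \<le> x" for M x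
    using that by (simp add: h_def power_mono)
  \<comment> \<open>Difference of squares with a bound independent of M, as dominated convergence
    requires.\<close>
  have h_diff: "\<bar>h M y - h M x\<bar> \<le> \<bar>y - x\<bar> * (x + y)" if "0 \<le> x" "0 \<le> y" for M x y
  proof -
    have "h M y - h M x = (min y (real M) - min x (real M)) * (min y (real M) + min x (real M))"
      by (simp add: h_def power2_eq_square algebra_simps)
    also have "\<bar>\<dots>\<bar> = \<bar>min y (real M) - min x (real M)\<bar> * (min y (real M) + min x (real M))"
      using that by (simp add: abs_mult)
    also have "\<dots> \<le> \<bar>y - x\<bar> * (x + y)"
      using that by (intro mult_mono) auto
    finally show ?thesis .
  qed
  have h_lim: "(\<lambda>M. h M x) \<longlonglongrightarrow> x\<^sup>2" for x
  proof (rule tendsto_eventually)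
    obtain N where "x \<le> real N" using real_arch_simple by blast
    then show "eventually (\<lambda>M. h M x = x\<^sup>2) sequentially"
      by (auto simp: eventually_sequentially h_def intro!: exI[of _ N])
  qed
  have drift_le: "?E (\<lambda>x. h M (Y x) - h M (X x)) \<le> 0" for M
  proof -
    have b: "integrable (measure_pmf ?J) (\<lambda>x. h M (f x))" if "\<And>x. 0 \<le> f x" for f
      using h_bound[OF that, of M] by (intro integrable_pmf_bounded) auto
    have X'0: "0 \<le> X' x" for x by (simp add: X'_def case_prod_unfold row_queue_nonneg)
    have "?E (\<lambda>x. h M (Y x)) \<le> ?E (\<lambda>x. h M (X' x))"
      using X'_ge Y0
      by (intro integral_mono_AE b X'0) (auto simp: AE_measure_pmf_iff h_def intro!: power_mono min.mono)
    also have "\<dots> = ?E (\<lambda>x. h M (X x))"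
      using slot_law_next(2)[OF st, of "\<lambda>q. h M (row_queue i q)"]
        expectation_slot_law_fst[of P ?r \<pi> "\<lambda>q. h M (row_queue i q)"]
      by (simp add: X'_def X_def case_prod_unfold)
    finally show ?thesis using b[of Y, OF Y0] b[of X, OF X0] by simp
  qed
  have YX: "\<bar>Y x - X x\<bar> \<le> n" "Y x \<le> X x + n" if "x \<in> set_pmf ?J" for x
    using A_le[OF that] A0[of x] X0[of x] n by (auto simp: Y_def)
  have dom: "AE x in measure_pmf ?J. norm (h M (Y x) - h M (X x)) \<le> n * (2 * X x + n)" for M
    unfolding AE_measure_pmf_iff
  proof
    fix x assume x: "x \<in> set_pmf ?J"
    have "\<bar>h M (Y x) - h M (X x)\<bar> \<le> \<bar>Y x - X x\<bar> * (X x + Y x)" by (rule h_diff[OF X0 Y0])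
    also have "\<dots> \<le> n * (2 * X x + n)"
      using YX[OF x] X0[of x] Y0[of x] n by (intro mult_mono) auto
    finally show "norm (h M (Y x) - h M (X x)) \<le> n * (2 * X x + n)" by simp
  qed
  have "(\<lambda>M. ?E (\<lambda>x. h M (Y x) - h M (X x))) \<longlonglongrightarrow> ?E (\<lambda>x. (Y x)\<^sup>2 - (X x)\<^sup>2)"
  proof (rule integral_dominated_convergence[where w="\<lambda>x. n * (2 * X x + n)"])
    show "AE x in measure_pmf ?J. (\<lambda>M. h M (Y x) - h M (X x)) \<longlonglongrightarrow> (Y x)\<^sup>2 - (X x)\<^sup>2"
      by (intro AE_I2 tendsto_diff h_lim)
    show "integrable (measure_pmf ?J) (\<lambda>x. n * (2 * X x + n))" using iXJ by simp
  qed (use dom in simp_all)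
  then have "?E (\<lambda>x. (Y x)\<^sup>2 - (X x)\<^sup>2) \<le> 0"
    by (rule LIMSEQ_le_const2) (use drift_le in blast)
  moreover have "(Y x)\<^sup>2 - (X x)\<^sup>2 = 2 * (X x * (A x - 1)) + (A x - 1)\<^sup>2 - I x" for x
  proof (cases "X x + A x = 0")
    case True
    then have "I x = 1" "X x = 0" "A x = 0" using X0[of x] A0[of x] by (auto simp: I_def)
    then show ?thesis unfolding YI by simp
  next
    case False
    then have "I x = 0" by (simp add: I_def)
    then show ?thesis unfolding YI by (simp add: power2_eq_square algebra_simps)
  qed
  ultimately have "?E (\<lambda>x. 2 * (X x * (A x - 1)) + (A x - 1)\<^sup>2 - I x) \<le> 0" by simp
  moreover have "?E (\<lambda>x. 2 * (X x * (A x - 1)) + (A x - 1)\<^sup>2 - I x)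
      = 2 * ?E (\<lambda>x. X x * (A x - 1)) + ?E (\<lambda>x. (A x - 1)\<^sup>2) - ?E I"
    using integrable_mult_right[OF iXA, of 2] iA1(2) iI
    by (simp only: Bochner_Integration.integral_add Bochner_Integration.integral_diff
        Bochner_Integration.integrable_add integral_mult_right_zero)
  ultimately have "(1 - \<epsilon>) * (1 - (1 - \<epsilon>) / n) + \<epsilon>\<^sup>2 - \<epsilon> \<le> 2 * \<epsilon> * ?E X"
    using EI unfolding EXA EA2J by simp
  \<comment> \<open>Since \<epsilon>^2 - \<epsilon> = - \<epsilon> (1 - \<epsilon>), the factor 1 -
    \<epsilon> splits off twice.\<close>
  moreover have "(1 - \<epsilon>) * (1 - (1 - \<epsilon>) / n) + \<epsilon>\<^sup>2 - \<epsilon> = (1 - \<epsilon>)\<^sup>2 * (n - 1) / n"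
    using n by (simp add: field_simps power2_eq_square)
  ultimately have "(1 - \<epsilon>)\<^sup>2 * (n - 1) / n \<le> ?E X * (2 * \<epsilon>)" by (simp only: mult.commute)
  then have "(1 - \<epsilon>)\<^sup>2 * (n - 1) / n / (2 * \<epsilon>) \<le> ?E X"
    using \<epsilon>(1) by (subst pos_divide_le_eq) simp_all
  moreover have "?E X = measure_pmf.expectation \<pi> (row_queue i)"
    using expectation_slot_law_fst[of P ?r \<pi> "row_queue i"] unfolding X_def[abs_def] by simp
  moreover have "(1 - \<epsilon>)\<^sup>2 * (n - 1) / n / (2 * \<epsilon>) = (1 - \<epsilon>)\<^sup>2 / (2 * \<epsilon>) * (n - 1) / n" by simp
  ultimately show ?thesis by (simp only:)
qed

text \<open>An infinite mean satisfies the bound trivially; a finite one makes every row integrable,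
  as the row estimate requires.\<close>

lemma total_queue_lower_bound:
  fixes \<pi> :: "'n::finite switch_vec pmf"
  assumes \<epsilon>: "0 < \<epsilon>" "\<epsilon> < 1" and P: "scheduling_policy P"
    and st: "stationary (switch_kernel P (uniform_rate \<epsilon>)) \<pi>"
  shows "ennreal ((1 - \<epsilon>)\<^sup>2 / (2 * \<epsilon>) * (real CARD('n) - 1))
     \<le> (\<integral>\<^sup>+q. ennreal (real (total_queue q)) \<partial>measure_pmf \<pi>)"
proof (cases "(\<integral>\<^sup>+q. ennreal (real (total_queue q)) \<partial>measure_pmf \<pi>) < \<infinity>")
  case True
  let ?n = "real CARD('n)"
  have n: "1 \<le> ?n" by (simp add: Suc_leI)
  have iT: "integrable (measure_pmf \<pi>) (\<lambda>q. real (total_queue q))"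
    using True by (intro integrableI_bounded) auto
  have i: "integrable (measure_pmf \<pi>) (row_queue i)" for i
  proof (rule Bochner_Integration.integrable_bound[OF iT])
    have "row_queue i q \<le> real (total_queue q)" for q
      unfolding sum_row_queue[symmetric] by (intro member_le_sum) (auto simp: row_queue_nonneg)
    then show "AE q in measure_pmf \<pi>. norm (row_queue i q) \<le> norm (real (total_queue q))"
      by (simp add: row_queue_nonneg)
  qed simp
  have "(1 - \<epsilon>)\<^sup>2 / (2 * \<epsilon>) * (?n - 1) = (\<Sum>i\<in>(UNIV :: 'n set). (1 - \<epsilon>)\<^sup>2 / (2 * \<epsilon>) * (?n - 1) / ?n)"
    using n by simp
  also have "\<dots> \<le> (\<Sum>i\<in>UNIV. measure_pmf.expectation \<pi> (row_queue i))"
    by (intro sum_mono row_queue_lower_bound[OF \<epsilon> P st i])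
  also have "\<dots> = measure_pmf.expectation \<pi> (\<lambda>q. real (total_queue q))"
    unfolding sum_row_queue[symmetric] by (rule Bochner_Integration.integral_sum[symmetric]) (rule i)
  finally have "ennreal ((1 - \<epsilon>)\<^sup>2 / (2 * \<epsilon>) * (?n - 1)) \<le> ennreal (measure_pmf.expectation \<pi> (\<lambda>q. real (total_queue q)))"
    by (rule ennreal_leI)
  also have "\<dots> = (\<integral>\<^sup>+q. ennreal (real (total_queue q)) \<partial>measure_pmf \<pi>)"
    by (rule nn_integral_eq_integral[OF iT, symmetric]) simp
  finally show ?thesis .
qed (simp add: less_top[symmetric])

section \<open>The heavy traffic limit\<close>

text \<open>Multiplied by \<epsilon>, the only delicate term becomes \<epsilon> powr (1 - 1/r), with
  a positive exponent.\<close>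

lemma B_bounds_little_o:
  assumes r: "2 \<le> r"
  shows "B1_bound n r \<in> o[at_right 0](\<lambda>\<epsilon>. 1 / \<epsilon>)" and "B2_bound n r \<in> o[at_right 0](\<lambda>\<epsilon>. 1 / \<epsilon>)"
proof -
  have e: "0 < 1 - 1 / real r" using r by simp
  have id0: "((\<lambda>\<epsilon>::real. \<epsilon>) \<longlongrightarrow> 0) (at_right 0)" by (rule tendsto_ident_at)
  have pw: "((\<lambda>\<epsilon>::real. \<epsilon> powr (1 - 1 / real r)) \<longlongrightarrow> 0) (at_right 0)"
  proof -
    have "((\<lambda>\<epsilon>::real. \<epsilon> powr (1 - 1 / real r)) \<longlongrightarrow> 0 powr (1 - 1 / real r)) (at_right 0)"
      using e by (intro tendsto_powr2 id0 tendsto_const) (auto simp: eventually_at_right_less intro: eventually_mono[OF eventually_at_right_less[of 0]])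
    then show ?thesis by simp
  qed
  have gen: "(\<lambda>\<epsilon>. (1 - \<epsilon> / 2) * a + b + c * \<epsilon> powr (- 1 / real r)) \<in> o[at_right 0](\<lambda>\<epsilon>. 1 / \<epsilon>)" for a b c :: real
  proof (rule smalloI_tendsto)
    have "((\<lambda>\<epsilon>. (1 - \<epsilon> / 2) * a * \<epsilon> + b * \<epsilon> + c * \<epsilon> powr (1 - 1 / real r))
       \<longlongrightarrow> (1 - 0 / 2) * a * 0 + b * 0 + c * 0) (at_right 0)"
      by (intro tendsto_intros id0 pw) auto
    moreover have "\<forall>\<^sub>F \<epsilon> in at_right 0. (1 - \<epsilon> / 2) * a * \<epsilon> + b * \<epsilon> + c * \<epsilon> powr (1 - 1 / real r)
        = ((1 - \<epsilon> / 2) * a + b + c * \<epsilon> powr (- 1 / real r)) / (1 / \<epsilon>)"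
      using eventually_at_right_less[of 0]
    proof eventually_elim
      case (elim \<epsilon>)
      have "\<epsilon> powr (1 - 1 / real r) = \<epsilon> * \<epsilon> powr (- 1 / real r)"
        using powr_add[of \<epsilon> 1 "- 1 / real r"] elim by simp
      then show ?case by (simp add: algebra_simps)
    qed
    ultimately show "((\<lambda>\<epsilon>. ((1 - \<epsilon> / 2) * a + b + c * \<epsilon> powr (- 1 / real r)) / (1 / \<epsilon>)) \<longlongrightarrow> 0) (at_right 0)"
      by (simp add: tendsto_cong)
    show "\<forall>\<^sub>F \<epsilon>::real in at_right 0. 1 / \<epsilon> \<noteq> 0"
      using eventually_at_right_less[of 0] by eventually_elim simp
  qed
  have "B1_bound n r = (\<lambda>\<epsilon>. (1 - \<epsilon> / 2) * (real n - 2 + 1 / real n) + (real n - 1 / 2)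
      + (3 * real n powr (2 - 1 / real r) * M_bound n r) * \<epsilon> powr (- 1 / real r))"
    by (rule ext) (simp add: B1_bound_def)
  then show "B1_bound n r \<in> o[at_right 0](\<lambda>\<epsilon>. 1 / \<epsilon>)" by (simp only: gen)
  have "B2_bound n r = (\<lambda>\<epsilon>. (1 - \<epsilon> / 2) * (- (real n - 2 + 1 / real n)) + (real n + 1) / 2
      + (2 * real n powr (2 - 1 / real r) * M_bound n r) * \<epsilon> powr (- 1 / real r))"
    by (rule ext) (simp add: B2_bound_def algebra_simps)
  then show "B2_bound n r \<in> o[at_right 0](\<lambda>\<epsilon>. 1 / \<epsilon>)" by (simp only: gen)
qed

lemma scaled_little_o_tendsto:
  assumes "B \<in> o[at_right 0](\<lambda>\<epsilon>. 1 / \<epsilon> :: real)"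
  shows "((\<lambda>\<epsilon>. \<epsilon> * B \<epsilon>) \<longlongrightarrow> 0) (at_right 0)"
  using smalloD_tendsto[OF assms] by (simp add: mult.commute)

lemma mw_stationary_exists:
  assumes \<epsilon>: "0 < \<epsilon>" "\<epsilon> < 1"
  shows "\<exists>\<pi> :: 'n::finite switch_vec pmf. positive_recurrent_on (mw_kernel \<epsilon>) (accessible (mw_kernel \<epsilon>) `` {0 :: 'n switch_vec}) \<and>
     stationary (mw_kernel \<epsilon>) \<pi> \<and> (\<forall>init. converges_in_distribution (chain_law (mw_kernel \<epsilon>) init) \<pi>)"
proof -
  obtain \<theta> \<gamma> C where
    "geometric_drift (mw_kernel \<epsilon> :: 'n switch_vec \<Rightarrow> _) (\<lambda>q. cosh (\<theta> * norm (real_vec q))) \<gamma> C 0"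
    using mw_geometric_drift[OF \<epsilon>] by blast
  then interpret geometric_drift "mw_kernel \<epsilon> :: 'n switch_vec \<Rightarrow> _"
      "\<lambda>q. cosh (\<theta> * norm (real_vec q))" \<gamma> C 0 .
  obtain \<pi> where st: "stationary (mw_kernel \<epsilon>) \<pi>"
    and conv: "\<And>init (f :: 'n switch_vec \<Rightarrow> real). bounded (range f) \<Longrightarrow>
     (\<lambda>t. measure_pmf.expectation (chain_law (mw_kernel \<epsilon>) init t) f) \<longlonglongrightarrow> measure_pmf.expectation \<pi> f"
    using ergodic by metis
  have dist: "converges_in_distribution (chain_law (mw_kernel \<epsilon>) init) \<pi>" for init
    unfolding converges_in_distribution_def by (intro allI impI conv) (elim conjE)
  show ?thesis by (intro exI[of _ \<pi>] conjI allI positive_recurrent st dist)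
qed

lemma liminf_scaled_lower_bound:
  fixes T :: "real \<Rightarrow> ennreal"
  assumes "\<And>\<epsilon>. 0 < \<epsilon> \<Longrightarrow> \<epsilon> < 1 \<Longrightarrow> ennreal ((1 - \<epsilon>)\<^sup>2 / (2 * \<epsilon>) * c) \<le> T \<epsilon>"
  shows "ennreal (c / 2) \<le> Liminf (at_right 0) (\<lambda>\<epsilon>. ennreal \<epsilon> * T \<epsilon>)"
proof -
  have id0: "((\<lambda>\<epsilon>::real. \<epsilon>) \<longlongrightarrow> 0) (at_right 0)" by (rule tendsto_ident_at)
  have "((\<lambda>\<epsilon>. ennreal ((1 - \<epsilon>)\<^sup>2 / 2 * c)) \<longlongrightarrow> ennreal ((1 - 0)\<^sup>2 / 2 * c)) (at_right 0)"
    by (intro tendsto_ennrealI tendsto_intros id0) auto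
  from lim_imp_Liminf[OF trivial_limit_at_right_real this]
  have "ennreal (c / 2) = Liminf (at_right 0) (\<lambda>\<epsilon>. ennreal ((1 - \<epsilon>)\<^sup>2 / 2 * c))"
    by (simp only: diff_zero power_one mult.commute times_divide_eq_left times_divide_eq_right mult_1)
  also have "\<dots> \<le> Liminf (at_right 0) (\<lambda>\<epsilon>. ennreal \<epsilon> * T \<epsilon>)"
  proof (rule Liminf_mono)
    have "\<forall>\<^sub>F \<epsilon> in at_right (0::real). 0 < \<epsilon> \<and> \<epsilon> < 1"
      unfolding eventually_at_right_field by (intro exI[of _ 1]) auto
    then show "\<forall>\<^sub>F \<epsilon> in at_right 0. ennreal ((1 - \<epsilon>)\<^sup>2 / 2 * c) \<le> ennreal \<epsilon> * T \<epsilon>"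
    proof eventually_elim
      case (elim \<epsilon>)
      have "ennreal ((1 - \<epsilon>)\<^sup>2 / 2 * c) = ennreal (\<epsilon> * ((1 - \<epsilon>)\<^sup>2 / (2 * \<epsilon>) * c))" using elim by simp
      also have "\<dots> = ennreal \<epsilon> * ennreal ((1 - \<epsilon>)\<^sup>2 / (2 * \<epsilon>) * c)" using elim by (intro ennreal_mult') simp
      also have "\<dots> \<le> ennreal \<epsilon> * T \<epsilon>" using assms elim by (intro mult_left_mono) auto
      finally show ?case .
    qed
  qed
  finally show ?thesis .
qed

text \<open>These orders concern the number m of ports tending to infinity, after the limit in
  \<epsilon> has been taken; they express that the scaling is optimal.\<close>

lemma heavy_traffic_constant_order:
  "(\<lambda>m :: nat. real m - 3 / 2 + 1 / (2 * real m)) \<in> O(\<lambda>m. real m)"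
  "(\<lambda>m :: nat. real m - 3 / 2 + 1 / (2 * real m)) \<in> \<Theta>(\<lambda>m. (real m - 1) / 2)"
  by real_asymp+

theorem theorem2:
  fixes n :: nat
  assumes n: "n = CARD('n::finite)"
  shows
    "(\<forall>(P :: 'n switch_policy) (init :: real \<Rightarrow> 'n switch_vec pmf)
        (qbar :: real \<Rightarrow> 'n switch_vec pmf).
        scheduling_policy P \<longrightarrow>
        (\<forall>\<epsilon>\<in>{0<..<1}. switch_stable (chain_law (switch_kernel P (uniform_rate \<epsilon>)) (init \<epsilon>))) \<longrightarrow>
        (\<forall>\<epsilon>\<in>{0<..<1}. converges_in_distribution
            (chain_law (switch_kernel P (uniform_rate \<epsilon>)) (init \<epsilon>)) (qbar \<epsilon>)) \<longrightarrow>
        (\<forall>\<epsilon>\<in>{0<..<1}.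
            ennreal ((1 - \<epsilon>)\<^sup>2 / (2 * \<epsilon>) * (real n - 1))
              \<le> (\<integral>\<^sup>+q. ennreal (real (total_queue q)) \<partial>measure_pmf (qbar \<epsilon>))) \<and>
        ennreal ((real n - 1) / 2)
          \<le> Liminf (at_right 0) (\<lambda>\<epsilon>. ennreal \<epsilon> *
               (\<integral>\<^sup>+q. ennreal (real (total_queue q)) \<partial>measure_pmf (qbar \<epsilon>))))
     \<and>
     (\<exists>qbar :: real \<Rightarrow> 'n switch_vec pmf.
        (\<forall>\<epsilon>\<in>{0<..<1}.
            positive_recurrent_on (switch_kernel max_weight (uniform_rate \<epsilon>))
              (accessible (switch_kernel max_weight (uniform_rate \<epsilon>)) `` {0 :: 'n switch_vec}) \<and>
            stationary (switch_kernel max_weight (uniform_rate \<epsilon>)) (qbar \<epsilon>) \<and>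
            (\<forall>init. converges_in_distribution
               (chain_law (switch_kernel max_weight (uniform_rate \<epsilon>)) init) (qbar \<epsilon>))) \<and>
        (\<forall>\<epsilon>. 0 < \<epsilon> \<and> \<epsilon> \<le> 1 / (2 * real n) \<longrightarrow>
            (\<forall>r\<ge>1.
               integrable (measure_pmf (qbar \<epsilon>)) (\<lambda>q. norm (perp (real_vec q)) ^ r) \<and>
               measure_pmf.expectation (qbar \<epsilon>) (\<lambda>q. norm (perp (real_vec q)) ^ r)
                 \<le> M_bound n r ^ r) \<and>
            integrable (measure_pmf (qbar \<epsilon>)) (\<lambda>q. real (total_queue q)) \<and>
            (\<forall>r\<ge>2.
               1 / \<epsilon> * (real n - 3 / 2 + 1 / (2 * real n)) - B1_bound n r \<epsilon>
                 \<le> measure_pmf.expectation (qbar \<epsilon>) (\<lambda>q. real (total_queue q)) \<and>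
               measure_pmf.expectation (qbar \<epsilon>) (\<lambda>q. real (total_queue q))
                 \<le> 1 / \<epsilon> * (real n - 3 / 2 + 1 / (2 * real n)) + B2_bound n r \<epsilon>)) \<and>
        (\<forall>r\<ge>2. B1_bound n r \<in> o[at_right 0](\<lambda>\<epsilon>. 1 / \<epsilon>) \<and>
                B2_bound n r \<in> o[at_right 0](\<lambda>\<epsilon>. 1 / \<epsilon>)) \<and>
        ((\<lambda>\<epsilon>. \<epsilon> * measure_pmf.expectation (qbar \<epsilon>) (\<lambda>q. real (total_queue q)))
           \<longlongrightarrow> real n - 3 / 2 + 1 / (2 * real n)) (at_right 0) \<and>
        (\<lambda>m :: nat. real m - 3 / 2 + 1 / (2 * real m)) \<in> O(\<lambda>m. real m) \<and>
        (\<lambda>m :: nat. real m - 3 / 2 + 1 / (2 * real m)) \<in> \<Theta>(\<lambda>m. (real m - 1) / 2))"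
  (is "?lower \<and> (\<exists>qbar. ?steady qbar \<and> ?bounds qbar \<and> ?small \<and> ?limit qbar \<and> ?order)")
proof
  show ?lower
  proof (intro allI impI)
    fix P :: "'n switch_policy" and init qbar :: "real \<Rightarrow> 'n switch_vec pmf"
    assume P: "scheduling_policy P" and "\<forall>\<epsilon>\<in>{0<..<1}. converges_in_distribution
            (chain_law (switch_kernel P (uniform_rate \<epsilon>)) (init \<epsilon>)) (qbar \<epsilon>)"
    then have st: "stationary (switch_kernel P (uniform_rate \<epsilon>)) (qbar \<epsilon>)" if "0 < \<epsilon>" "\<epsilon> < 1" for \<epsilon>
      using that by (intro limit_law_stationary[of _ "init \<epsilon>"]) auto
    have "ennreal ((1 - \<epsilon>)\<^sup>2 / (2 * \<epsilon>) * (real n - 1))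
       \<le> (\<integral>\<^sup>+q. ennreal (real (total_queue q)) \<partial>measure_pmf (qbar \<epsilon>))" if "0 < \<epsilon>" "\<epsilon> < 1" for \<epsilon>
      unfolding n by (rule total_queue_lower_bound[OF that P st[OF that]])
    then show "(\<forall>\<epsilon>\<in>{0<..<1}.
            ennreal ((1 - \<epsilon>)\<^sup>2 / (2 * \<epsilon>) * (real n - 1))
              \<le> (\<integral>\<^sup>+q. ennreal (real (total_queue q)) \<partial>measure_pmf (qbar \<epsilon>))) \<and>
        ennreal ((real n - 1) / 2)
          \<le> Liminf (at_right 0) (\<lambda>\<epsilon>. ennreal \<epsilon> *
               (\<integral>\<^sup>+q. ennreal (real (total_queue q)) \<partial>measure_pmf (qbar \<epsilon>)))"
      by (intro conjI ballI liminf_scaled_lower_bound) auto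
  qed
  have n1: "1 \<le> real n" unfolding n by (simp add: Suc_leI)
  have "\<forall>\<epsilon>. \<exists>\<pi> :: 'n switch_vec pmf. 0 < \<epsilon> \<and> \<epsilon> < 1 \<longrightarrow>
     positive_recurrent_on (mw_kernel \<epsilon>) (accessible (mw_kernel \<epsilon>) `` {0 :: 'n switch_vec}) \<and>
     stationary (mw_kernel \<epsilon>) \<pi> \<and> (\<forall>init. converges_in_distribution (chain_law (mw_kernel \<epsilon>) init) \<pi>)"
    using mw_stationary_exists by blast
  then obtain qbar :: "real \<Rightarrow> 'n switch_vec pmf" where qbar: "\<And>\<epsilon>. 0 < \<epsilon> \<Longrightarrow> \<epsilon> < 1 \<Longrightarrow>
     positive_recurrent_on (mw_kernel \<epsilon>) (accessible (mw_kernel \<epsilon>) `` {0 :: 'n switch_vec}) \<and>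
     stationary (mw_kernel \<epsilon>) (qbar \<epsilon>) \<and> (\<forall>init. converges_in_distribution (chain_law (mw_kernel \<epsilon>) init) (qbar \<epsilon>))"
    by metis
  let ?ET = "\<lambda>\<epsilon>. measure_pmf.expectation (qbar \<epsilon>) (\<lambda>q. real (total_queue q))"
  let ?c = "real n - 3 / 2 + 1 / (2 * real n)"
  \<comment> \<open>The condition \<epsilon> < 1 is automatic, as 1 / (2n) is at most 1/2.\<close>
  have small: "0 < \<epsilon> \<and> \<epsilon> < 1 \<and> \<epsilon> \<le> 1 / (2 * real CARD('n))" if "0 < \<epsilon> \<and> \<epsilon> \<le> 1 / (2 * real n)" for \<epsilon>
  proof -
    have "1 / (2 * real n) \<le> 1 / 2" using n1 by (simp add: field_simps)
    then show ?thesis using that unfolding n by linarith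
  qed
  have sandwich: "1 / \<epsilon> * ?c - B1_bound n r \<epsilon> \<le> ?ET \<epsilon> \<and> ?ET \<epsilon> \<le> 1 / \<epsilon> * ?c + B2_bound n r \<epsilon>"
    if "0 < \<epsilon> \<and> \<epsilon> \<le> 1 / (2 * real n)" "2 \<le> r" for \<epsilon> r
    using small[OF that(1)] qbar[of \<epsilon>] that(2) unfolding n
    by (intro conjI mw_heavy_traffic_bounds) auto
  have bounds: "?bounds qbar"
  proof (intro allI impI)
    fix \<epsilon> assume \<epsilon>: "0 < \<epsilon> \<and> \<epsilon> \<le> 1 / (2 * real n)"
    note e = small[OF \<epsilon>, THEN conjunct1] small[OF \<epsilon>, THEN conjunct2, THEN conjunct1]
      small[OF \<epsilon>, THEN conjunct2, THEN conjunct2]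
    have st: "stationary (mw_kernel \<epsilon>) (qbar \<epsilon>)" using qbar[OF e(1,2)] by blast
    show "(\<forall>r\<ge>1.
               integrable (measure_pmf (qbar \<epsilon>)) (\<lambda>q. norm (perp (real_vec q)) ^ r) \<and>
               measure_pmf.expectation (qbar \<epsilon>) (\<lambda>q. norm (perp (real_vec q)) ^ r)
                 \<le> M_bound n r ^ r) \<and>
            integrable (measure_pmf (qbar \<epsilon>)) (\<lambda>q. real (total_queue q)) \<and>
            (\<forall>r\<ge>2.
               1 / \<epsilon> * (real n - 3 / 2 + 1 / (2 * real n)) - B1_bound n r \<epsilon>
                 \<le> measure_pmf.expectation (qbar \<epsilon>) (\<lambda>q. real (total_queue q)) \<and>
               measure_pmf.expectation (qbar \<epsilon>) (\<lambda>q. real (total_queue q))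
                 \<le> 1 / \<epsilon> * (real n - 3 / 2 + 1 / (2 * real n)) + B2_bound n r \<epsilon>)"
      using mw_perp_moment[OF e st] mw_stationary_first_moment[OF e(1,2) st] sandwich[OF \<epsilon>]
      unfolding n by blast
  qed
  have o: "?small" using B_bounds_little_o by blast
  have limit: "?limit qbar"
  proof (rule tendsto_sandwich)
    \<comment> \<open>For the limit any single exponent will do; r = 2 is taken.\<close>
    have ev: "\<forall>\<^sub>F \<epsilon> in at_right (0::real). 0 < \<epsilon> \<and> \<epsilon> \<le> 1 / (2 * real n)"
      unfolding eventually_at_right_field using n1 by (intro exI[of _ "1 / (2 * real n)"]) auto
    show "\<forall>\<^sub>F \<epsilon> in at_right 0. ?c - \<epsilon> * B1_bound n 2 \<epsilon> \<le> \<epsilon> * ?ET \<epsilon>"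
      using ev
    proof eventually_elim
      case (elim \<epsilon>)
      have "\<epsilon> * (1 / \<epsilon> * ?c - B1_bound n 2 \<epsilon>) \<le> \<epsilon> * ?ET \<epsilon>"
        using sandwich[OF elim, of 2] elim by (intro mult_left_mono) auto
      then show ?case using elim by (simp add: right_diff_distrib)
    qed
    show "\<forall>\<^sub>F \<epsilon> in at_right 0. \<epsilon> * ?ET \<epsilon> \<le> ?c + \<epsilon> * B2_bound n 2 \<epsilon>"
      using ev
    proof eventually_elim
      case (elim \<epsilon>)
      have "\<epsilon> * ?ET \<epsilon> \<le> \<epsilon> * (1 / \<epsilon> * ?c + B2_bound n 2 \<epsilon>)"
        using sandwich[OF elim, of 2] elim by (intro mult_left_mono) auto
      then show ?case using elim by (simp add: distrib_left)
    qed
    have "((\<lambda>\<epsilon>. ?c - \<epsilon> * B1_bound n 2 \<epsilon>) \<longlongrightarrow> ?c - 0) (at_right 0)"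
      by (intro tendsto_diff tendsto_const scaled_little_o_tendsto B_bounds_little_o) simp
    then show "((\<lambda>\<epsilon>. ?c - \<epsilon> * B1_bound n 2 \<epsilon>) \<longlongrightarrow> ?c) (at_right 0)" by simp
    have "((\<lambda>\<epsilon>. ?c + \<epsilon> * B2_bound n 2 \<epsilon>) \<longlongrightarrow> ?c + 0) (at_right 0)"
      by (intro tendsto_add tendsto_const scaled_little_o_tendsto B_bounds_little_o) simp
    then show "((\<lambda>\<epsilon>. ?c + \<epsilon> * B2_bound n 2 \<epsilon>) \<longlongrightarrow> ?c) (at_right 0)" by simp
  qed
  have "?steady qbar" using qbar by auto
  then show "\<exists>qbar. ?steady qbar \<and> ?bounds qbar \<and> ?small \<and> ?limit qbar \<and> ?order"
    using bounds o limit heavy_traffic_constant_order by (intro exI[of _ qbar] conjI)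
qed

end
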